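(* Let $(\Omega,\mathcal{F},P)$ be a complete probability space, let $F=(\mathcal{F}_t)_{t\in[0,\infty)}$ be an augmented filtration on it (not necessarily right-continuous), and let $W$ be a one-dimensional standard Wiener process with respect to $F$. Then there exists a unique stochastic integral mapping $I:\mathcal{L}^2\to\mathcal{C}$, that is, a unique mapping $I:\mathcal{L}^2\to\mathcal{C}$ having the following two properties: 1. (Integrals of simple processes) Whenever $b\in\mathcal{L}^2$ is simple, $t\in[0,\infty)$, and $0=t_0<t_1<\cdots<t_n\le t$ is a finite sequence of times such that \[ b=b(t_0)1_{\{0\}}+\sum_{i=1}^{n}b(t_i)1_{(t_{i-1},t_i]}, \] then \[ I(b)(t)=\sum_{i=1}^{n}b(t_i)\,(W(t_i)-W(t_{i-1})) \] with probability one. 2. (Convergence in probability) Whenever $t\in[0,\infty)$, $b\in\mathcal{L}^2$, and $(b_n)$ is a sequence of simple processes in $\mathcal{H}^2$ such that \[ \int_0^t (b-b_n)^2\,ds\to 0 \] in probability, then $I(b_n)(t)\to I(b)(t)$ in probability.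
   Context: All processes are one-dimensional (real-valued) and indexed by time $[0,\infty)$, on the given probability space. A filtration is augmented if each $\mathcal{F}_t$ contains all $P$-null sets of $\mathcal{F}$. A standard Wiener process with respect to $F$ is a continuous process $W$ adapted to $F$ with $W(0)=0$ such that for $0\le s<t$ the increment $W(t)-W(s)$ is independent of $\mathcal{F}_s$ and normally distributed with mean $0$ and variance $t-s$. "Adapted" means adapted to $F$; "measurable" means jointly measurable in $(\omega,t)$. $\mathcal{L}^2$ is the set of measurable and adapted processes $b$ that are pathwise locally square integrable with probability one: for every $t\in[0,\infty)$, $P\left(\int_0^t b^2\,ds<\infty\right)=1$. $\mathcal{H}^2\subset\mathcal{L}^2$ is the set of measurable and adapted processes $b$ such that $\mathbb{E}\int_0^t b^2\,ds<\infty$ for every $t\in[0,\infty)$. A process $b$ is simple if there exists a finite sequence of times $0=t_0<t_1<\cdots<t_n$ such that \[ b=b(t_0)1_{\{0\}}+\sum_{i=1}^{n}b(t_i)1_{(t_{i-1},t_i]} \] and such that $b(t_0)$ is $\mathcal{F}_0$-measurable and, for each $i=1,\ldots,n$, $b(t_i)$ is $\mathcal{F}_{t_{i-1}}$-measurable. $\mathcal{C}$ is the set of adapted continuous processes, where two such processes are identified if they are indistinguishable (so uniqueness of $I$ means that for each $b \in \mathcal{L}^2$ the process $I(b)$ is unique up to indistinguishability). *)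

theory Defs
  imports "HOL-Probability.Probability"
begin

text \<open>
  A process is a function \<open>X :: real \<Rightarrow> 'a \<Rightarrow> real\<close>, written time first; only its values at
  times \<open>t \<ge> 0\<close> and at points of \<open>space M\<close> are constrained or used. A filtration is likewise a
  family \<open>F\<close> of which only the members \<open>F t\<close> with \<open>t \<ge> 0\<close> matter; this is why the
  library locale \<open>filtration\<close>, whose axioms range over the whole index type, is not used.
  Each \<open>F t\<close> stands for a sub-sigma-algebra of \<open>M\<close>; its measure plays no role.
\<close>

type_synonym 'a process = "real \<Rightarrow> 'a \<Rightarrow> real"

definition augmented_filtration :: "'a measure \<Rightarrow> (real \<Rightarrow> 'a measure) \<Rightarrow> bool" where
  "augmented_filtration M F \<longleftrightarrow>
     (\<forall>t\<ge>0. subalgebra M (F t)) \<and>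
     (\<forall>s t. 0 \<le> s \<and> s \<le> t \<longrightarrow> sets (F s) \<subseteq> sets (F t)) \<and>
     (\<forall>t\<ge>0. null_sets M \<subseteq> sets (F t))"

definition adapted :: "(real \<Rightarrow> 'a measure) \<Rightarrow> 'a process \<Rightarrow> bool" where
  "adapted F X \<longleftrightarrow> (\<forall>t\<ge>0. X t \<in> borel_measurable (F t))"

definition jointly_measurable :: "'a measure \<Rightarrow> 'a process \<Rightarrow> bool" where
  "jointly_measurable M X \<longleftrightarrow>
     (\<lambda>(\<omega>, t). X t \<omega>) \<in> borel_measurable (M \<Otimes>\<^sub>M restrict_space borel {0..})"

definition continuous_process :: "'a measure \<Rightarrow> 'a process \<Rightarrow> bool" where
  "continuous_process M X \<longleftrightarrow> (\<forall>\<omega>\<in>space M. continuous_on {0..} (\<lambda>t. X t \<omega>))"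

definition indistinguishable :: "'a measure \<Rightarrow> 'a process \<Rightarrow> 'a process \<Rightarrow> bool" where
  "indistinguishable M X Y \<longleftrightarrow> (AE \<omega> in M. \<forall>t\<ge>0. X t \<omega> = Y t \<omega>)"

text \<open>The second parameter of \<^const>\<open>normal_density\<close> is the standard deviation.\<close>

definition standard_Wiener_process ::
    "'a measure \<Rightarrow> (real \<Rightarrow> 'a measure) \<Rightarrow> 'a process \<Rightarrow> bool" where
  "standard_Wiener_process M F W \<longleftrightarrow>
     continuous_process M W \<and> adapted F W \<and> (\<forall>\<omega>\<in>space M. W 0 \<omega> = 0) \<and>
     (\<forall>s t. 0 \<le> s \<and> s < t \<longrightarrow>
        prob_space.indep_set M
          (sets (vimage_algebra (space M) (\<lambda>\<omega>. W t \<omega> - W s \<omega>) borel)) (sets (F s)) \<and>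
        distributed M lborel (\<lambda>\<omega>. W t \<omega> - W s \<omega>) (normal_density 0 (sqrt (t - s))))"

definition L2_processes :: "'a measure \<Rightarrow> (real \<Rightarrow> 'a measure) \<Rightarrow> 'a process set" where
  "L2_processes M F = {b. jointly_measurable M b \<and> adapted F b \<and>
     (\<forall>t\<ge>0. AE \<omega> in M. (\<integral>\<^sup>+s\<in>{0..t}. ennreal ((b s \<omega>)\<^sup>2) \<partial>lborel) < \<infinity>)}"

definition H2_processes :: "'a measure \<Rightarrow> (real \<Rightarrow> 'a measure) \<Rightarrow> 'a process set" where
  "H2_processes M F = {b. jointly_measurable M b \<and> adapted F b \<and>
     (\<forall>t\<ge>0. (\<integral>\<^sup>+\<omega>. (\<integral>\<^sup>+s\<in>{0..t}. ennreal ((b s \<omega>)\<^sup>2) \<partial>lborel) \<partial>M) < \<infinity>)}"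

text \<open>
  The target space of the integral, before identification of indistinguishable processes. The
  identification is expressed by stating uniqueness up to \<^const>\<open>indistinguishable\<close>.
\<close>

definition continuous_adapted_processes ::
    "'a measure \<Rightarrow> (real \<Rightarrow> 'a measure) \<Rightarrow> 'a process set" where
  "continuous_adapted_processes M F = {X. adapted F X \<and> continuous_process M X}"

text \<open>
  \<open>step_representation M b n \<tau>\<close>: the times \<open>0 = \<tau> 0 < \<dots> < \<tau> n\<close> represent \<open>b\<close> as a step process.
  The case \<open>n = 0\<close>, in which \<open>b\<close> vanishes at all positive times, is allowed.
\<close>

definition step_representation ::
    "'a measure \<Rightarrow> 'a process \<Rightarrow> nat \<Rightarrow> (nat \<Rightarrow> real) \<Rightarrow> bool" where
  "step_representation M b n \<tau> \<longleftrightarrow>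
     \<tau> 0 = 0 \<and> strict_mono_on {0..n} \<tau> \<and>
     (\<forall>\<omega>\<in>space M. \<forall>s\<ge>0.
        b s \<omega> = b (\<tau> 0) \<omega> * indicator {0} s +
          (\<Sum>i=1..n. b (\<tau> i) \<omega> * indicator {\<tau> (i - 1)<..\<tau> i} s))"

definition simple_process ::
    "'a measure \<Rightarrow> (real \<Rightarrow> 'a measure) \<Rightarrow> 'a process \<Rightarrow> bool" where
  "simple_process M F b \<longleftrightarrow>
     (\<exists>n \<tau>. step_representation M b n \<tau> \<and>
        b (\<tau> 0) \<in> borel_measurable (F 0) \<and>
        (\<forall>i\<in>{1..n}. b (\<tau> i) \<in> borel_measurable (F (\<tau> (i - 1)))))"

definition converges_in_probability ::
    "'a measure \<Rightarrow> (nat \<Rightarrow> 'a \<Rightarrow> real) \<Rightarrow> ('a \<Rightarrow> real) \<Rightarrow> bool" where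
  "converges_in_probability M X Y \<longleftrightarrow>
     (\<forall>\<epsilon>>0. (\<lambda>n. \<P>(\<omega> in M. \<bar>X n \<omega> - Y \<omega>\<bar> > \<epsilon>)) \<longlonglongrightarrow> 0)"

text \<open>
  In the convergence property the inner Bochner integral is only meaningful for those \<open>\<omega>\<close> for
  which \<open>(b - b\<^sub>n)\<^sup>2\<close> is integrable on \<open>[0, t]\<close>; as \<open>b\<close> and \<open>b\<^sub>n\<close> are almost
  surely square integrable there, this is the case with probability one.
\<close>

definition stochastic_integral_mapping ::
    "'a measure \<Rightarrow> (real \<Rightarrow> 'a measure) \<Rightarrow> 'a process \<Rightarrow> ('a process \<Rightarrow> 'a process) \<Rightarrow> bool" where
  "stochastic_integral_mapping M F W I \<longleftrightarrow>
     I \<in> L2_processes M F \<rightarrow> continuous_adapted_processes M F \<and>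
     (\<forall>b t n \<tau>.
        b \<in> L2_processes M F \<and> simple_process M F b \<and> 0 \<le> t \<and>
        step_representation M b n \<tau> \<and> \<tau> n \<le> t \<longrightarrow>
          (AE \<omega> in M. I b t \<omega> = (\<Sum>i=1..n. b (\<tau> i) \<omega> * (W (\<tau> i) \<omega> - W (\<tau> (i - 1)) \<omega>)))) \<and>
     (\<forall>t b B.
        0 \<le> t \<and> b \<in> L2_processes M F \<and>
        (\<forall>n. simple_process M F (B n) \<and> B n \<in> H2_processes M F) \<and>
        converges_in_probability M
          (\<lambda>n \<omega>. \<integral>s\<in>{0..t}. (b s \<omega> - B n s \<omega>)\<^sup>2 \<partial>lborel) (\<lambda>\<omega>. 0) \<longrightarrow>
          converges_in_probability M (\<lambda>n. I (B n) t) (I b t))"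

end

theory Submission
  imports Defs
begin

text \<open>
  For simple \<open>b\<close> the elementary integral \<open>E(b)\<close> satisfies Lenglart's inequality
  \<open>P(sup {|E(b)(s)| : s \<le> T} > \<epsilon>) \<le> P(\<integral>\<^sub>0\<^sup>T b\<^sup>2 > \<delta>) + \<delta>/\<epsilon>\<^sup>2\<close>, proved by stopping a discrete
  martingale transform. Hence \<open>E\<close> extends continuously from the simple processes to their closure
  with respect to convergence in probability of \<open>\<integral>\<^sub>0\<^sup>T (b - c)\<^sup>2\<close>, and along a fast sequence the
  convergence is almost surely locally uniform, which yields continuous paths.

  The closure is all of \<open>L2_processes M F\<close>: truncation reduces to bounded \<open>b\<close>, and a bounded adapted measurable
  process is approximated by sampling it at the left end points of a grid of mesh \<open>h\<close> shifted by
  \<open>s\<close>. Averaging the error over \<open>s \<in> (0,h)\<close> gives the \<open>L\<^sup>2\<close>-modulus of continuity of translations,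
  so some shift is good. Unlike averaging in time, sampling keeps the process adapted without any
  progressive measurability.
\<close>

section \<open>Step functions\<close>

text \<open>Everything that does not involve probability is done path by path: the elementary
  integral depends only on one path of the integrator and one path of the integrand, so independence
  of the chosen times and linearity are deterministic facts about common refinements. The filtration
  is merely augmented, and this is where augmentation enters: the limit is a series that converges
  only off a null set. That set belongs to every \<open>F t\<close>, so the limit may be put equal
  to 0 on it and stays adapted. The times of a simple process are deterministic, so a single shift
  must serve all \<omega>. Hence the error is averaged over the shift only after taking
  expectations, and translation continuity, which holds path by path, enters through dominated
  convergence. For uniqueness, the first property prescribes the integral of a simple process at t
  only when its last time is at most t. This is why the approximation results also return a grid
  inside [0,T]. The limit process is specified against all approximating sequences at once, so that
  both properties of the mapping can be read off it.\<close>

definition grid :: "nat \<Rightarrow> (nat \<Rightarrow> real) \<Rightarrow> bool" where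
  "grid n \<tau> \<longleftrightarrow> \<tau> 0 = 0 \<and> strict_mono_on {0..n} \<tau>"

text \<open>Being constant on cells, rather than being a sum of indicators, is the form that passes
  directly to finer grids. The value at 0 is left free: it affects neither the integral nor the
  quadratic integral.\<close>

definition step_fun :: "(real \<Rightarrow> real) \<Rightarrow> nat \<Rightarrow> (nat \<Rightarrow> real) \<Rightarrow> bool" where
  "step_fun f n \<tau> \<longleftrightarrow> grid n \<tau> \<and>
     (\<forall>i<n. \<forall>s. \<tau> i < s \<and> s \<le> \<tau> (Suc i) \<longrightarrow> f s = f (\<tau> (Suc i))) \<and> (\<forall>s>\<tau> n. f s = 0)"

text \<open>Both ends of each cell are cut at t, so cells after t contribute 0 and one formula over
  the whole grid gives the integral up to any t.\<close>

definition step_sum :: "(real \<Rightarrow> real) \<Rightarrow> (real \<Rightarrow> real) \<Rightarrow> nat \<Rightarrow> (nat \<Rightarrow> real) \<Rightarrow> real \<Rightarrow> real" where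
  "step_sum w f n \<tau> t = (\<Sum>i<n. f (\<tau> (Suc i)) * (w (min (\<tau> (Suc i)) t) - w (min (\<tau> i) t)))"

lemma step_fun_grid: "step_fun f n \<tau> \<Longrightarrow> grid n \<tau>"
  by (simp add: step_fun_def)

lemma grid_less: "grid n \<tau> \<Longrightarrow> i < j \<Longrightarrow> j \<le> n \<Longrightarrow> \<tau> i < \<tau> j"
  unfolding grid_def strict_mono_on_def by auto

lemma grid_le: "grid n \<tau> \<Longrightarrow> i \<le> j \<Longrightarrow> j \<le> n \<Longrightarrow> \<tau> i \<le> \<tau> j"
  using grid_less[of n \<tau> i j] by (cases "i = j") auto

lemma grid_nonneg: "grid n \<tau> \<Longrightarrow> i \<le> n \<Longrightarrow> 0 \<le> \<tau> i"
  using grid_le[of n \<tau> 0 i] by (simp add: grid_def)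

lemma grid_zero: "grid n \<tau> \<Longrightarrow> \<tau> 0 = 0"
  by (simp add: grid_def)

lemma grid_cell:
  assumes "grid n \<tau>" "0 < s" "s \<le> \<tau> n"
  obtains i where "i < n" "\<tau> i < s" "s \<le> \<tau> (Suc i)"
proof -
  define j where "j = (LEAST j. s \<le> \<tau> j)"
  have j: "s \<le> \<tau> j" "j \<le> n"
    unfolding j_def using assms(3) by (auto intro: LeastI Least_le)
  obtain i where i: "j = Suc i"
    using j assms(1,2) by (cases j) (auto simp: grid_def)
  have "\<not> s \<le> \<tau> i"
    using not_less_Least[of i "\<lambda>j. s \<le> \<tau> j"] i unfolding j_def by auto
  then show thesis using i j by (intro that[of i]) auto
qed

lemma grid_between:
  assumes "grid n \<tau>" "j \<le> n" "i < n" shows "\<not> (\<tau> i < \<tau> j \<and> \<tau> j < \<tau> (Suc i))"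
proof (cases "j \<le> i")
  case True then show ?thesis using grid_le[of n \<tau> j i] assms by auto
next
  case False then show ?thesis using grid_le[of n \<tau> "Suc i" j] assms by auto
qed

text \<open>Only the summand of cell i distinguishes r from s: earlier cells are already complete at
  r, and in later cells both ends are cut to the same time.\<close>

lemma step_sum_cell:
  assumes g: "grid n \<tau>" and i: "i < n" and r: "\<tau> i \<le> r" "r \<le> s" "s \<le> \<tau> (Suc i)"
  shows "step_sum w f n \<tau> s - step_sum w f n \<tau> r = f (\<tau> (Suc i)) * (w s - w r)"
proof -
  have "step_sum w f n \<tau> s - step_sum w f n \<tau> r =
    (\<Sum>j<n. if j = i then f (\<tau> (Suc i)) * (w s - w r) else 0)"
    unfolding step_sum_def sum_subtractf[symmetric]
  proof (rule sum.cong[OF refl])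
    fix j assume "j \<in> {..<n}"
    then have j: "j < n" by simp
    consider "j < i" | "j = i" | "i < j" by linarith
    then show "f (\<tau> (Suc j)) * (w (min (\<tau> (Suc j)) s) - w (min (\<tau> j) s)) -
        f (\<tau> (Suc j)) * (w (min (\<tau> (Suc j)) r) - w (min (\<tau> j) r)) =
        (if j = i then f (\<tau> (Suc i)) * (w s - w r) else 0)"
    proof cases
      case 1
      then have "\<tau> (Suc j) \<le> \<tau> i" "\<tau> j \<le> \<tau> i"
        using i by (auto intro!: grid_le[OF g])
      then show ?thesis using 1 r by (simp add: min_def)
    next
      case 2
      then show ?thesis using r by (auto simp: min_def algebra_simps)
    next
      case 3
      then have "\<tau> (Suc i) \<le> \<tau> j" "\<tau> (Suc i) \<le> \<tau> (Suc j)"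
        using j by (auto intro!: grid_le[OF g])
      then have "min (\<tau> j) s = s" "min (\<tau> j) r = r" "min (\<tau> (Suc j)) s = s" "min (\<tau> (Suc j)) r = r"
        using r by auto
      then show ?thesis using 3 by simp
    qed
  qed
  also have "\<dots> = f (\<tau> (Suc i)) * (w s - w r)"
    using i by simp
  finally show ?thesis .
qed

lemma step_sum_beyond:
  assumes g: "grid n \<tau>" and "\<tau> n \<le> r"
  shows "step_sum w f n \<tau> r = (\<Sum>i<n. f (\<tau> (Suc i)) * (w (\<tau> (Suc i)) - w (\<tau> i)))"
  unfolding step_sum_def
proof (rule sum.cong[OF refl])
  fix j assume "j \<in> {..<n}"
  then have "\<tau> (Suc j) \<le> \<tau> n" "\<tau> j \<le> \<tau> n" by (auto intro!: grid_le[OF g])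
  then show "f (\<tau> (Suc j)) * (w (min (\<tau> (Suc j)) r) - w (min (\<tau> j) r)) =
    f (\<tau> (Suc j)) * (w (\<tau> (Suc j)) - w (\<tau> j))"
    using assms(2) by (simp add: min_def)
qed

lemma step_sum_0: "grid n \<tau> \<Longrightarrow> step_sum w f n \<tau> 0 = 0"
  unfolding step_sum_def
proof (intro sum.neutral ballI)
  fix i assume g: "grid n \<tau>" and "i \<in> {..<n}"
  then show "f (\<tau> (Suc i)) * (w (min (\<tau> (Suc i)) 0) - w (min (\<tau> i) 0)) = 0"
    using grid_nonneg[OF g, of i] grid_nonneg[OF g, of "Suc i"] by (simp add: min.absorb2)
qed

text \<open>Points of \<tau> need not be points of x; they are only kept out of the open cells of x.
  This admits grids x that stop before \<tau> does, as in \<open>refinement_upto\<close>.\<close>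

definition grid_refines :: "nat \<Rightarrow> (nat \<Rightarrow> real) \<Rightarrow> nat \<Rightarrow> (nat \<Rightarrow> real) \<Rightarrow> bool" where
  "grid_refines N x n \<tau> \<longleftrightarrow> grid N x \<and> (\<forall>k<N. \<forall>i\<le>n. \<not> (x k < \<tau> i \<and> \<tau> i < x (Suc k)))"

lemma refinesD: "grid_refines N x n \<tau> \<Longrightarrow> k < N \<Longrightarrow> i \<le> n \<Longrightarrow> \<tau> i < x (Suc k) \<Longrightarrow> \<tau> i \<le> x k"
  unfolding grid_refines_def by (meson not_le)

text \<open>The dichotomy behind all refinement arguments: on a cell of x a step function for \<tau>
  is either constant with the value of one cell of \<tau>, or zero because the grid \<tau> has
  ended.\<close>

lemma refines_cell:
  assumes g: "grid n \<tau>" and x: "grid_refines N x n \<tau>" and k: "k < N"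
  shows "(\<exists>i<n. \<tau> i \<le> x k \<and> x (Suc k) \<le> \<tau> (Suc i)) \<or> \<tau> n \<le> x k"
proof (cases "x (Suc k) \<le> \<tau> n")
  case True
  have "0 < x (Suc k)" using x k grid_less[of N x 0 "Suc k"] grid_zero[of N x] unfolding grid_refines_def by simp
  from grid_cell[OF g this True] obtain i where i: "i < n" "\<tau> i < x (Suc k)" "x (Suc k) \<le> \<tau> (Suc i)" .
  then have "\<tau> i \<le> x k" using refinesD[OF x k, of i] by simp
  with i show ?thesis by auto
next
  case False
  then show ?thesis using refinesD[OF x k, of n] by simp
qed

lemma refines_const:
  assumes f: "step_fun f n \<tau>" and x: "grid_refines N x n \<tau>" and k: "k < N" "x k < s" "s \<le> x (Suc k)"
  shows "f s = f (x (Suc k))"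
proof -
  have g: "grid n \<tau>" using f by (rule step_fun_grid)
  from refines_cell[OF g x k(1)] show ?thesis
  proof
    assume "\<exists>i<n. \<tau> i \<le> x k \<and> x (Suc k) \<le> \<tau> (Suc i)"
    then obtain i where i: "i < n" "\<tau> i \<le> x k" "x (Suc k) \<le> \<tau> (Suc i)" by auto
    have c: "\<And>s. \<tau> i < s \<Longrightarrow> s \<le> \<tau> (Suc i) \<Longrightarrow> f s = f (\<tau> (Suc i))"
      using f i(1) unfolding step_fun_def by blast
    have "f s = f (\<tau> (Suc i))" by (rule c) (use i k in linarith)+
    moreover have "f (x (Suc k)) = f (\<tau> (Suc i))" by (rule c) (use i k in linarith)+
    ultimately show ?thesis by simp
  next
    assume "\<tau> n \<le> x k"
    then have "\<tau> n < s" "\<tau> n < x (Suc k)" using k by linarith+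
    then have "f s = 0" "f (x (Suc k)) = 0" using f unfolding step_fun_def by blast+
    then show ?thesis by simp
  qed
qed

lemma refines_step_fun:
  assumes f: "step_fun f n \<tau>" and x: "grid_refines N x n \<tau>" and "\<tau> n \<le> x N"
  shows "step_fun f N x"
  unfolding step_fun_def
proof (intro conjI allI impI)
  show "grid N x" using x by (simp add: grid_refines_def)
  show "f s = f (x (Suc i))" if "i < N" "x i < s \<and> s \<le> x (Suc i)" for i s
    using refines_const[OF f x] that by blast
  show "f s = 0" if "x N < s" for s
  proof -
    have "\<tau> n < s" using that assms(3) by linarith
    then show ?thesis using f unfolding step_fun_def by blast
  qed
qed

lemma step_sum_increment:
  assumes f: "step_fun f n \<tau>" and x: "grid_refines N x n \<tau>" and k: "k < N"
  shows "step_sum w f n \<tau> (x (Suc k)) - step_sum w f n \<tau> (x k) = f (x (Suc k)) * (w (x (Suc k)) - w (x k))"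
proof -
  have g: "grid n \<tau>" using f by (rule step_fun_grid)
  have xx: "x k < x (Suc k)" using x k grid_less[of N x k "Suc k"] unfolding grid_refines_def by simp
  from refines_cell[OF g x k] show ?thesis
  proof
    assume "\<exists>i<n. \<tau> i \<le> x k \<and> x (Suc k) \<le> \<tau> (Suc i)"
    then obtain i where i: "i < n" "\<tau> i \<le> x k" "x (Suc k) \<le> \<tau> (Suc i)" by auto
    then have "\<tau> i < x (Suc k)" using xx by linarith
    then have "f (x (Suc k)) = f (\<tau> (Suc i))" using f i unfolding step_fun_def by blast
    then show ?thesis using step_sum_cell[OF g i(1,2) _ i(3)] xx by simp
  next
    assume *: "\<tau> n \<le> x k"
    then have "\<tau> n < x (Suc k)" using xx by linarith
    then have "f (x (Suc k)) = 0" using f unfolding step_fun_def by blast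
    then show ?thesis using * xx by (simp add: step_sum_beyond[OF g])
  qed
qed

lemma step_sum_refine:
  assumes f: "step_fun f n \<tau>" and x: "grid_refines N x n \<tau>" and "k \<le> N"
  shows "step_sum w f n \<tau> (x k) = (\<Sum>j<k. f (x (Suc j)) * (w (x (Suc j)) - w (x j)))"
  using \<open>k \<le> N\<close>
proof (induction k)
  case 0
  have "grid N x" using x by (simp add: grid_refines_def)
  then show ?case using step_sum_0[OF step_fun_grid[OF f]] grid_zero[of N x] by simp
next
  case (Suc k)
  then show ?case using step_sum_increment[OF f x, of k w] by simp
qed

section \<open>Grids through prescribed times\<close>

lemma grid_exists:
  fixes D :: "real set"
  assumes "finite D" "\<And>d. d \<in> D \<Longrightarrow> 0 \<le> d"
  obtains N x where "grid N x" "x ` {0..N} = insert 0 D"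
proof -
  define l where "l = sorted_list_of_set (insert 0 D)"
  have fin: "finite (insert 0 D)" using assms by simp
  have l1: "set l = insert 0 D" unfolding l_def using fin by (rule set_sorted_list_of_set)
  have l2: "sorted_wrt (<) l" 
    unfolding l_def by (simp add: strict_sorted_iff del: sorted_list_of_set_insert_remove)
  define N where "N = length l - 1"
  have "l \<noteq> []" using l1 by auto
  then have len: "length l = Suc N" by (simp add: N_def)
  have sm: "strict_mono_on {0..N} (\<lambda>k. l ! k)"
    unfolding strict_mono_on_def using sorted_wrt_nth_less[OF l2] len by simp
  have "(\<lambda>k. l ! k) ` {0..N} = set l"
    using nth_image[of "length l" l] len by (simp add: atLeast0AtMost lessThan_Suc_atMost atLeast0LessThan)
  then have im: "(\<lambda>k. l ! k) ` {0..N} = insert 0 D" using l1 by simp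
  have "l ! 0 = 0"
  proof -
    have "0 \<in> (\<lambda>k. l ! k) ` {0..N}" unfolding im by simp
    then obtain k where k: "k \<le> N" "l ! k = 0" by auto
    have "l ! 0 \<in> set l" using len by (intro nth_mem) simp
    then have "0 \<le> l ! 0" unfolding l1 using assms(2) by auto
    moreover have "l ! 0 \<le> l ! k" using strict_mono_onD[OF sm, of 0 k] k by (cases "k = 0") auto
    ultimately show ?thesis using k by simp
  qed
  with sm im that[of N "\<lambda>k. l ! k"] show thesis by (simp add: grid_def)
qed

lemma refines_if_image:
  assumes "grid N x" "\<And>i. i \<le> n \<Longrightarrow> \<tau> i \<le> x N \<Longrightarrow> \<tau> i \<in> x ` {0..N}"
  shows "grid_refines N x n \<tau>"
  unfolding grid_refines_def
proof (intro conjI allI impI notI)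
  fix k i assume *: "k < N" "i \<le> n" "x k < \<tau> i \<and> \<tau> i < x (Suc k)"
  then have "\<tau> i \<le> x N" using grid_le[OF assms(1), of "Suc k" N] by auto
  then obtain j where "j \<le> N" "\<tau> i = x j" using assms(2) * by fastforce
  then show False using grid_between[OF assms(1), of j k] * by auto
qed fact

text \<open>The extra set Q turns arbitrary evaluation times into grid points, where
  \<open>step_sum_refine\<close> applies.\<close>

lemma common_refinement:
  assumes "grid n \<tau>" "grid m \<sigma>" "finite Q" "\<And>q. q \<in> Q \<Longrightarrow> 0 \<le> q"
  obtains N x where "grid_refines N x n \<tau>" "grid_refines N x m \<sigma>" "\<tau> n \<le> x N" "\<sigma> m \<le> x N" "Q \<subseteq> x ` {0..N}"
proof -
  obtain N x where x: "grid N x" "x ` {0..N} = insert 0 (Q \<union> \<tau> ` {0..n} \<union> \<sigma> ` {0..m})"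
    by (rule grid_exists[of "Q \<union> \<tau> ` {0..n} \<union> \<sigma> ` {0..m}"])
       (use assms grid_nonneg[OF assms(1)] grid_nonneg[OF assms(2)] in auto)
  have le: "y \<le> x N" if "y \<in> x ` {0..N}" for y
    using that grid_le[OF x(1)] by auto
  show thesis
    by (rule that[of N x]) (auto intro!: refines_if_image x(1) le simp: x(2))
qed

text \<open>The grid ends exactly at T, so that the integral of the square over [0,T] becomes the
  sum over all of its cells; points of \<tau> beyond T are dropped.\<close>

lemma refinement_upto:
  assumes "grid n \<tau>" "0 \<le> T" "finite Q" "Q \<subseteq> {0..T}"
  obtains N x where "grid_refines N x n \<tau>" "x N = T" "Q \<subseteq> x ` {0..N}"
proof -
  obtain N x where x: "grid N x" "x ` {0..N} = insert 0 (insert T Q \<union> (\<tau> ` {0..n} \<inter> {0..T}))"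
    by (rule grid_exists[of "insert T Q \<union> (\<tau> ` {0..n} \<inter> {0..T})"]) (use assms in auto)
  have "x N \<in> x ` {0..N}" by simp
  then have "x N \<le> T" unfolding x(2) using assms by auto
  moreover have "T \<in> x ` {0..N}" unfolding x(2) by simp
  then have "T \<le> x N" using grid_le[OF x(1)] by auto
  ultimately have T: "x N = T" by simp
  show thesis
    by (rule that[of N x]) (auto intro!: refines_if_image x(1) grid_nonneg[OF assms(1)] simp: x(2) T)
qed

text \<open>With t inserted into a common refinement, both sides equal the same sum over its cells
  up to t.\<close>

lemma step_sum_unique:
  assumes "step_fun f n \<tau>" "step_fun f m \<sigma>" "0 \<le> t"
  shows "step_sum w f n \<tau> t = step_sum w f m \<sigma> t"
proof -
  have "grid n \<tau>" "grid m \<sigma>" using assms step_fun_grid by blast+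
  then obtain N x where x: "grid_refines N x n \<tau>" "grid_refines N x m \<sigma>" "{t} \<subseteq> x ` {0..N}"
    by (rule common_refinement[of n \<tau> m \<sigma> "{t}"]) (use assms(3) in auto)
  then obtain k where "k \<le> N" "t = x k" by auto
  then show ?thesis
    using step_sum_refine[OF assms(1) x(1), of k] step_sum_refine[OF assms(2) x(2), of k] by simp
qed

text \<open>The choice removes the grid from the notation; by \<open>step_sum_unique\<close> every
  admissible grid gives the same value at t \<ge> 0.\<close>

definition step_integral :: "(real \<Rightarrow> real) \<Rightarrow> (real \<Rightarrow> real) \<Rightarrow> real \<Rightarrow> real" where
  "step_integral w f t = (SOME y. \<exists>n \<tau>. step_fun f n \<tau> \<and> y = step_sum w f n \<tau> t)"

lemma step_integral_eq:
  assumes "step_fun f n \<tau>" "0 \<le> t" shows "step_integral w f t = step_sum w f n \<tau> t"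
  unfolding step_integral_def
proof (rule some_equality)
  show "\<exists>n' \<tau>'. step_fun f n' \<tau>' \<and> step_sum w f n \<tau> t = step_sum w f n' \<tau>' t"
    using assms(1) by blast
  show "y = step_sum w f n \<tau> t" if "\<exists>n \<tau>. step_fun f n \<tau> \<and> y = step_sum w f n \<tau> t" for y
    using that step_sum_unique[OF _ assms(1,2)] by blast
qed

lemma step_fun_diff:
  assumes "step_fun f n \<tau>" "step_fun g n \<tau>" shows "step_fun (\<lambda>s. f s - g s) n \<tau>"
  unfolding step_fun_def
proof (intro conjI allI impI)
  show "f s - g s = f (\<tau> (Suc i)) - g (\<tau> (Suc i))" if "i < n" "\<tau> i < s \<and> s \<le> \<tau> (Suc i)" for i s
  proof -
    have "f s = f (\<tau> (Suc i))" "g s = g (\<tau> (Suc i))" using that assms unfolding step_fun_def by blast+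
    then show ?thesis by simp
  qed
next
  show "grid n \<tau>" using assms(1) by (rule step_fun_grid)
  show "f s - g s = 0" if "\<tau> n < s" for s
  proof -
    have "f s = 0" "g s = 0" using that assms unfolding step_fun_def by blast+
    then show ?thesis by simp
  qed
qed

lemma step_integral_diff:
  assumes f: "step_fun f n \<tau>" and g: "step_fun g m \<sigma>" and "0 \<le> t"
  shows "step_integral w (\<lambda>s. f s - g s) t = step_integral w f t - step_integral w g t"
proof -
  have "grid n \<tau>" "grid m \<sigma>" using assms step_fun_grid by blast+
  then obtain N x where x: "grid_refines N x n \<tau>" "grid_refines N x m \<sigma>" "\<tau> n \<le> x N" "\<sigma> m \<le> x N"
    by (rule common_refinement[of n \<tau> m \<sigma> "{}"]) auto
  have *: "step_fun f N x" "step_fun g N x"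
    using refines_step_fun f g x by auto
  show ?thesis
    unfolding step_integral_eq[OF *(1) \<open>0 \<le> t\<close>] step_integral_eq[OF *(2) \<open>0 \<le> t\<close>]
      step_integral_eq[OF step_fun_diff[OF *] \<open>0 \<le> t\<close>]
    by (simp add: step_sum_def sum_subtractf[symmetric] algebra_simps)
qed

lemma continuous_on_step_sum:
  assumes g: "grid n \<tau>" and w: "continuous_on {0..} w"
  shows "continuous_on {0..} (step_sum w f n \<tau>)"
  unfolding step_sum_def
  by (intro continuous_intros continuous_on_compose2[OF w]) (use grid_nonneg[OF g] in auto)

lemma continuous_on_step_integral:
  assumes "step_fun f n \<tau>" "continuous_on {0..} w"
  shows "continuous_on {0..} (step_integral w f)"
proof -
  have "continuous_on {0..} (step_sum w f n \<tau>)"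
    using assms step_fun_grid by (intro continuous_on_step_sum) blast+
  then show ?thesis
    by (rule continuous_on_eq) (simp add: step_integral_eq[OF assms(1)])
qed

text \<open>Up to the single point 0, a null set, the integrand is a sum of indicators of cells.
  Nothing is asked of f beyond the last grid point, since the lemma is applied to grids that stop at
  T while f may continue.\<close>

lemma nn_integral_step:
  assumes g: "grid N x" and c: "\<And>k s. k < N \<Longrightarrow> x k < s \<Longrightarrow> s \<le> x (Suc k) \<Longrightarrow> f s = f (x (Suc k))"
    and k: "k \<le> N"
  shows "(\<integral>\<^sup>+s\<in>{0..x k}. ennreal ((f s)\<^sup>2) \<partial>lborel) = ennreal (\<Sum>j<k. (f (x (Suc j)))\<^sup>2 * (x (Suc j) - x j))"
proof -
  have "ennreal ((f s)\<^sup>2) * indicator {0..x k} s =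
      ennreal ((f 0)\<^sup>2) * indicator {0} s +
      (\<Sum>j<k. ennreal ((f (x (Suc j)))\<^sup>2) * indicator {x j<..x (Suc j)} s)" for s
    using k
  proof (induction k)
    case 0
    then show ?case using grid_zero[OF g] by (auto split: split_indicator)
  next
    case (Suc k)
    have *: "x k < x (Suc k)" "0 \<le> x k"
      using grid_less[OF g, of k "Suc k"] grid_nonneg[OF g, of k] Suc.prems by auto
    have "ennreal ((f s)\<^sup>2) * indicator {0..x (Suc k)} s =
       ennreal ((f s)\<^sup>2) * indicator {0..x k} s + ennreal ((f (x (Suc k)))\<^sup>2) * indicator {x k<..x (Suc k)} s"
    proof -
      consider "s \<le> x k" | "x k < s" "s \<le> x (Suc k)" | "x (Suc k) < s" by linarith
      then show ?thesis
      proof cases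
        case 2
        have "f s = f (x (Suc k))" by (rule c) (use 2 Suc.prems in linarith)+
        then show ?thesis using 2 * by simp
      qed (use * in \<open>auto split: split_indicator\<close>)
    qed
    moreover have "ennreal ((f s)\<^sup>2) * indicator {0..x k} s =
      ennreal ((f 0)\<^sup>2) * indicator {0} s +
      (\<Sum>j<k. ennreal ((f (x (Suc j)))\<^sup>2) * indicator {x j<..x (Suc j)} s)"
      by (rule Suc.IH) (use Suc.prems in linarith)
    ultimately show ?case by (simp only: sum.lessThan_Suc add.assoc)
  qed
  then have "(\<integral>\<^sup>+s\<in>{0..x k}. ennreal ((f s)\<^sup>2) \<partial>lborel) =
     (\<integral>\<^sup>+s. ennreal ((f 0)\<^sup>2) * indicator {0} s + (\<Sum>j<k. ennreal ((f (x (Suc j)))\<^sup>2) * indicator {x j<..x (Suc j)} s) \<partial>lborel)"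
    by (simp only:)
  also have "\<dots> = (\<integral>\<^sup>+s. ennreal ((f 0)\<^sup>2) * indicator {0::real} s \<partial>lborel) +
      (\<integral>\<^sup>+s. (\<Sum>j<k. ennreal ((f (x (Suc j)))\<^sup>2) * indicator {x j<..x (Suc j)} s) \<partial>lborel)"
    by (rule nn_integral_add) measurable
  also have "(\<integral>\<^sup>+s. (\<Sum>j<k. ennreal ((f (x (Suc j)))\<^sup>2) * indicator {x j<..x (Suc j)} s) \<partial>lborel) =
      (\<Sum>j<k. \<integral>\<^sup>+s. ennreal ((f (x (Suc j)))\<^sup>2) * indicator {x j<..x (Suc j)} s \<partial>lborel)"
    by (rule nn_integral_sum) measurable
  also have "(\<integral>\<^sup>+s. ennreal ((f 0)\<^sup>2) * indicator {0::real} s \<partial>lborel) = 0"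
    by (subst nn_integral_cmult_indicator) auto
  also have "(\<Sum>j<k. \<integral>\<^sup>+s. ennreal ((f (x (Suc j)))\<^sup>2) * indicator {x j<..x (Suc j)} s \<partial>lborel) =
      (\<Sum>j<k. ennreal ((f (x (Suc j)))\<^sup>2 * (x (Suc j) - x j)))"
  proof (rule sum.cong[OF refl])
    fix j assume "j \<in> {..<k}"
    then have "x j \<le> x (Suc j)" using grid_le[OF g, of j "Suc j"] k by auto
    then show "(\<integral>\<^sup>+s. ennreal ((f (x (Suc j)))\<^sup>2) * indicator {x j<..x (Suc j)} s \<partial>lborel) =
      ennreal ((f (x (Suc j)))\<^sup>2 * (x (Suc j) - x j))"
      by (subst nn_integral_cmult_indicator) (auto simp: ennreal_mult')
  qed
  also have "\<dots> = ennreal (\<Sum>j<k. (f (x (Suc j)))\<^sup>2 * (x (Suc j) - x j))"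
  proof (rule sum_ennreal)
    fix j assume "j \<in> {..<k}"
    then have "x j \<le> x (Suc j)" using grid_le[OF g, of j "Suc j"] k by auto
    then show "0 \<le> (f (x (Suc j)))\<^sup>2 * (x (Suc j) - x j)" by simp
  qed
  finally show ?thesis by simp
qed

section \<open>A maximal inequality for martingale transforms\<close>

context prob_space begin

text \<open>X generates a sub-sigma-algebra of G, so D and X are independent random variables and
  the product rule for expectations applies.\<close>

lemma indep_measurable_mult:
  fixes X D :: "'a \<Rightarrow> real"
  assumes G: "subalgebra M G" and X: "X \<in> borel_measurable G" and D: "D \<in> borel_measurable M"
    and ind: "indep_set (sets (vimage_algebra (space M) D borel)) (sets G)"
    and int: "integrable M X" "integrable M D"
  shows "integrable M (\<lambda>\<omega>. X \<omega> * D \<omega>)" "expectation (\<lambda>\<omega>. X \<omega> * D \<omega>) = expectation X * expectation D"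
proof -
  have spc: "space G = space M" using G by (simp add: subalgebra_def)
  have "indep_var borel D borel X"
    unfolding indep_var_eq
  proof (intro conjI)
    show "random_variable borel X" using measurable_from_subalg[OF G X] .
    have 1: "sigma_sets (space M) {D -` A \<inter> space M |A. A \<in> sets borel} \<subseteq> sets (vimage_algebra (space M) D borel)"
      by (simp add: sets_vimage_algebra)
    have 2: "sigma_sets (space M) {X -` A \<inter> space M |A. A \<in> sets borel} \<subseteq> sets G"
      unfolding spc[symmetric] by (rule sets.sigma_sets_subset) (use X in \<open>auto intro: measurable_sets\<close>)
    show "indep_set (sigma_sets (space M) {D -` A \<inter> space M |A. A \<in> sets borel})
     (sigma_sets (space M) {X -` A \<inter> space M |A. A \<in> sets borel})"
      using ind 1 2 unfolding indep_sets2_eq by blast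
  qed fact
  from indep_var_integrable[OF this int(2,1)] indep_var_lebesgue_integral[OF this int(2,1)]
  show "integrable M (\<lambda>\<omega>. X \<omega> * D \<omega>)" "expectation (\<lambda>\<omega>. X \<omega> * D \<omega>) = expectation X * expectation D"
    by (simp_all add: mult.commute)
qed

text \<open>The isometry for a discrete stochastic integral, by induction on the number of terms:
  expanding the square, the mixed term has mean 0 and the new square factorizes. The bounds
  \<open>K j\<close> are there to secure integrability of these products.\<close>

lemma martingale_transform_variance:
  fixes a D :: "nat \<Rightarrow> 'a \<Rightarrow> real" and v :: "nat \<Rightarrow> real"
  assumes G: "\<And>j. j < N \<Longrightarrow> subalgebra M (G j)" "\<And>i j. i \<le> j \<Longrightarrow> j < N \<Longrightarrow> sets (G i) \<subseteq> sets (G j)"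
    and a: "\<And>j. j < N \<Longrightarrow> a j \<in> borel_measurable (G j)"
    and bdd: "\<And>j \<omega>. j < N \<Longrightarrow> \<omega> \<in> space M \<Longrightarrow> \<bar>a j \<omega>\<bar> \<le> K j"
    and D: "\<And>i j. i < j \<Longrightarrow> j < N \<Longrightarrow> D i \<in> borel_measurable (G j)"
    and DM: "\<And>j. j < N \<Longrightarrow> D j \<in> borel_measurable M"
    and ind: "\<And>j. j < N \<Longrightarrow> indep_set (sets (vimage_algebra (space M) (D j) borel)) (sets (G j))"
    and D1: "\<And>j. j < N \<Longrightarrow> expectation (D j) = 0"
    and D2: "\<And>j. j < N \<Longrightarrow> integrable M (\<lambda>\<omega>. (D j \<omega>)\<^sup>2)" "\<And>j. j < N \<Longrightarrow> expectation (\<lambda>\<omega>. (D j \<omega>)\<^sup>2) = v j"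
    and k: "k \<le> N"
  shows "integrable M (\<lambda>\<omega>. (\<Sum>j<k. a j \<omega> * D j \<omega>)\<^sup>2) \<and>
    expectation (\<lambda>\<omega>. (\<Sum>j<k. a j \<omega> * D j \<omega>)\<^sup>2) = expectation (\<lambda>\<omega>. \<Sum>j<k. (a j \<omega>)\<^sup>2 * v j)"
  using k
proof (induction k)
  case 0
  then show ?case by simp
next
  case (Suc k)
  let ?S = "\<lambda>\<omega>. \<Sum>j<k. a j \<omega> * D j \<omega>"
  have kN: "k < N" using Suc.prems by simp
  have Gsub: "X \<in> borel_measurable (G k)" if "i \<le> k" "X \<in> borel_measurable (G i)" for i and X :: "'a \<Rightarrow> real"
    using that G(1)[of i] G(1)[of k] G(2)[of i k] kN
    by (intro measurable_from_subalg[of "G k" "G i"]) (auto simp: subalgebra_def)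
  have SG: "?S \<in> borel_measurable (G k)"
    using kN by (intro borel_measurable_sum borel_measurable_times Gsub[OF _ a] D) auto
  have ak: "a k \<in> borel_measurable (G k)" using a kN by simp
  have [measurable]: "a k \<in> borel_measurable M" "?S \<in> borel_measurable M" "D k \<in> borel_measurable M"
    using measurable_from_subalg[OF G(1)[OF kN]] ak SG DM kN by auto
  have IH: "integrable M (\<lambda>\<omega>. (?S \<omega>)\<^sup>2)"
    "expectation (\<lambda>\<omega>. (?S \<omega>)\<^sup>2) = expectation (\<lambda>\<omega>. \<Sum>j<k. (a j \<omega>)\<^sup>2 * v j)"
    using Suc by auto
  have K: "\<bar>a k \<omega>\<bar> \<le> \<bar>K k\<bar>" if "\<omega> \<in> space M" for \<omega> using bdd[OF kN that] by auto
  have Sint: "integrable M ?S"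
    using IH(1) by (rule square_integrable_imp_integrable[rotated]) simp
  have Dint: "integrable M (D k)"
    using D2(1)[OF kN] by (rule square_integrable_imp_integrable[rotated]) simp
  have aSint: "integrable M (\<lambda>\<omega>. ?S \<omega> * a k \<omega>)"
  proof (rule Bochner_Integration.integrable_bound[OF integrable_mult_right[OF Sint, of "\<bar>K k\<bar>"]])
    show "AE \<omega> in M. norm (?S \<omega> * a k \<omega>) \<le> norm (\<bar>K k\<bar> * ?S \<omega>)"
      using K by (intro AE_I2) (simp add: abs_mult mult.commute mult_right_mono)
  qed measurable
  have K2: "(a k \<omega>)\<^sup>2 \<le> (K k)\<^sup>2" if "\<omega> \<in> space M" for \<omega> using K[OF that] by (metis abs_le_square_iff)
  have a2int: "integrable M (\<lambda>\<omega>. (a k \<omega>)\<^sup>2)"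
    by (rule integrable_const_bound[of _ "(K k)\<^sup>2"]) (auto intro!: AE_I2 K2)
  \<comment> \<open>The partial sum and \<open>a k\<close> are known at stage k, while
    \<open>D k\<close> is independent of that stage and centred.\<close>
  have cross: "integrable M (\<lambda>\<omega>. (?S \<omega> * a k \<omega>) * D k \<omega>)"
     "expectation (\<lambda>\<omega>. (?S \<omega> * a k \<omega>) * D k \<omega>) = 0"
    using indep_measurable_mult[OF G(1)[OF kN] borel_measurable_times[OF SG ak] _ ind[OF kN] aSint Dint] D1[OF kN]
    by auto
  \<comment> \<open>Independence passes from \<open>D k\<close> to its square, which generates a
    smaller sigma-algebra.\<close>
  have indD: "indep_set (sets (vimage_algebra (space M) (\<lambda>\<omega>. (D k \<omega>)\<^sup>2) borel)) (sets (G k))"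
  proof -
    have "D k \<in> borel_measurable (vimage_algebra (space M) (D k) borel)"
      by (rule measurable_vimage_algebra1) auto
    then have "(\<lambda>\<omega>. (D k \<omega>)\<^sup>2) \<in> borel_measurable (vimage_algebra (space M) (D k) borel)"
      by simp
    then have "sets (vimage_algebra (space M) (\<lambda>\<omega>. (D k \<omega>)\<^sup>2) borel) \<subseteq> sets (vimage_algebra (space M) (D k) borel)"
      unfolding sets_vimage_algebra2[of "\<lambda>\<omega>. (D k \<omega>)\<^sup>2" "space M" borel, simplified]
      by (auto dest: measurable_sets)
    then show ?thesis using ind[OF kN] unfolding indep_sets2_eq by blast
  qed
  have sq: "integrable M (\<lambda>\<omega>. (a k \<omega>)\<^sup>2 * (D k \<omega>)\<^sup>2)"
    "expectation (\<lambda>\<omega>. (a k \<omega>)\<^sup>2 * (D k \<omega>)\<^sup>2) = expectation (\<lambda>\<omega>. (a k \<omega>)\<^sup>2) * v k"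
    using indep_measurable_mult[OF G(1)[OF kN] borel_measurable_power[OF ak] _ indD a2int D2(1)[OF kN]] D2(2)[OF kN]
    by auto
  have eq: "(\<Sum>j<Suc k. a j \<omega> * D j \<omega>)\<^sup>2 = (?S \<omega>)\<^sup>2 + 2 * ((?S \<omega> * a k \<omega>) * D k \<omega>) + (a k \<omega>)\<^sup>2 * (D k \<omega>)\<^sup>2" for \<omega>
    by (simp add: power2_eq_square algebra_simps)
  have sumint: "integrable M (\<lambda>\<omega>. \<Sum>j<k. (a j \<omega>)\<^sup>2 * v j)"
  proof (rule Bochner_Integration.integrable_sum)
    fix j assume "j \<in> {..<k}"
    then have j: "j < N" using kN by simp
    have [measurable]: "a j \<in> borel_measurable M" using measurable_from_subalg[OF G(1)[OF j] a[OF j]] .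
    have "(a j \<omega>)\<^sup>2 \<le> (K j)\<^sup>2" if "\<omega> \<in> space M" for \<omega>
      using bdd[OF j that] by (metis abs_ge_self abs_le_square_iff order.trans)
    then have "integrable M (\<lambda>\<omega>. (a j \<omega>)\<^sup>2)"
      by (intro integrable_const_bound[of _ "(K j)\<^sup>2"]) (auto intro!: AE_I2)
    then show "integrable M (\<lambda>\<omega>. (a j \<omega>)\<^sup>2 * v j)" by simp
  qed
  show ?case
    unfolding eq using IH cross sq a2int sumint by simp
qed

text \<open>The transform is stopped as soon as the partial sums exceed \<open>\<epsilon>\<close> and before the
  predictable variation exceeds \<open>\<delta>\<close>; the stopped transform has second moment at most \<open>\<delta>\<close>.\<close>

lemma martingale_transform_maximal:
  fixes a D :: "nat \<Rightarrow> 'a \<Rightarrow> real" and v :: "nat \<Rightarrow> real"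
  assumes G: "\<And>j. j < N \<Longrightarrow> subalgebra M (G j)" "\<And>i j. i \<le> j \<Longrightarrow> j < N \<Longrightarrow> sets (G i) \<subseteq> sets (G j)"
    and a: "\<And>j. j < N \<Longrightarrow> a j \<in> borel_measurable (G j)"
    and D: "\<And>i j. i < j \<Longrightarrow> j < N \<Longrightarrow> D i \<in> borel_measurable (G j)"
    and DM: "\<And>j. j < N \<Longrightarrow> D j \<in> borel_measurable M"
    and ind: "\<And>j. j < N \<Longrightarrow> indep_set (sets (vimage_algebra (space M) (D j) borel)) (sets (G j))"
    and D1: "\<And>j. j < N \<Longrightarrow> expectation (D j) = 0"
    and D2: "\<And>j. j < N \<Longrightarrow> integrable M (\<lambda>\<omega>. (D j \<omega>)\<^sup>2)" "\<And>j. j < N \<Longrightarrow> expectation (\<lambda>\<omega>. (D j \<omega>)\<^sup>2) = v j"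
    and v: "\<And>j. j < N \<Longrightarrow> 0 < v j"
    and \<epsilon>: "0 < \<epsilon>" and \<delta>: "0 \<le> \<delta>"
  shows "prob {\<omega>\<in>space M. \<exists>k\<le>N. \<epsilon> < \<bar>\<Sum>j<k. a j \<omega> * D j \<omega>\<bar>} \<le>
    prob {\<omega>\<in>space M. \<delta> < (\<Sum>j<N. (a j \<omega>)\<^sup>2 * v j)} + \<delta> / \<epsilon>\<^sup>2"
proof -
  define S where "S k \<omega> = (\<Sum>j<k. a j \<omega> * D j \<omega>)" for k \<omega>
  define V where "V k \<omega> = (\<Sum>j<k. (a j \<omega>)\<^sup>2 * v j)" for k \<omega>
  \<comment> \<open>The test at j inspects \<open>S\<close> up to j and \<open>V (Suc j)\<close>.
    The latter contains \<open>a j\<close> but no \<open>D j\<close>, so the test is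
    \<open>G j\<close>-measurable and the stopped coefficients are still predictable.\<close>
  define a' where "a' j \<omega> = (if (\<forall>k\<in>{..j}. \<bar>S k \<omega>\<bar> \<le> \<epsilon>) \<and> V (Suc j) \<omega> \<le> \<delta> then a j \<omega> else 0)" for j \<omega>
  define S' where "S' \<omega> = (\<Sum>j<N. a' j \<omega> * D j \<omega>)" for \<omega>
  have Gsub: "X \<in> borel_measurable (G k)" if "i \<le> k" "k < N" "X \<in> borel_measurable (G i)" for i k and X :: "'a \<Rightarrow> real"
    using that G(1)[of i] G(1)[of k] G(2)[of i k]
    by (intro measurable_from_subalg[of "G k" "G i"]) (auto simp: subalgebra_def)
  have SG: "S k \<in> borel_measurable (G j)" if "k \<le> j" "j < N" for k j
    unfolding S_def using that by (intro borel_measurable_sum borel_measurable_times Gsub[OF _ _ a] D) auto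
  have VG: "V (Suc j) \<in> borel_measurable (G j)" if "j < N" for j
    unfolding V_def using that by (intro borel_measurable_sum borel_measurable_times borel_measurable_power borel_measurable_const Gsub[OF _ _ a]) auto
  have a': "a' j \<in> borel_measurable (G j)" if j: "j < N" for j
  proof -
    have [measurable]: "\<And>k. k \<in> {..j} \<Longrightarrow> S k \<in> borel_measurable (G j)" "V (Suc j) \<in> borel_measurable (G j)"
      "a j \<in> borel_measurable (G j)"
      using SG VG a j by auto
    show ?thesis unfolding a'_def by measurable
  qed
  have [measurable]: "a j \<in> borel_measurable M" "D j \<in> borel_measurable M" "a' j \<in> borel_measurable M" if "j < N" for j
    using measurable_from_subalg[OF G(1)[OF that] a[OF that]] measurable_from_subalg[OF G(1)[OF that] a'[OF that]]
      DM[OF that] by simp_all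
  have SM[measurable]: "S k \<in> borel_measurable M" if "k \<le> N" for k
    unfolding S_def using that by (intro borel_measurable_sum borel_measurable_times) auto
  have VM[measurable]: "V N \<in> borel_measurable M"
    unfolding V_def by (intro borel_measurable_sum borel_measurable_times borel_measurable_power) auto
  have v0: "0 \<le> v j" if "j < N" for j using v[OF that] by simp
  have Vmono: "V i \<omega> \<le> V j \<omega>" if "i \<le> j" "j \<le> N" for i j \<omega>
    unfolding V_def using that v0 by (intro sum_mono2) auto
  have a'sq: "(a' j \<omega>)\<^sup>2 \<le> (a j \<omega>)\<^sup>2" for j \<omega> by (simp add: a'_def)
  have V'le: "(\<Sum>j<k. (a' j \<omega>)\<^sup>2 * v j) \<le> V k \<omega>" if "k \<le> N" for k \<omega>
    unfolding V_def using that v0 by (intro sum_mono mult_right_mono a'sq) auto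
  \<comment> \<open>If \<open>V (Suc k)\<close> exceeds \<delta>, the new coefficient is 0 and the
    sum does not grow; otherwise the sum is dominated by \<open>V (Suc k)\<close>.\<close>
  have V': "(\<Sum>j<k. (a' j \<omega>)\<^sup>2 * v j) \<le> \<delta>" if "k \<le> N" for k \<omega>
    using that
  proof (induction k)
    case 0 then show ?case using \<delta> by simp
  next
    case (Suc k)
    show ?case
    proof (cases "V (Suc k) \<omega> \<le> \<delta>")
      case True
      then show ?thesis using V'le[OF Suc.prems, of \<omega>] by linarith
    next
      case False
      then have "a' k \<omega> = 0" by (simp add: a'_def)
      then show ?thesis using Suc by simp
    qed
  qed
  \<comment> \<open>The coefficients \<open>a j\<close> may be unbounded, but a single term of the
    stopped variation is at most \<delta>. As \<open>v j\<close> is positive, this bounds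
    \<open>a' j\<close> and makes the variance lemma applicable.\<close>
  have bdd: "\<bar>a' j \<omega>\<bar> \<le> sqrt (\<delta> / v j)" if j: "j < N" for j \<omega>
  proof -
    have "(a' j \<omega>)\<^sup>2 * v j \<le> (\<Sum>j<Suc j. (a' j \<omega>)\<^sup>2 * v j)"
      using v0 j by (intro member_le_sum) auto
    also have "\<dots> \<le> \<delta>" using j by (intro V') auto
    finally have "(a' j \<omega>)\<^sup>2 \<le> \<delta> / v j" using v[OF j] by (simp add: field_simps)
    then show ?thesis using real_le_rsqrt[of "\<bar>a' j \<omega>\<bar>"] by simp
  qed
  have var: "integrable M (\<lambda>\<omega>. (S' \<omega>)\<^sup>2)" "expectation (\<lambda>\<omega>. (S' \<omega>)\<^sup>2) = expectation (\<lambda>\<omega>. \<Sum>j<N. (a' j \<omega>)\<^sup>2 * v j)"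
    using martingale_transform_variance[of N G a' "\<lambda>j. sqrt (\<delta> / v j)" D v N, OF G a' bdd D DM ind D1 D2]
    by (auto simp: S'_def)
  have "expectation (\<lambda>\<omega>. \<Sum>j<N. (a' j \<omega>)\<^sup>2 * v j) \<le> expectation (\<lambda>\<omega>. \<delta>)"
  proof (rule integral_mono)
    have "norm (\<Sum>j<N. (a' j \<omega>)\<^sup>2 * v j) \<le> \<delta>" for \<omega>
      using V'[of N \<omega>] sum_nonneg[of "{..<N}" "\<lambda>j. (a' j \<omega>)\<^sup>2 * v j"] v0 by simp
    then show "integrable M (\<lambda>\<omega>. \<Sum>j<N. (a' j \<omega>)\<^sup>2 * v j)"
      by (intro integrable_const_bound[of _ \<delta>] AE_I2) auto
  qed (use V' in auto)
  then have ES': "expectation (\<lambda>\<omega>. (S' \<omega>)\<^sup>2) \<le> \<delta>" using var by (simp add: prob_space)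
  have [measurable]: "S' \<in> borel_measurable M" unfolding S'_def by measurable
  \<comment> \<open>If the variation never exceeds \<delta>, only the first condition can stop the
    transform. At the first passage time m the stopped sum is \<open>S m\<close>, and from m on all
    coefficients vanish, so \<open>S'\<close> retains a value beyond \<epsilon>.\<close>
  have sub: "{\<omega>\<in>space M. \<exists>k\<le>N. \<epsilon> < \<bar>S k \<omega>\<bar>} \<subseteq> {\<omega>\<in>space M. \<delta> < V N \<omega>} \<union> {\<omega>\<in>space M. \<epsilon>\<^sup>2 \<le> (S' \<omega>)\<^sup>2}"
  proof safe
    fix \<omega> k assume "\<omega> \<in> space M" and k: "k \<le> N" "\<epsilon> < \<bar>S k \<omega>\<bar>" and nV: "\<not> \<epsilon>\<^sup>2 \<le> (S' \<omega>)\<^sup>2"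
    show "\<delta> < V N \<omega>"
    proof (rule ccontr)
      assume "\<not> \<delta> < V N \<omega>"
      then have Vle: "V j \<omega> \<le> \<delta>" if "j \<le> N" for j using Vmono[of j N \<omega>] that by auto
      define m where "m = (LEAST k. \<epsilon> < \<bar>S k \<omega>\<bar>)"
      have m: "\<epsilon> < \<bar>S m \<omega>\<bar>" "m \<le> k" unfolding m_def using k(2) by (auto intro: LeastI Least_le)
      have less: "\<bar>S i \<omega>\<bar> \<le> \<epsilon>" if "i < m" for i
        using not_less_Least[of i "\<lambda>k. \<epsilon> < \<bar>S k \<omega>\<bar>"] that unfolding m_def by auto
      have a1: "a' j \<omega> = a j \<omega>" if "j < m" for j
        using less Vle[of "Suc j"] m k that by (auto simp: a'_def)
      have a2: "a' j \<omega> = 0" if "m \<le> j" for j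
        using m that by (force simp: a'_def)
      have "S' \<omega> = (\<Sum>j<m. a' j \<omega> * D j \<omega>)"
        unfolding S'_def using m k a2 by (intro sum.mono_neutral_right) auto
      also have "\<dots> = S m \<omega>" unfolding S_def using a1 by (intro sum.cong) auto
      finally have "S' \<omega> = S m \<omega>" .
      then have "\<epsilon>\<^sup>2 \<le> (S' \<omega>)\<^sup>2" using m(1) \<epsilon> by (metis abs_of_pos abs_le_square_iff less_imp_le)
      then show False using nV by simp
    qed
  qed
  have "prob {\<omega>\<in>space M. \<exists>k\<le>N. \<epsilon> < \<bar>S k \<omega>\<bar>} \<le> prob ({\<omega>\<in>space M. \<delta> < V N \<omega>} \<union> {\<omega>\<in>space M. \<epsilon>\<^sup>2 \<le> (S' \<omega>)\<^sup>2})"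
    by (intro finite_measure_mono sub) measurable
  also have "\<dots> \<le> prob {\<omega>\<in>space M. \<delta> < V N \<omega>} + prob {\<omega>\<in>space M. \<epsilon>\<^sup>2 \<le> (S' \<omega>)\<^sup>2}"
    by (intro measure_Un_le) measurable
  also have "prob {\<omega>\<in>space M. \<epsilon>\<^sup>2 \<le> (S' \<omega>)\<^sup>2} \<le> expectation (\<lambda>\<omega>. (S' \<omega>)\<^sup>2) / \<epsilon>\<^sup>2"
    by (rule integral_Markov_inequality_measure[OF var(1), of "{}"]) (use \<epsilon> in auto)
  also have "\<dots> \<le> \<delta> / \<epsilon>\<^sup>2" using ES' by (intro divide_right_mono) auto
  finally show ?thesis by (simp add: S_def V_def)
qed

end

section \<open>The elementary integral\<close>

lemma step_representation_grid: "step_representation M b n \<tau> \<Longrightarrow> grid n \<tau>"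
  by (simp add: step_representation_def grid_def)

lemma step_representation_step_fun:
  assumes r: "step_representation M b n \<tau>" and \<omega>: "\<omega> \<in> space M"
  shows "step_fun (\<lambda>s. b s \<omega>) n \<tau>"
proof -
  have g: "grid n \<tau>" using r by (rule step_representation_grid)
  have rep: "b s \<omega> = b (\<tau> 0) \<omega> * indicator {0} s + (\<Sum>i=1..n. b (\<tau> i) \<omega> * indicator {\<tau> (i - 1)<..\<tau> i} s)"
    if "0 \<le> s" for s
    using r \<omega> that unfolding step_representation_def by blast
  show ?thesis
    unfolding step_fun_def
  proof (intro conjI allI impI)
    fix i s assume i: "i < n" and s: "\<tau> i < s \<and> s \<le> \<tau> (Suc i)"
    have s0: "0 < s" using grid_nonneg[OF g, of i] i s by auto
    have "(\<Sum>k=1..n. b (\<tau> k) \<omega> * indicator {\<tau> (k - 1)<..\<tau> k} s) =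
      (\<Sum>k=1..n. if k = Suc i then b (\<tau> (Suc i)) \<omega> else 0)"
    proof (rule sum.cong[OF refl])
      fix k assume k: "k \<in> {1..n}"
      consider "k \<le> i" | "k = Suc i" | "Suc i < k" by linarith
      then show "b (\<tau> k) \<omega> * indicator {\<tau> (k - 1)<..\<tau> k} s = (if k = Suc i then b (\<tau> (Suc i)) \<omega> else 0)"
      proof cases
        case 1
        then have "\<tau> k \<le> \<tau> i" using i by (intro grid_le[OF g]) auto
        then show ?thesis using 1 s by simp
      next
        case 3
        then have "\<tau> (Suc i) \<le> \<tau> (k - 1)" using k by (intro grid_le[OF g]) auto
        then show ?thesis using 3 s by simp
      qed (use s in simp)
    qed
    then show "b s \<omega> = b (\<tau> (Suc i)) \<omega>" using rep[of s] s0 i by simp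
  next
    fix s assume s: "\<tau> n < s"
    have s0: "0 < s" using grid_nonneg[OF g, of n] s by auto
    have "(\<Sum>k=1..n. b (\<tau> k) \<omega> * indicator {\<tau> (k - 1)<..\<tau> k} s) = 0"
    proof (rule sum.neutral, rule ballI)
      fix k assume "k \<in> {1..n}"
      then have "\<tau> k \<le> \<tau> n" by (intro grid_le[OF g]) auto
      then show "b (\<tau> k) \<omega> * indicator {\<tau> (k - 1)<..\<tau> k} s = 0" using s by simp
    qed
    then show "b s \<omega> = 0" using rep[of s] s0 by simp
  qed fact
qed

text \<open>The part of simplicity that survives refinement and differences: paths are step
  functions and each value is known at the left end of its cell. The value at time 0 is left
  free.\<close>

definition simple_rep :: "'a measure \<Rightarrow> (real \<Rightarrow> 'a measure) \<Rightarrow> 'a process \<Rightarrow> nat \<Rightarrow> (nat \<Rightarrow> real) \<Rightarrow> bool" where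
  "simple_rep M F b n \<tau> \<longleftrightarrow> grid n \<tau> \<and> (\<forall>\<omega>\<in>space M. step_fun (\<lambda>s. b s \<omega>) n \<tau>) \<and>
     (\<forall>i<n. b (\<tau> (Suc i)) \<in> borel_measurable (F (\<tau> i)))"

lemma simple_rep_exists:
  assumes "simple_process M F b"
  obtains n \<tau> where "simple_rep M F b n \<tau>"
proof -
  from assms obtain n \<tau> where r: "step_representation M b n \<tau>"
    and m: "\<forall>i\<in>{1..n}. b (\<tau> i) \<in> borel_measurable (F (\<tau> (i - 1)))"
    unfolding simple_process_def by blast
  have "b (\<tau> (Suc i)) \<in> borel_measurable (F (\<tau> i))" if "i < n" for i
    using m[rule_format, of "Suc i"] that by simp
  then have "simple_rep M F b n \<tau>"
    unfolding simple_rep_def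
    by (intro conjI ballI allI impI step_representation_grid[OF r] step_representation_step_fun[OF r])
  then show thesis by (rule that)
qed

lemma simple_repD:
  assumes "simple_rep M F b n \<tau>"
  shows "grid n \<tau>" "\<And>\<omega>. \<omega> \<in> space M \<Longrightarrow> step_fun (\<lambda>s. b s \<omega>) n \<tau>"
    "\<And>i. i < n \<Longrightarrow> b (\<tau> (Suc i)) \<in> borel_measurable (F (\<tau> i))"
  using assms unfolding simple_rep_def by simp_all

definition elementary_integral :: "'a process \<Rightarrow> 'a process \<Rightarrow> 'a process" where
  "elementary_integral W b t \<omega> = step_integral (\<lambda>s. W s \<omega>) (\<lambda>s. b s \<omega>) t"

text \<open>Taking values in \<open>ennreal\<close> makes this meaningful for every \<omega>, also
  where the path is not square integrable.\<close>

definition quad :: "'a process \<Rightarrow> real \<Rightarrow> 'a \<Rightarrow> ennreal" where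
  "quad b T \<omega> = (\<integral>\<^sup>+s\<in>{0..T}. ennreal ((b s \<omega>)\<^sup>2) \<partial>lborel)"

lemma closure_Rats: "closure \<rat> = (UNIV :: real set)"
proof -
  have "\<exists>y\<in>\<rat>. dist y x < e" if "0 < e" for x e :: real
    using Rats_dense_in_real[of x "x + e"] that by (force simp: dist_real_def)
  then show ?thesis by (auto simp: closure_approachable)
qed

locale wiener = prob_space M for M :: "'a measure" +
  fixes F :: "real \<Rightarrow> 'a measure" and W :: "'a process"
  assumes augmented: "augmented_filtration M F"
    and Wiener: "standard_Wiener_process M F W"
begin

lemma subalg: "0 \<le> t \<Longrightarrow> subalgebra M (F t)"
  using augmented by (simp add: augmented_filtration_def)

lemma space_F: "0 \<le> t \<Longrightarrow> space (F t) = space M"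
  using subalg by (simp add: subalgebra_def)

lemma sets_F_mono: "0 \<le> s \<Longrightarrow> s \<le> t \<Longrightarrow> sets (F s) \<subseteq> sets (F t)"
  using augmented by (simp add: augmented_filtration_def)

lemma measurable_F_M: "0 \<le> t \<Longrightarrow> X \<in> borel_measurable (F t) \<Longrightarrow> X \<in> borel_measurable M"
  using measurable_from_subalg[OF subalg] .

lemma measurable_F_mono: "0 \<le> s \<Longrightarrow> s \<le> t \<Longrightarrow> X \<in> borel_measurable (F s) \<Longrightarrow> X \<in> borel_measurable (F t)"
  by (rule measurable_from_subalg[of _ "F s"])
     (use sets_F_mono space_F in \<open>auto simp: subalgebra_def\<close>)

lemma W_measurable: "0 \<le> t \<Longrightarrow> W t \<in> borel_measurable (F t)"
  using Wiener by (simp add: standard_Wiener_process_def adapted_def)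

lemma W_continuous: "\<omega> \<in> space M \<Longrightarrow> continuous_on {0..} (\<lambda>t. W t \<omega>)"
  using Wiener by (simp add: standard_Wiener_process_def continuous_process_def)

lemma increment_indep:
  "0 \<le> s \<Longrightarrow> s < t \<Longrightarrow> indep_set (sets (vimage_algebra (space M) (\<lambda>\<omega>. W t \<omega> - W s \<omega>) borel)) (sets (F s))"
  using Wiener by (simp add: standard_Wiener_process_def)

lemma increment_moments:
  assumes "0 \<le> s" "s < t"
  shows "expectation (\<lambda>\<omega>. W t \<omega> - W s \<omega>) = 0" "integrable M (\<lambda>\<omega>. (W t \<omega> - W s \<omega>)\<^sup>2)"
    "expectation (\<lambda>\<omega>. (W t \<omega> - W s \<omega>)\<^sup>2) = t - s"
proof -
  let ?f = "normal_density 0 (sqrt (t - s))"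
  have pos: "0 < sqrt (t - s)" using assms by simp
  have d: "distributed M lborel (\<lambda>\<omega>. W t \<omega> - W s \<omega>) ?f"
    using Wiener assms by (simp add: standard_Wiener_process_def)
  have "expectation (\<lambda>\<omega>. W t \<omega> - W s \<omega>) = (\<integral>x. ?f x * x \<partial>lborel)"
    using distributed_integral[OF d, of "\<lambda>x. x"] by simp
  then show "expectation (\<lambda>\<omega>. W t \<omega> - W s \<omega>) = 0"
    using integral_normal_moment_nz_1[OF pos] by simp
  have "integrable lborel (\<lambda>x. ?f x * x\<^sup>2)" using integrable_normal_moment[OF pos, of 0 2] by simp
  then show "integrable M (\<lambda>\<omega>. (W t \<omega> - W s \<omega>)\<^sup>2)"
    using distributed_integrable[OF d, of "\<lambda>x. x\<^sup>2"] by simp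
  have "expectation (\<lambda>\<omega>. (W t \<omega> - W s \<omega>)\<^sup>2) = (\<integral>x. ?f x * x\<^sup>2 \<partial>lborel)"
    using distributed_integral[OF d, of "\<lambda>x. x\<^sup>2"] by simp
  also have "\<dots> = t - s" using integral_normal_moment_even[OF pos, of 0 1] assms by simp
  finally show "expectation (\<lambda>\<omega>. (W t \<omega> - W s \<omega>)\<^sup>2) = t - s" .
qed

lemma elementary_integral_eq:
  assumes "step_fun (\<lambda>s. b s \<omega>) n \<tau>" "0 \<le> t"
  shows "elementary_integral W b t \<omega> =
    (\<Sum>i<n. b (\<tau> (Suc i)) \<omega> * (W (min (\<tau> (Suc i)) t) \<omega> - W (min (\<tau> i) t) \<omega>))"
  unfolding elementary_integral_def step_integral_eq[OF assms] step_sum_def ..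

lemma elementary_integral_eq_sum:
  assumes r: "step_representation M b n \<tau>" and "\<tau> n \<le> t" and \<omega>: "\<omega> \<in> space M"
  shows "elementary_integral W b t \<omega> = (\<Sum>i=1..n. b (\<tau> i) \<omega> * (W (\<tau> i) \<omega> - W (\<tau> (i - 1)) \<omega>))"
proof -
  have g: "grid n \<tau>" using r by (rule step_representation_grid)
  have "0 \<le> t" using grid_nonneg[OF g, of n] assms(2) by simp
  then have "elementary_integral W b t \<omega> = step_sum (\<lambda>s. W s \<omega>) (\<lambda>s. b s \<omega>) n \<tau> t"
    unfolding elementary_integral_def by (rule step_integral_eq[OF step_representation_step_fun[OF r \<omega>]])
  also have "\<dots> = (\<Sum>i<n. b (\<tau> (Suc i)) \<omega> * (W (\<tau> (Suc i)) \<omega> - W (\<tau> i) \<omega>))"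
    by (rule step_sum_beyond[OF g assms(2)])
  also have "\<dots> = (\<Sum>i=1..n. b (\<tau> i) \<omega> * (W (\<tau> i) \<omega> - W (\<tau> (i - 1)) \<omega>))"
    by (rule sum.reindex_bij_witness[of _ "\<lambda>i. i - 1" Suc]) auto
  finally show ?thesis .
qed

lemma elementary_integral_continuous:
  assumes "simple_rep M F b n \<tau>" "\<omega> \<in> space M"
  shows "continuous_on {0..} (\<lambda>t. elementary_integral W b t \<omega>)"
  using continuous_on_step_integral[OF simple_repD(2)[OF assms] W_continuous[OF assms(2)]]
  by (simp add: elementary_integral_def)

text \<open>The coefficient of a cell that has begun by t is already known at its left end, hence at
  t, even if its right end lies in the future. Cells that begin later contribute an increment of W
  over an empty interval.\<close>

lemma elementary_integral_adapted:
  assumes r: "simple_rep M F b n \<tau>" and t: "0 \<le> t"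
  shows "elementary_integral W b t \<in> borel_measurable (F t)"
proof -
  note g = simple_repD(1)[OF r]
  have "(\<lambda>\<omega>. \<Sum>i<n. b (\<tau> (Suc i)) \<omega> * (W (min (\<tau> (Suc i)) t) \<omega> - W (min (\<tau> i) t) \<omega>)) \<in> borel_measurable (F t)"
  proof (rule borel_measurable_sum)
    fix i assume "i \<in> {..<n}"
    then have i: "i < n" by simp
    have \<tau>: "0 \<le> \<tau> i" "\<tau> i \<le> \<tau> (Suc i)" using grid_nonneg[OF g, of i] grid_le[OF g, of i "Suc i"] i by auto
    show "(\<lambda>\<omega>. b (\<tau> (Suc i)) \<omega> * (W (min (\<tau> (Suc i)) t) \<omega> - W (min (\<tau> i) t) \<omega>)) \<in> borel_measurable (F t)"
    proof (cases "\<tau> i \<le> t")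
      case True
      have "b (\<tau> (Suc i)) \<in> borel_measurable (F t)"
        using measurable_F_mono[OF \<tau>(1) True simple_repD(3)[OF r i]] .
      moreover have "W (min (\<tau> (Suc i)) t) \<in> borel_measurable (F t)" "W (min (\<tau> i) t) \<in> borel_measurable (F t)"
        using \<tau> t by (auto intro!: measurable_F_mono[OF _ _ W_measurable])
      ultimately show ?thesis by measurable
    next
      case False
      then show ?thesis using \<tau> by (simp add: min_def)
    qed
  qed
  then show ?thesis
    by (rule measurable_cong[THEN iffD2, rotated])
       (use elementary_integral_eq[OF simple_repD(2)[OF r] t] space_F[OF t] in auto)
qed

text \<open>The value on a finer cell is the value on the coarse cell around it, which is known even
  earlier, namely at the left end of the coarse cell.\<close>

lemma simple_rep_refine_measurable:
  assumes r: "simple_rep M F b n \<tau>" and x: "grid_refines N x n \<tau>" and j: "j < N"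
  shows "b (x (Suc j)) \<in> borel_measurable (F (x j))"
proof -
  note g = simple_repD(1)[OF r]
  have gx: "grid N x" using x by (simp add: grid_refines_def)
  have xj: "0 \<le> x j" "x j < x (Suc j)" using grid_nonneg[OF gx, of j] grid_less[OF gx, of j "Suc j"] j by auto
  from refines_cell[OF g x j] show ?thesis
  proof
    assume "\<exists>i<n. \<tau> i \<le> x j \<and> x (Suc j) \<le> \<tau> (Suc i)"
    then obtain i where i: "i < n" "\<tau> i \<le> x j" "x (Suc j) \<le> \<tau> (Suc i)" by auto
    have eq: "b (x (Suc j)) \<omega> = b (\<tau> (Suc i)) \<omega>" if "\<omega> \<in> space M" for \<omega>
    proof -
      have "\<tau> i < x (Suc j)" using i xj by linarith
      then show ?thesis using simple_repD(2)[OF r that] i unfolding step_fun_def by blast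
    qed
    have "b (\<tau> (Suc i)) \<in> borel_measurable (F (x j))"
      using measurable_F_mono[OF _ i(2) simple_repD(3)[OF r i(1)]] grid_nonneg[OF g, of i] i by simp
    then show ?thesis
      by (rule measurable_cong[THEN iffD2, rotated]) (use eq space_F[OF xj(1)] in auto)
  next
    assume "\<tau> n \<le> x j"
    then have *: "\<tau> n < x (Suc j)" using xj by linarith
    have "b (x (Suc j)) \<omega> = 0" if "\<omega> \<in> space M" for \<omega>
      using simple_repD(2)[OF r that] * unfolding step_fun_def by blast
    then show ?thesis
      by (subst measurable_cong[of _ _ "\<lambda>_. 0"]) (use space_F[OF xj(1)] in auto)
  qed
qed

lemma simple_rep_diff:
  assumes b: "simple_rep M F b n \<tau>" and c: "simple_rep M F c m \<sigma>"
  obtains N x where "simple_rep M F (\<lambda>s \<omega>. b s \<omega> - c s \<omega>) N x"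
proof -
  obtain N x where x: "grid_refines N x n \<tau>" "grid_refines N x m \<sigma>" "\<tau> n \<le> x N" "\<sigma> m \<le> x N"
    by (rule common_refinement[OF simple_repD(1)[OF b] simple_repD(1)[OF c], of "{}"]) auto
  have "simple_rep M F (\<lambda>s \<omega>. b s \<omega> - c s \<omega>) N x"
    unfolding simple_rep_def
  proof (intro conjI ballI allI impI)
    show "grid N x" using x by (simp add: grid_refines_def)
    show "step_fun (\<lambda>s. b s \<omega> - c s \<omega>) N x" if "\<omega> \<in> space M" for \<omega>
      using refines_step_fun[OF simple_repD(2)[OF b that] x(1,3)]
        refines_step_fun[OF simple_repD(2)[OF c that] x(2,4)] by (rule step_fun_diff)
    show "(\<lambda>\<omega>. b (x (Suc i)) \<omega> - c (x (Suc i)) \<omega>) \<in> borel_measurable (F (x i))" if "i < N" for i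
      using simple_rep_refine_measurable[OF b x(1) that] simple_rep_refine_measurable[OF c x(2) that]
      by measurable
  qed
  then show thesis by (rule that)
qed

lemma elementary_integral_diff:
  assumes b: "simple_rep M F b n \<tau>" and c: "simple_rep M F c m \<sigma>" and "\<omega> \<in> space M" "0 \<le> t"
  shows "elementary_integral W (\<lambda>s \<omega>. b s \<omega> - c s \<omega>) t \<omega> = elementary_integral W b t \<omega> - elementary_integral W c t \<omega>"
  unfolding elementary_integral_def
  by (rule step_integral_diff[OF simple_repD(2)[OF b] simple_repD(2)[OF c]]) fact+

text \<open>On a refinement that contains Q and ends at T, the integral at grid points is a
  martingale transform with the increments of W, and its predictable variation is exactly
  \<open>quad b T\<close>.\<close>

lemma elementary_integral_maximal_finite:
  assumes r: "simple_rep M F b n \<tau>" and T: "0 \<le> T" and Q: "finite Q" "Q \<subseteq> {0..T}"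
    and \<epsilon>: "0 < \<epsilon>" and \<delta>: "0 \<le> \<delta>"
  shows "prob {\<omega>\<in>space M. \<exists>q\<in>Q. \<epsilon> < \<bar>elementary_integral W b q \<omega>\<bar>} \<le>
    prob {\<omega>\<in>space M. ennreal \<delta> < quad b T \<omega>} + \<delta> / \<epsilon>\<^sup>2"
proof -
  obtain N x where x: "grid_refines N x n \<tau>" "x N = T" "Q \<subseteq> x ` {0..N}"
    by (rule refinement_upto[OF simple_repD(1)[OF r] T Q])
  have gx: "grid N x" using x by (simp add: grid_refines_def)
  have x0: "0 \<le> x j" "x j < x (Suc j)" if "j < N" for j
    using grid_nonneg[OF gx, of j] grid_less[OF gx, of j "Suc j"] that by auto
  let ?a = "\<lambda>j. b (x (Suc j))" and ?D = "\<lambda>j \<omega>. W (x (Suc j)) \<omega> - W (x j) \<omega>" and ?v = "\<lambda>j. x (Suc j) - x j"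
  have int: "elementary_integral W b (x k) \<omega> = (\<Sum>j<k. ?a j \<omega> * ?D j \<omega>)" if "k \<le> N" "\<omega> \<in> space M" for k \<omega>
    unfolding elementary_integral_def
      step_integral_eq[OF simple_repD(2)[OF r that(2)] grid_nonneg[OF gx that(1)]]
    by (rule step_sum_refine[OF simple_repD(2)[OF r that(2)] x(1) that(1)])
  have q: "quad b T \<omega> = ennreal (\<Sum>j<N. (?a j \<omega>)\<^sup>2 * ?v j)" if "\<omega> \<in> space M" for \<omega>
    unfolding quad_def x(2)[symmetric]
    by (rule nn_integral_step[OF gx _ order_refl]) (rule refines_const[OF simple_repD(2)[OF r that] x(1)])
  have qle: "ennreal \<delta> < quad b T \<omega> \<longleftrightarrow> \<delta> < (\<Sum>j<N. (?a j \<omega>)\<^sup>2 * ?v j)" if "\<omega> \<in> space M" for \<omega>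
    unfolding q[OF that] using \<delta> by (simp add: ennreal_less_iff)
  have am: "?a j \<in> borel_measurable M" if "j < N" for j
    using measurable_F_M[OF x0(1)[OF that] simple_rep_refine_measurable[OF r x(1) that]] .
  have DF: "?D i \<in> borel_measurable (F (x j))" if "i < j" "j \<le> N" for i j
  proof -
    have "0 \<le> x i" "x i \<le> x j" "0 \<le> x (Suc i)" "x (Suc i) \<le> x j"
      using that grid_nonneg[OF gx, of i] grid_le[OF gx, of i j]
        grid_nonneg[OF gx, of "Suc i"] grid_le[OF gx, of "Suc i" j] by simp_all
    then have "W (x (Suc i)) \<in> borel_measurable (F (x j))" "W (x i) \<in> borel_measurable (F (x j))"
      by (simp_all only: measurable_F_mono[OF _ _ W_measurable])
    then show ?thesis by measurable
  qed
  have DM: "?D j \<in> borel_measurable M" if "j < N" for j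
    by (rule measurable_F_M[OF grid_nonneg[OF gx, of "Suc j"] DF]) (use that in simp_all)
  have max: "prob {\<omega>\<in>space M. \<exists>k\<le>N. \<epsilon> < \<bar>\<Sum>j<k. ?a j \<omega> * ?D j \<omega>\<bar>} \<le>
    prob {\<omega>\<in>space M. \<delta> < (\<Sum>j<N. (?a j \<omega>)\<^sup>2 * ?v j)} + \<delta> / \<epsilon>\<^sup>2"
  proof (rule martingale_transform_maximal[where G = "\<lambda>j. F (x j)"])
    show "sets (F (x i)) \<subseteq> sets (F (x j))" if "i \<le> j" "j < N" for i j
      using that grid_nonneg[OF gx, of i] grid_le[OF gx, of i j] by (intro sets_F_mono) auto
  next
    fix j assume j: "j < N"
    note xj = x0[OF j]
    show "subalgebra M (F (x j))" by (rule subalg[OF xj(1)])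
    show "?a j \<in> borel_measurable (F (x j))" by (rule simple_rep_refine_measurable[OF r x(1) j])
    show "?D i \<in> borel_measurable (F (x j))" if "i < j" for i
      using that j by (intro DF) simp_all
    show "?D j \<in> borel_measurable M" by (rule DM[OF j])
    show "indep_set (sets (vimage_algebra (space M) (?D j) borel)) (sets (F (x j)))"
      by (rule increment_indep[OF xj])
    show "expectation (?D j) = 0" "integrable M (\<lambda>\<omega>. (?D j \<omega>)\<^sup>2)" "expectation (\<lambda>\<omega>. (?D j \<omega>)\<^sup>2) = ?v j"
      by (rule increment_moments[OF xj])+
    show "0 < ?v j" using xj by simp
  qed fact+
  have "prob {\<omega>\<in>space M. \<exists>q\<in>Q. \<epsilon> < \<bar>elementary_integral W b q \<omega>\<bar>} \<le>
    prob {\<omega>\<in>space M. \<exists>k\<le>N. \<epsilon> < \<bar>\<Sum>j<k. ?a j \<omega> * ?D j \<omega>\<bar>}"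
  proof (rule finite_measure_mono)
    show "{\<omega>\<in>space M. \<exists>q\<in>Q. \<epsilon> < \<bar>elementary_integral W b q \<omega>\<bar>} \<subseteq> {\<omega>\<in>space M. \<exists>k\<le>N. \<epsilon> < \<bar>\<Sum>j<k. ?a j \<omega> * ?D j \<omega>\<bar>}"
    proof safe
      fix \<omega> q assume \<omega>: "\<omega> \<in> space M" and "q \<in> Q" "\<epsilon> < \<bar>elementary_integral W b q \<omega>\<bar>"
      then obtain k where k: "k \<le> N" "q = x k" using x(3) by force
      have "\<epsilon> < \<bar>\<Sum>j<k. ?a j \<omega> * ?D j \<omega>\<bar>"
        unfolding int[OF k(1) \<omega>, symmetric] k(2)[symmetric] by fact
      then show "\<exists>k\<le>N. \<epsilon> < \<bar>\<Sum>j<k. ?a j \<omega> * ?D j \<omega>\<bar>" using k(1) by blast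
    qed
    have ev: "{\<omega>\<in>space M. \<epsilon> < \<bar>\<Sum>j<k. ?a j \<omega> * ?D j \<omega>\<bar>} \<in> events" if k: "k \<le> N" for k
    proof -
      have "(\<lambda>\<omega>. \<Sum>j<k. ?a j \<omega> * ?D j \<omega>) \<in> borel_measurable M"
      proof (rule borel_measurable_sum)
        fix j assume "j \<in> {..<k}"
        then have "j < N" using k by simp
        then show "(\<lambda>\<omega>. ?a j \<omega> * ?D j \<omega>) \<in> borel_measurable M"
          by (simp only: borel_measurable_times[OF am DM])
      qed
      from borel_measurable_less[OF borel_measurable_const borel_measurable_abs[OF this], of \<epsilon>]
      show ?thesis .
    qed
    have "(\<Union>k\<in>{..N}. {\<omega>\<in>space M. \<epsilon> < \<bar>\<Sum>j<k. ?a j \<omega> * ?D j \<omega>\<bar>}) \<in> events"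
      by (rule sets.finite_UN[rotated]) (use ev in simp_all)
    also have "(\<Union>k\<in>{..N}. {\<omega>\<in>space M. \<epsilon> < \<bar>\<Sum>j<k. ?a j \<omega> * ?D j \<omega>\<bar>}) =
      {\<omega>\<in>space M. \<exists>k\<le>N. \<epsilon> < \<bar>\<Sum>j<k. ?a j \<omega> * ?D j \<omega>\<bar>}" by auto
    finally show "{\<omega>\<in>space M. \<exists>k\<le>N. \<epsilon> < \<bar>\<Sum>j<k. ?a j \<omega> * ?D j \<omega>\<bar>} \<in> events" .
  qed
  also note max
  also have "{\<omega>\<in>space M. \<delta> < (\<Sum>j<N. (?a j \<omega>)\<^sup>2 * ?v j)} = {\<omega>\<in>space M. ennreal \<delta> < quad b T \<omega>}"
    using qle by (intro Collect_cong conj_cong refl) (rule sym)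
  finally show ?thesis .
qed

text \<open>Finite initial segments of an enumeration of rational times increase to a dense set, and
  path continuity shows that exceeding \<epsilon> anywhere in [0,T] means exceeding it at one of
  these times. This yields measurability of the event as well.\<close>

lemma elementary_integral_maximal:
  assumes r: "simple_rep M F b n \<tau>" and T: "0 < T" and \<epsilon>: "0 < \<epsilon>" and \<delta>: "0 \<le> \<delta>"
  shows "{\<omega>\<in>space M. \<exists>q\<in>{0..T}. \<epsilon> < \<bar>elementary_integral W b q \<omega>\<bar>} \<in> events" (is "?A \<in> _")
    and "prob {\<omega>\<in>space M. \<exists>q\<in>{0..T}. \<epsilon> < \<bar>elementary_integral W b q \<omega>\<bar>} \<le>
    prob {\<omega>\<in>space M. ennreal \<delta> < quad b T \<omega>} + \<delta> / \<epsilon>\<^sup>2"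
proof -
  \<comment> \<open>Intersecting with the open interval lets density of the rationals give the
    closure {0..T}; this is where T > 0 is used.\<close>
  define D where "D = \<rat> \<inter> {0<..<T}"
  have cD: "countable D" unfolding D_def using countable_rat by blast
  have clD: "closure D = {0..T}"
    using closure_open_Int_superset[of "{0<..<T}" "\<rat>"] T by (simp add: D_def closure_Rats Int_commute)
  then have neD: "D \<noteq> {}" using T by force
  have subD: "D \<subseteq> {0..T}" by (auto simp: D_def)
  define B where "B m = {\<omega>\<in>space M. \<exists>q\<in>from_nat_into D ` {..m}. \<epsilon> < \<bar>elementary_integral W b q \<omega>\<bar>}" for m
  have fin: "from_nat_into D q \<in> {0..T}" for q using from_nat_into[OF neD] subD by blast
  have int_m: "elementary_integral W b q \<in> borel_measurable M" if "q \<in> {0..T}" for q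
    by (rule measurable_F_M[OF _ elementary_integral_adapted[OF r]]) (use that in simp_all)
  have Bev: "B m \<in> events" for m
  proof -
    have "(\<Union>i\<in>{..m}. {\<omega>\<in>space M. \<epsilon> < \<bar>elementary_integral W b (from_nat_into D i) \<omega>\<bar>}) \<in> events"
      by (rule sets.finite_UN[OF finite_atMost]) (intro borel_measurable_less borel_measurable_const borel_measurable_abs int_m fin)
    also have "(\<Union>i\<in>{..m}. {\<omega>\<in>space M. \<epsilon> < \<bar>elementary_integral W b (from_nat_into D i) \<omega>\<bar>}) = B m"
      by (auto simp: B_def)
    finally show ?thesis .
  qed
  have UB: "(\<Union>m. B m) = ?A"
  proof safe
    fix \<omega> m assume "\<omega> \<in> B m"
    then show "\<omega> \<in> space M" "\<exists>q\<in>{0..T}. \<epsilon> < \<bar>elementary_integral W b q \<omega>\<bar>"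
      using fin unfolding B_def by blast+
  next
    fix \<omega> q assume \<omega>: "\<omega> \<in> space M" and q: "q \<in> {0..T}" "\<epsilon> < \<bar>elementary_integral W b q \<omega>\<bar>"
    show "\<omega> \<in> (\<Union>m. B m)"
    proof (rule ccontr)
      assume "\<omega> \<notin> (\<Union>m. B m)"
      then have nB: "\<omega> \<notin> B i" for i by blast
      have le: "\<bar>elementary_integral W b (from_nat_into D i) \<omega>\<bar> \<le> \<epsilon>" for i
      proof -
        have "\<forall>q\<in>from_nat_into D ` {..i}. \<not> \<epsilon> < \<bar>elementary_integral W b q \<omega>\<bar>"
          using nB[of i] \<omega> unfolding B_def by blast
        then show ?thesis by (meson atMost_iff image_eqI not_less order_refl)
      qed
      have "norm (elementary_integral W b d \<omega>) \<le> \<epsilon>" if "d \<in> D" for d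
        using le[of "to_nat_on D d"] from_nat_into_to_nat_on[OF cD that] by simp
      moreover have "continuous_on (closure D) (\<lambda>t. elementary_integral W b t \<omega>)"
        unfolding clD by (rule continuous_on_subset[OF elementary_integral_continuous[OF r \<omega>]]) auto
      ultimately have "norm (elementary_integral W b q \<omega>) \<le> \<epsilon>"
        using continuous_on_closure_norm_le[of D "\<lambda>t. elementary_integral W b t \<omega>"] q(1) unfolding clD by blast
      then show False using q(2) by simp
    qed
  qed
  show "?A \<in> events" unfolding UB[symmetric] by (intro sets.countable_UN image_subsetI Bev)
  have "incseq B"
    unfolding incseq_def
  proof (intro allI impI)
    fix m k :: nat assume "m \<le> k"
    then have "from_nat_into D ` {..m} \<subseteq> from_nat_into D ` {..k}" by (intro image_mono) simp
    then show "B m \<subseteq> B k" unfolding B_def by blast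
  qed
  then have "(\<lambda>m. prob (B m)) \<longlonglongrightarrow> prob (\<Union>m. B m)"
    by (intro finite_Lim_measure_incseq image_subsetI Bev)
  moreover have "prob (B m) \<le> prob {\<omega>\<in>space M. ennreal \<delta> < quad b T \<omega>} + \<delta> / \<epsilon>\<^sup>2" for m
    unfolding B_def by (rule elementary_integral_maximal_finite[OF r less_imp_le[OF T] _ _ \<epsilon> \<delta>]) (simp, rule image_subsetI, rule fin)
  ultimately show "prob ?A \<le> prob {\<omega>\<in>space M. ennreal \<delta> < quad b T \<omega>} + \<delta> / \<epsilon>\<^sup>2"
    unfolding UB[symmetric] by (intro LIMSEQ_le_const2) blast+
qed

end

section \<open>Sampling on shifted grids\<close>

lemma sum_square_le_3: "(x + y + z)\<^sup>2 \<le> 3 * x\<^sup>2 + 3 * y\<^sup>2 + 3 * (z::real)\<^sup>2"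
proof -
  have "0 \<le> (x - y)\<^sup>2 + (y - z)\<^sup>2 + (x - z)\<^sup>2" by simp
  then show ?thesis by (simp add: power2_eq_square algebra_simps)
qed

text \<open>A measurable function is an almost everywhere limit of continuous ones. Clipping these
  to [-K,K] does not change the limit and supplies the dominating constant (2 K)^2.\<close>

lemma continuous_L2_approximation:
  fixes f :: "real \<Rightarrow> real"
  assumes f[measurable]: "f \<in> borel_measurable borel" and K: "\<And>x. \<bar>f x\<bar> \<le> K" and "0 < \<eta>"
  obtains g where "continuous_on UNIV g"
    "(\<integral>\<^sup>+x\<in>{0..T}. ennreal ((f x - g x)\<^sup>2) \<partial>lborel) \<le> ennreal \<eta>"
proof -
  have "f \<in> borel_measurable lebesgue" using f by (simp add: measurable_completion)
  then have "f measurable_on UNIV" by (simp add: lebesgue_measurable_imp_measurable_on)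
  then obtain N g where N: "negligible N" and g: "\<And>n. continuous_on UNIV (g n)"
    and lim: "\<And>x. x \<notin> N \<Longrightarrow> (\<lambda>n. g n x) \<longlonglongrightarrow> f x"
    unfolding measurable_on_def by auto
  define h where "h n x = max (-K) (min K (g n x))" for n x
  have hc: "continuous_on UNIV (h n)" for n
    unfolding h_def by (intro continuous_intros g)
  have [measurable]: "h n \<in> borel_measurable borel" for n
    using hc by (rule borel_measurable_continuous_onI)
  have K0: "0 \<le> K" using K[of 0] by linarith
  have hK: "\<bar>h n x\<bar> \<le> K" for n x using K0 by (auto simp: h_def)
  have hlim: "(\<lambda>n. h n x) \<longlonglongrightarrow> f x" if "x \<notin> N" for x
  proof -
    have "(\<lambda>n. h n x) \<longlonglongrightarrow> max (-K) (min K (f x))"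
      unfolding h_def by (intro tendsto_intros lim that)
    moreover have "max (-K) (min K (f x)) = f x" using K[of x] by auto
    ultimately show ?thesis by simp
  qed
  have "N \<in> null_sets lebesgue" using N by (simp add: negligible_iff_null_sets)
  then have "AE x in lebesgue. x \<notin> N" by (rule AE_not_in)
  then have AEN: "AE x in lborel. x \<notin> N" by (simp add: AE_completion_iff)
  have "(\<lambda>n. \<integral>\<^sup>+x. ennreal ((f x - h n x)\<^sup>2) * indicator {0..T} x \<partial>lborel) \<longlonglongrightarrow> integral\<^sup>N lborel (\<lambda>_::real. 0)"
  proof (rule nn_integral_dominated_convergence[where w = "\<lambda>x. ennreal ((2 * K)\<^sup>2) * indicator {0..T} x"])
    show "AE x in lborel. ennreal ((f x - h n x)\<^sup>2) * indicator {0..T} x \<le> ennreal ((2 * K)\<^sup>2) * indicator {0..T} x" for n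
    proof (intro AE_I2 mult_right_mono ennreal_leI)
      fix x
      have "\<bar>f x - h n x\<bar> \<le> \<bar>2 * K\<bar>" using K[of x] hK[of n x] by linarith
      then show "(f x - h n x)\<^sup>2 \<le> (2 * K)\<^sup>2" by (simp add: abs_le_square_iff)
    qed simp
    show "(\<integral>\<^sup>+x. ennreal ((2 * K)\<^sup>2) * indicator {0..T} x \<partial>lborel) < \<infinity>"
      by (simp add: nn_integral_cmult_indicator ennreal_mult_less_top emeasure_lborel_Icc_eq)
    show "AE x in lborel. (\<lambda>n. ennreal ((f x - h n x)\<^sup>2) * indicator {0..T} x) \<longlonglongrightarrow> 0"
      using AEN
    proof eventually_elim
      case (elim x)
      have "(\<lambda>n. ennreal ((f x - h n x)\<^sup>2 * indicator {0..T} x)) \<longlonglongrightarrow> ennreal ((f x - f x)\<^sup>2 * indicator {0..T} x)"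
        by (intro tendsto_intros tendsto_ennrealI hlim elim)
      then show ?case by (simp add: ennreal_mult' ennreal_indicator)
    qed
  qed simp_all
  then have "(\<lambda>n. \<integral>\<^sup>+x\<in>{0..T}. ennreal ((f x - h n x)\<^sup>2) \<partial>lborel) \<longlonglongrightarrow> 0" by simp
  then have "\<forall>\<^sub>F n in sequentially. (\<integral>\<^sup>+x\<in>{0..T}. ennreal ((f x - h n x)\<^sup>2) \<partial>lborel) < ennreal \<eta>"
    by (rule order_tendstoD) (use \<open>0 < \<eta>\<close> in simp)
  then obtain n where "(\<integral>\<^sup>+x\<in>{0..T}. ennreal ((f x - h n x)\<^sup>2) \<partial>lborel) < ennreal \<eta>"
    by (auto simp: eventually_sequentially)
  then show thesis using that[OF hc[of n]] by simp
qed

text \<open>Compare with a continuous g: two terms are the distance of f to g, before and after the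
  shift, and the third is small by uniform continuity of g.\<close>

lemma translation_L2_continuous:
  fixes f :: "real \<Rightarrow> real"
  assumes f[measurable]: "f \<in> borel_measurable borel" and K: "\<And>x. \<bar>f x\<bar> \<le> K" and T: "0 < T" and \<eta>: "0 < \<eta>"
  obtains d where "0 < d"
    "\<forall>u\<in>{0..d}. (\<integral>\<^sup>+v\<in>{0..T}. ennreal ((f (v + u) - f v)\<^sup>2) \<partial>lborel) \<le> ennreal \<eta>"
proof -
  \<comment> \<open>With the factor 3 from \<open>sum_square_le_3\<close>, each of the two distances
    to g then costs at most \<eta>/3. The interval extends to T + 1 because shifts up to 1 are
    allowed.\<close>
  have "0 < \<eta> / 9" using \<eta> by simp
  then obtain g where g: "continuous_on UNIV g"
    "(\<integral>\<^sup>+x\<in>{0..T+1}. ennreal ((f x - g x)\<^sup>2) \<partial>lborel) \<le> ennreal (\<eta> / 9)"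
    using continuous_L2_approximation[OF f K, where T = "T + 1"] by blast
  have [measurable]: "g \<in> borel_measurable borel" using g(1) by (rule borel_measurable_continuous_onI)
  define F where "F x = ennreal (3 * (f x - g x)\<^sup>2) * indicator {0..T+1} x" for x
  have Fm[measurable]: "F \<in> borel_measurable borel" unfolding F_def by measurable
  have "(\<integral>\<^sup>+x. F x \<partial>lborel) = (\<integral>\<^sup>+x. ennreal 3 * (ennreal ((f x - g x)\<^sup>2) * indicator {0..T+1} x) \<partial>lborel)"
    unfolding F_def by (simp add: ennreal_mult' mult.assoc)
  also have "\<dots> = ennreal 3 * (\<integral>\<^sup>+x\<in>{0..T+1}. ennreal ((f x - g x)\<^sup>2) \<partial>lborel)"
    by (rule nn_integral_cmult) measurable
  also have "\<dots> \<le> ennreal 3 * ennreal (\<eta> / 9)" by (intro mult_left_mono g(2)) simp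
  also have "\<dots> = ennreal (\<eta> / 3)" by (subst ennreal_mult'[symmetric]) auto
  finally have F: "(\<integral>\<^sup>+x. F x \<partial>lborel) \<le> ennreal (\<eta> / 3)" .
  have "uniformly_continuous_on {0..T+1} g"
    using continuous_on_subset[OF g(1)] by (intro compact_uniformly_continuous) auto
  \<comment> \<open>Chosen so that the third term costs 3 * \<rho>^2 * T = \<eta>/3.\<close>
  moreover define \<rho> where "\<rho> = sqrt (\<eta> / (9 * T))"
  ultimately obtain e where e: "0 < e" "\<And>x y. x \<in> {0..T+1} \<Longrightarrow> y \<in> {0..T+1} \<Longrightarrow> dist y x < e \<Longrightarrow> dist (g y) (g x) < \<rho>"
    using \<eta> T unfolding uniformly_continuous_on_def by (metis divide_pos_pos mult_pos_pos real_sqrt_gt_0_iff zero_less_numeral)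
  have \<rho>: "\<rho>\<^sup>2 = \<eta> / (9 * T)" using \<eta> T by (simp add: \<rho>_def)
  show thesis
  proof (rule that[of "min 1 (e / 2)"], use e in simp, rule ballI)
    fix u assume "u \<in> {0..min 1 (e / 2)}"
    then have u: "0 \<le> u" "u \<le> min 1 (e / 2)" by auto
    \<comment> \<open>The shape \<open>u + 1 * v\<close> is that of
      \<open>nn_integral_real_affine\<close>, which later removes the shift from the integral of
      \<open>F\<close>.\<close>
    have pt: "ennreal ((f (v + u) - f v)\<^sup>2) * indicator {0..T} v \<le>
        F (u + 1 * v) + (F v + ennreal (3 * \<rho>\<^sup>2) * indicator {0..T} v)" for v
    proof (cases "v \<in> {0..T}")
      case True
      have mem: "v \<in> {0..T+1}" "u + v \<in> {0..T+1}" using True u by auto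
      have "dist (g (u + v)) (g v) < \<rho>"
        by (rule e(2)[OF mem]) (use u e(1) in \<open>auto simp: dist_real_def\<close>)
      then have "(g (u + v) - g v)\<^sup>2 \<le> \<rho>\<^sup>2"
        by (simp add: dist_real_def abs_le_square_iff[symmetric])
      moreover have "(f (v + u) - f v)\<^sup>2 \<le> 3 * (f (u + v) - g (u + v))\<^sup>2 + 3 * (g (u + v) - g v)\<^sup>2 + 3 * (f v - g v)\<^sup>2"
        using sum_square_le_3[of "f (u + v) - g (u + v)" "g (u + v) - g v" "g v - f v"]
        by (simp add: add.commute power2_commute)
      ultimately have "(f (v + u) - f v)\<^sup>2 \<le> 3 * (f (u + v) - g (u + v))\<^sup>2 + (3 * (f v - g v)\<^sup>2 + 3 * \<rho>\<^sup>2)" by linarith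
      then show ?thesis using True mem by (simp add: F_def del: ennreal_plus flip: ennreal_plus)
    qed simp
    have "(\<integral>\<^sup>+v\<in>{0..T}. ennreal ((f (v + u) - f v)\<^sup>2) \<partial>lborel) \<le>
      (\<integral>\<^sup>+v. F (u + 1 * v) + (F v + ennreal (3 * \<rho>\<^sup>2) * indicator {0..T} v) \<partial>lborel)"
      by (intro nn_integral_mono pt)
    also have "\<dots> = (\<integral>\<^sup>+v. F (u + 1 * v) \<partial>lborel) + ((\<integral>\<^sup>+v. F v \<partial>lborel) + ennreal (3 * \<rho>\<^sup>2) * emeasure lborel {0..T})"
      by (simp add: nn_integral_add nn_integral_cmult_indicator)
    also have "(\<integral>\<^sup>+v. F (u + 1 * v) \<partial>lborel) = (\<integral>\<^sup>+v. F v \<partial>lborel)"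
      using nn_integral_real_affine[OF Fm, of 1 u] by simp
    also have "ennreal (3 * \<rho>\<^sup>2) * emeasure lborel {0..T} = ennreal (3 * \<rho>\<^sup>2 * T)"
      using T by (simp add: ennreal_mult')
    also have "3 * \<rho>\<^sup>2 * T = \<eta> / 3" using T by (simp add: \<rho>)
    also have "(\<integral>\<^sup>+v. F v \<partial>lborel) + ((\<integral>\<^sup>+v. F v \<partial>lborel) + ennreal (\<eta> / 3)) \<le> ennreal (\<eta> / 3) + (ennreal (\<eta> / 3) + ennreal (\<eta> / 3))"
      by (intro add_mono F order_refl)
    also have "\<dots> = ennreal \<eta>" using \<eta> by (simp flip: ennreal_plus)
    finally show "(\<integral>\<^sup>+v\<in>{0..T}. ennreal ((f (v + u) - f v)\<^sup>2) \<partial>lborel) \<le> ennreal \<eta>" .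
  qed
qed

section \<open>Step functions sampled along a shifted grid\<close>

lemma step_on_cell:
  fixes \<xi> :: "nat \<Rightarrow> 'b::semiring_1"
  assumes g: "grid n \<tau>" and i: "i < n" "\<tau> i < s" "s \<le> \<tau> (Suc i)"
  shows "(\<Sum>j<n. \<xi> j * indicator {\<tau> j<..\<tau> (Suc j)} s) = \<xi> i"
proof -
  have "(\<Sum>j<n. \<xi> j * indicator {\<tau> j<..\<tau> (Suc j)} s) = (\<Sum>j<n. if j = i then \<xi> i else 0)"
  proof (rule sum.cong[OF refl])
    fix j assume j: "j \<in> {..<n}"
    consider "j < i" | "j = i" | "i < j" by linarith
    then show "\<xi> j * indicator {\<tau> j<..\<tau> (Suc j)} s = (if j = i then \<xi> i else 0)"
    proof cases
      case 1
      then have "\<tau> (Suc j) \<le> \<tau> i" using grid_le[OF g, of "Suc j" i] i by simp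
      then show ?thesis using 1 i by simp
    next
      case 3
      then have "\<tau> (Suc i) \<le> \<tau> j" using grid_le[OF g, of "Suc i" j] j by simp
      then show ?thesis using 3 i by simp
    qed (use i in simp)
  qed
  then show ?thesis using i by simp
qed

lemma step_beyond:
  fixes \<xi> :: "nat \<Rightarrow> 'b::semiring_1"
  assumes g: "grid n \<tau>" and s: "s \<le> 0 \<or> \<tau> n < s"
  shows "(\<Sum>j<n. \<xi> j * indicator {\<tau> j<..\<tau> (Suc j)} s) = 0"
proof (rule sum.neutral, rule ballI)
  fix j assume "j \<in> {..<n}"
  then have "0 \<le> \<tau> j" "\<tau> (Suc j) \<le> \<tau> n" using grid_nonneg[OF g, of j] grid_le[OF g, of "Suc j" n] by auto
  then show "\<xi> j * indicator {\<tau> j<..\<tau> (Suc j)} s = 0" using s by auto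
qed

text \<open>With h = T / N and 0 < s < h, the times are 0, s, s + h, ..., s + (N - 1) h, T. So there
  are \<open>Suc N\<close> cells, of which the first and the last are shorter than h.\<close>

definition shifted_grid :: "real \<Rightarrow> nat \<Rightarrow> real \<Rightarrow> nat \<Rightarrow> real" where
  "shifted_grid T N s i = (if i = 0 then 0 else if i \<le> N then s + real (i - 1) * (T / real N) else T)"

text \<open>Values are taken at left end points, so that a sampled adapted process is predictable.
  On the first cell the value is 0; its length s is less than the mesh, so the loss is of the order
  of the mesh.\<close>

definition sampled :: "real \<Rightarrow> nat \<Rightarrow> real \<Rightarrow> (real \<Rightarrow> real) \<Rightarrow> real \<Rightarrow> real" where
  "sampled T N s f t = (\<Sum>i<Suc N. (if i = 0 then 0 else f (shifted_grid T N s i)) *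
     indicator {shifted_grid T N s i<..shifted_grid T N s (Suc i)} t)"

lemma grid_shifted_grid:
  assumes "0 < T" "0 < N" "0 < s" "s < T / real N"
  shows "grid (Suc N) (shifted_grid T N s)"
proof -
  let ?h = "T / real N"
  have h: "0 < ?h" using assms by simp
  have last: "s + real (N - 1) * ?h < T"
  proof -
    have "s + real (N - 1) * ?h < ?h + real (N - 1) * ?h" using assms by simp
    also have "\<dots> = T" using assms by (simp add: of_nat_diff field_simps)
    finally show ?thesis .
  qed
  have "shifted_grid T N s i < shifted_grid T N s j" if "i < j" "j \<le> Suc N" for i j
  proof -
    have le: "s + real (k - 1) * ?h \<le> s + real (N - 1) * ?h" if "k \<le> N" for k
      using that h by (intro add_left_mono mult_right_mono) auto
    have lt: "s + real (i - 1) * ?h < s + real (j - 1) * ?h" if "i \<noteq> 0"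
      using h \<open>i < j\<close> that by (intro add_strict_left_mono mult_strict_right_mono) auto
    have pos: "0 < s + real (j - 1) * ?h" using assms h by (simp add: add_pos_nonneg)
    have "i \<le> N" "j \<le> N \<or> j = Suc N" using that by auto
    then consider "i = 0" "j \<le> N" | "i = 0" "j = Suc N" | "i \<noteq> 0" "j \<le> N" | "i \<noteq> 0" "j = Suc N" "i \<le> N"
      by blast
    then show ?thesis
    proof cases
      case 1 then show ?thesis using pos that by (simp add: shifted_grid_def)
    next
      case 2 then show ?thesis using assms by (simp add: shifted_grid_def)
    next
      case 3 then show ?thesis using lt that by (simp add: shifted_grid_def)
    next
      case 4 then show ?thesis using le[of i] last by (simp add: shifted_grid_def)
    qed
  qed
  then show ?thesis by (auto simp: grid_def strict_mono_on_def shifted_grid_def)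
qed

lemma sampled_cell:
  assumes "0 < T" "0 < N" "0 < s" "s < T / real N"
    and "i < Suc N" "shifted_grid T N s i < t" "t \<le> shifted_grid T N s (Suc i)"
  shows "sampled T N s f t = (if i = 0 then 0 else f (shifted_grid T N s i))"
  unfolding sampled_def by (rule step_on_cell[OF grid_shifted_grid[OF assms(1-4)] assms(5-7)])

lemma sampled_beyond:
  assumes "0 < T" "0 < N" "0 < s" "s < T / real N" and "t \<le> 0 \<or> T < t"
  shows "sampled T N s f t = 0"
  unfolding sampled_def
  by (rule step_beyond[OF grid_shifted_grid[OF assms(1-4)]]) (use assms(5) in \<open>simp add: shifted_grid_def\<close>)

lemma sampled_bound:
  assumes T: "0 < T" and N: "0 < N" and s: "0 < s" "s < T / real N" and K: "\<And>x. \<bar>f x\<bar> \<le> K"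
  shows "\<bar>sampled T N s f t\<bar> \<le> K"
proof -
  have K0: "0 \<le> K" using K[of 0] by linarith
  show ?thesis
  proof (cases "0 < t \<and> t \<le> T")
    case True
    then obtain i where i: "i < Suc N" "shifted_grid T N s i < t" "t \<le> shifted_grid T N s (Suc i)"
      using grid_cell[OF grid_shifted_grid[OF T N s], of t] by (auto simp: shifted_grid_def)
    show ?thesis unfolding sampled_cell[OF T N s i] using K K0 by simp
  next
    case False
    then have "sampled T N s f t = 0" by (intro sampled_beyond[OF T N s]) auto
    then show ?thesis using K0 by simp
  qed
qed

text \<open>A time t > s lies at most one mesh length after the sample point s + k h in use, so its
  error appears among the summands; the others are nonnegative and may be added. Times t \<le> s are
  covered by the bound K.\<close>

lemma sampled_error_pointwise:
  fixes f :: "real \<Rightarrow> real"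
  assumes T: "0 < T" and N: "0 < N" and s: "0 < s" "s < T / real N" and K: "\<And>x. \<bar>f x\<bar> \<le> K"
  shows "ennreal ((f t - sampled T N s f t)\<^sup>2) * indicator {0..T} t \<le>
    ennreal (K\<^sup>2) * indicator {0..T / real N} t +
    (\<Sum>k<N. ennreal ((f t - f (s + real k * (T / real N)))\<^sup>2) *
      indicator {0..T / real N} (t - (s + real k * (T / real N))))" (is "?L \<le> ?A + ?B")
proof (cases "t \<in> {0..T}")
  case True
  let ?\<tau> = "shifted_grid T N s" and ?h = "T / real N"
  note g = grid_shifted_grid[OF T N s]
  show ?thesis
  proof (cases "t \<le> s")
    case t: True
    have "sampled T N s f t = 0"
    proof (cases "t = 0")
      case True then show ?thesis by (intro sampled_beyond[OF T N s]) simp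
    next
      case False
      then have "?\<tau> 0 < t" "t \<le> ?\<tau> (Suc 0)" using \<open>t \<in> {0..T}\<close> t N by (auto simp: shifted_grid_def)
      from sampled_cell[OF T N s _ this] show ?thesis by simp
    qed
    moreover have "(f t)\<^sup>2 \<le> K\<^sup>2" using K[of t] by (metis abs_ge_self abs_le_square_iff order.trans)
    ultimately have "?L \<le> ennreal (K\<^sup>2)" using \<open>t \<in> {0..T}\<close> by (simp add: ennreal_leI)
    also have "\<dots> = ?A" using t s \<open>t \<in> {0..T}\<close> by simp
    also have "\<dots> \<le> ?A + ?B" by simp
    finally show ?thesis .
  next
    case t: False
    have "?\<tau> (Suc N) = T" by (simp add: shifted_grid_def)
    then obtain i where i: "i < Suc N" "?\<tau> i < t" "t \<le> ?\<tau> (Suc i)"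
      using grid_cell[OF g, of t] True t s by auto
    have i0: "i \<noteq> 0"
    proof
      assume "i = 0"
      then have "t \<le> s" using i(3) N by (simp add: shifted_grid_def)
      then show False using t by simp
    qed
    then obtain k where k: "i = Suc k" using not0_implies_Suc by blast
    have kN: "k < N" using i k by simp
    have \<tau>i: "?\<tau> i = s + real k * ?h" using k kN by (simp add: shifted_grid_def)
    have "sampled T N s f t = f (s + real k * ?h)"
      unfolding sampled_cell[OF T N s i] using i0 \<tau>i by simp
    \<comment> \<open>In the last cell the next point is T, not the next multiple of the mesh; there
      k + 1 = N, and t \<le> T with s > 0 gives the bound.\<close>
    moreover have "t - (s + real k * ?h) \<le> ?h"
    proof (cases "Suc i \<le> N")
      case True
      then have "?\<tau> (Suc i) = s + real k * ?h + ?h" using k by (simp add: shifted_grid_def field_simps)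
      then show ?thesis using i by simp
    next
      case False
      then have "Suc k = N" using kN k by simp
      then have "real k * ?h + ?h = T" using N by (simp add: field_simps) (metis add.commute mult.commute of_nat_Suc distrib_right mult_1)
      then show ?thesis using True s by simp
    qed
    moreover have "0 \<le> t - (s + real k * ?h)" using i(2) \<tau>i by simp
    ultimately have "?L = ennreal ((f t - f (s + real k * ?h))\<^sup>2) * indicator {0..?h} (t - (s + real k * ?h))"
      using True by simp
    also have "\<dots> \<le> ?B"
      using kN by (intro member_le_sum) auto
    also have "\<dots> \<le> ?A + ?B" by simp
    finally show ?thesis .
  qed
qed simp

text \<open>Write t = v + u with sample point v = s + k h, where h = T / N and u is in [0,h]. As s
  runs over (0,h) and k over the indices below N, v covers each point of [0,T] at most once, so the
  error integrated over shifts becomes an integral of translation errors. The term K^2 h^2 is the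
  cost K^2 h of the initial stretch, integrated over s.\<close>

lemma sampled_error_average:
  fixes f :: "real \<Rightarrow> real"
  assumes f[measurable]: "f \<in> borel_measurable borel" and K: "\<And>x. \<bar>f x\<bar> \<le> K" and T: "0 < T" and N: "0 < N"
  shows "(\<integral>\<^sup>+s\<in>{0<..<T / real N}. (\<integral>\<^sup>+t\<in>{0..T}. ennreal ((f t - sampled T N s f t)\<^sup>2) \<partial>lborel) \<partial>lborel) \<le>
    ennreal (K\<^sup>2 * (T / real N)\<^sup>2) +
    (\<integral>\<^sup>+u\<in>{0..T / real N}. (\<integral>\<^sup>+v\<in>{0..T}. ennreal ((f (v + u) - f v)\<^sup>2) \<partial>lborel) \<partial>lborel)"
proof -
  define h where "h = T / real N"
  have h: "0 < h" and Nh: "real N * h = T" using T N by (simp_all add: h_def)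
  define G where "G v u = ennreal ((f (v + u) - f v)\<^sup>2) * indicator {0..h} u" for v u :: real
  \<comment> \<open>The translation error over one mesh length, as a function of the sample point
    v.\<close>
  define H where "H v = (\<integral>\<^sup>+u. G v u \<partial>lborel)" for v
  have Gm: "(\<lambda>(v, u). G v u) \<in> borel_measurable (lborel \<Otimes>\<^sub>M lborel)" unfolding G_def by measurable
  have Hm[measurable]: "H \<in> borel_measurable borel"
    using lborel.borel_measurable_nn_integral[OF Gm] by (simp add: H_def[abs_def])
  have err: "(\<integral>\<^sup>+t\<in>{0..T}. ennreal ((f t - sampled T N s f t)\<^sup>2) \<partial>lborel) \<le>
      ennreal (K\<^sup>2 * h) + (\<Sum>k<N. H (s + real k * h))" if s: "s \<in> {0<..<h}" for s
  proof -
    define B where "B k t = ennreal ((f t - f (s + real k * h))\<^sup>2) * indicator {0..h} (t - (s + real k * h))" for k t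
    have [measurable]: "B k \<in> borel_measurable borel" for k unfolding B_def by measurable
    have "(\<integral>\<^sup>+t\<in>{0..T}. ennreal ((f t - sampled T N s f t)\<^sup>2) \<partial>lborel) \<le>
      (\<integral>\<^sup>+t. ennreal (K\<^sup>2) * indicator {0..h} t + (\<Sum>k<N. B k t) \<partial>lborel)"
      unfolding B_def h_def by (intro nn_integral_mono sampled_error_pointwise[OF T N _ _ K]) (use s in \<open>auto simp: h_def\<close>)
    also have "\<dots> = ennreal (K\<^sup>2) * emeasure lborel {0..h} + (\<Sum>k<N. \<integral>\<^sup>+t. B k t \<partial>lborel)"
      by (simp add: nn_integral_add nn_integral_sum nn_integral_cmult_indicator)
    also have "ennreal (K\<^sup>2) * emeasure lborel {0..h} = ennreal (K\<^sup>2 * h)" using h by (simp add: ennreal_mult')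
    also have "(\<Sum>k<N. \<integral>\<^sup>+t. B k t \<partial>lborel) = (\<Sum>k<N. H (s + real k * h))"
    proof (rule sum.cong[OF refl])
      show "(\<integral>\<^sup>+t. B k t \<partial>lborel) = H (s + real k * h)" for k
        using nn_integral_real_affine[of "B k" 1 "s + real k * h"] by (simp add: H_def G_def B_def)
    qed
    finally show ?thesis .
  qed
  \<comment> \<open>The translates of (0,h) by multiples of h are disjoint subsets of [0,T];
    comparing with half-open cells lets \<open>step_on_cell\<close> count them.\<close>
  have ind: "(\<Sum>k<N. indicator {0<..<h} (v - real k * h)) \<le> (indicator {0..T} v :: ennreal)" for v
  proof -
    have g: "grid N (\<lambda>k. real k * h)" using h by (simp add: grid_def strict_mono_on_def)
    have "(\<Sum>k<N. indicator {0<..<h} (v - real k * h)) \<le> (\<Sum>k<N. 1 * indicator {real k * h<..real (Suc k) * h} v :: ennreal)"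
      by (intro sum_mono) (auto simp: algebra_simps split: split_indicator)
    also have "\<dots> \<le> indicator {0..T} v"
    proof (cases "0 < v \<and> v \<le> T")
      case True
      then obtain i where i: "i < N" "real i * h < v" "v \<le> real (Suc i) * h"
        using grid_cell[OF g, of v] Nh by auto
      show ?thesis unfolding step_on_cell[OF g i] using True by simp
    next
      case False
      then show ?thesis using step_beyond[OF g, of v "\<lambda>_. 1 :: ennreal"] Nh by (simp add: not_less not_le)
    qed
    finally show ?thesis .
  qed
  have "(\<integral>\<^sup>+s\<in>{0<..<h}. (\<integral>\<^sup>+t\<in>{0..T}. ennreal ((f t - sampled T N s f t)\<^sup>2) \<partial>lborel) \<partial>lborel) \<le>
    (\<integral>\<^sup>+s. ennreal (K\<^sup>2 * h) * indicator {0<..<h} s + (\<Sum>k<N. H (s + real k * h) * indicator {0<..<h} s) \<partial>lborel)"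
    using err by (intro nn_integral_mono) (simp add: indicator_def)
  also have "\<dots> = ennreal (K\<^sup>2 * h) * emeasure lborel {0<..<h} +
      (\<Sum>k<N. \<integral>\<^sup>+s. H (s + real k * h) * indicator {0<..<h} s \<partial>lborel)"
  proof (subst nn_integral_add)
    show "(\<integral>\<^sup>+s\<in>{0<..<h}. ennreal (K\<^sup>2 * h) \<partial>lborel) +
        (\<integral>\<^sup>+s. (\<Sum>k<N. H (s + real k * h) * indicator {0<..<h} s) \<partial>lborel) =
      ennreal (K\<^sup>2 * h) * emeasure lborel {0<..<h} +
        (\<Sum>k<N. \<integral>\<^sup>+s. H (s + real k * h) * indicator {0<..<h} s \<partial>lborel)"
      by (intro arg_cong2[where f = "(+)"] nn_integral_cmult_indicator nn_integral_sum) measurable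
  qed measurable
  also have "ennreal (K\<^sup>2 * h) * emeasure lborel {0<..<h} = ennreal (K\<^sup>2 * h\<^sup>2)"
    using h by (simp add: power2_eq_square mult.assoc flip: ennreal_mult'')
  also have "(\<Sum>k<N. \<integral>\<^sup>+s. H (s + real k * h) * indicator {0<..<h} s \<partial>lborel) =
      (\<Sum>k<N. \<integral>\<^sup>+v. H v * indicator {0<..<h} (v - real k * h) \<partial>lborel)"
  proof (rule sum.cong[OF refl])
    fix k
    show "(\<integral>\<^sup>+s. H (s + real k * h) * indicator {0<..<h} s \<partial>lborel) =
      (\<integral>\<^sup>+v. H v * indicator {0<..<h} (v - real k * h) \<partial>lborel)"
      using nn_integral_real_affine[of "\<lambda>v. H v * indicator {0<..<h} (v - real k * h)" 1 "real k * h"]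
      by (simp add: add.commute)
  qed
  also have "\<dots> = (\<integral>\<^sup>+v. (\<Sum>k<N. H v * indicator {0<..<h} (v - real k * h)) \<partial>lborel)"
    by (rule nn_integral_sum[symmetric]) measurable
  also have "\<dots> \<le> (\<integral>\<^sup>+v. H v * indicator {0..T} v \<partial>lborel)"
    unfolding sum_distrib_left[symmetric] by (intro nn_integral_mono mult_left_mono ind) simp
  also have "\<dots> = (\<integral>\<^sup>+v. (\<integral>\<^sup>+u. G v u * indicator {0..T} v \<partial>lborel) \<partial>lborel)"
    unfolding H_def G_def by (intro nn_integral_cong nn_integral_multc[symmetric]) measurable
  \<comment> \<open>Exchanging the integrals puts the translation u outside, so that the inner
    integral is the mean square translation error for a fixed u.\<close>
  also have "\<dots> = (\<integral>\<^sup>+u. (\<integral>\<^sup>+v. G v u * indicator {0..T} v \<partial>lborel) \<partial>lborel)"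
    unfolding G_def by (rule lborel_pair.Fubini'[symmetric]) measurable
  also have "\<dots> = (\<integral>\<^sup>+u\<in>{0..h}. (\<integral>\<^sup>+v\<in>{0..T}. ennreal ((f (v + u) - f v)\<^sup>2) \<partial>lborel) \<partial>lborel)"
    unfolding G_def by (intro nn_integral_cong) (simp add: indicator_def)
  finally show ?thesis unfolding h_def by (simp add: add_left_mono)
qed

section \<open>Density of the simple processes\<close>

text \<open>Dominated convergence for the indicators of the events. Values in \<open>ennreal\<close>
  are allowed so that it applies to \<open>quad\<close>.\<close>

lemma (in prob_space) tendsto_AE_imp_tendsto_prob:
  fixes X :: "nat \<Rightarrow> 'a \<Rightarrow> ennreal"
  assumes X[measurable]: "\<And>n. X n \<in> borel_measurable M" and lim: "AE \<omega> in M. (\<lambda>n. X n \<omega>) \<longlonglongrightarrow> 0" and \<epsilon>: "0 < \<epsilon>"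
  shows "(\<lambda>n. prob {\<omega>\<in>space M. ennreal \<epsilon> < X n \<omega>}) \<longlonglongrightarrow> 0"
proof -
  have "(\<lambda>n. \<integral>\<^sup>+\<omega>. indicator {\<omega>\<in>space M. ennreal \<epsilon> < X n \<omega>} \<omega> \<partial>M) \<longlonglongrightarrow> (\<integral>\<^sup>+\<omega>. 0 \<partial>M)"
  proof (rule nn_integral_dominated_convergence[where w = "\<lambda>_. 1"])
    show "AE \<omega> in M. (\<lambda>n. indicator {\<omega>\<in>space M. ennreal \<epsilon> < X n \<omega>} \<omega>) \<longlonglongrightarrow> (0 :: ennreal)"
      using lim
    proof eventually_elim
      case (elim \<omega>)
      then have "\<forall>\<^sub>F n in sequentially. X n \<omega> < ennreal \<epsilon>"
        by (rule order_tendstoD) (use \<epsilon> in simp)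
      then have "\<forall>\<^sub>F n in sequentially. indicator {\<omega>\<in>space M. ennreal \<epsilon> < X n \<omega>} \<omega> = (0 :: ennreal)"
        by eventually_elim (auto simp: indicator_def dest: less_asym)
      then show ?case by (rule tendsto_eventually)
    qed
  qed (auto simp: indicator_def emeasure_space_1)
  then have "(\<lambda>n. ennreal (prob {\<omega>\<in>space M. ennreal \<epsilon> < X n \<omega>})) \<longlonglongrightarrow> ennreal 0"
    by (simp add: emeasure_eq_measure)
  then show ?thesis by (subst (asm) tendsto_ennreal_iff) auto
qed

section \<open>Joint measurability and the integral of the square\<close>

lemma jointly_measurableI:
  assumes "(\<lambda>(\<omega>, t). X t \<omega>) \<in> borel_measurable (M \<Otimes>\<^sub>M borel)"
  shows "jointly_measurable M X"
proof -
  have [measurable]: "(\<lambda>t. t) \<in> restrict_space borel {0..} \<rightarrow>\<^sub>M (borel :: real measure)"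
    by (rule measurable_restrict_space1) simp
  have "(\<lambda>p. (fst p, snd p)) \<in> M \<Otimes>\<^sub>M restrict_space borel {0::real..} \<rightarrow>\<^sub>M M \<Otimes>\<^sub>M borel"
    by (intro measurable_Pair measurable_fst measurable_compose[OF measurable_snd]) measurable
  from measurable_compose[OF this assms] show ?thesis
    by (simp add: jointly_measurable_def case_prod_beta')
qed

text \<open>Freezing the process at its time-0 value for negative times makes it measurable on the
  whole line, where translations and the product with \<open>lborel\<close> are available. On [0,T]
  nothing changes.\<close>

lemma jointly_measurable_extend:
  assumes "jointly_measurable M X"
  shows "(\<lambda>p. X (max 0 (snd p)) (fst p)) \<in> borel_measurable (M \<Otimes>\<^sub>M borel)"
proof -
  have "(\<lambda>t::real. max 0 t) \<in> borel \<rightarrow>\<^sub>M restrict_space borel {0..}"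
    by (intro measurable_restrict_space2) auto
  then have "(\<lambda>p. (fst p, max 0 (snd p))) \<in> M \<Otimes>\<^sub>M borel \<rightarrow>\<^sub>M M \<Otimes>\<^sub>M restrict_space borel {0::real..}"
    by (intro measurable_Pair measurable_fst measurable_compose[OF measurable_snd])
  from measurable_compose[OF this assms[unfolded jointly_measurable_def]] show ?thesis by simp
qed

lemma jointly_measurable_diff:
  "jointly_measurable M b \<Longrightarrow> jointly_measurable M c \<Longrightarrow> jointly_measurable M (\<lambda>s \<omega>. b s \<omega> - c s \<omega>)"
  unfolding jointly_measurable_def case_prod_beta' by (rule borel_measurable_diff)

lemma quad_extend: "quad b T \<omega> = (\<integral>\<^sup>+s. ennreal ((b (max 0 s) \<omega>)\<^sup>2) * indicator {0..T} s \<partial>lborel)"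
  unfolding quad_def by (intro nn_integral_cong) (simp add: indicator_def)

lemma quad_measurable:
  assumes "jointly_measurable M b" shows "quad b T \<in> borel_measurable M"
proof -
  have "(\<lambda>(\<omega>, s). ennreal ((b (max 0 s) \<omega>)\<^sup>2) * indicator {0..T} s) \<in> borel_measurable (M \<Otimes>\<^sub>M lborel)"
    using jointly_measurable_extend[OF assms] unfolding case_prod_beta' by measurable
  from lborel.borel_measurable_nn_integral[OF this] show ?thesis
    unfolding quad_extend[abs_def] .
qed

lemma path_measurable:
  assumes "jointly_measurable M b" "\<omega> \<in> space M" shows "(\<lambda>s. b (max 0 s) \<omega>) \<in> borel_measurable borel"
  using measurable_compose[OF measurable_Pair1'[OF assms(2)] jointly_measurable_extend[OF assms(1)]] by simp

lemma quad_diff_le: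
  assumes "jointly_measurable M b" "jointly_measurable M a" "jointly_measurable M c" "\<omega> \<in> space M"
  shows "quad (\<lambda>s \<omega>. b s \<omega> - c s \<omega>) T \<omega> \<le>
    2 * quad (\<lambda>s \<omega>. b s \<omega> - a s \<omega>) T \<omega> + 2 * quad (\<lambda>s \<omega>. a s \<omega> - c s \<omega>) T \<omega>"
proof -
  let ?b = "\<lambda>s. b (max 0 s) \<omega>" and ?a = "\<lambda>s. a (max 0 s) \<omega>" and ?c = "\<lambda>s. c (max 0 s) \<omega>"
  have [measurable]: "?b \<in> borel_measurable borel" "?a \<in> borel_measurable borel" "?c \<in> borel_measurable borel"
    using assms by (auto intro: path_measurable)
  have "ennreal ((x - z)\<^sup>2) \<le> 2 * ennreal ((x - y)\<^sup>2) + 2 * ennreal ((y - z)\<^sup>2)" for x y z :: real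
  proof -
    have "0 \<le> ((x - y) - (y - z))\<^sup>2" by simp
    then have "(x - z)\<^sup>2 \<le> 2 * (x - y)\<^sup>2 + 2 * (y - z)\<^sup>2" by (simp add: power2_eq_square algebra_simps)
    then have "ennreal ((x - z)\<^sup>2) \<le> ennreal (2 * (x - y)\<^sup>2 + 2 * (y - z)\<^sup>2)" by (rule ennreal_leI)
    also have "\<dots> = 2 * ennreal ((x - y)\<^sup>2) + 2 * ennreal ((y - z)\<^sup>2)" by (simp add: ennreal_mult')
    finally show ?thesis .
  qed
  then have "quad (\<lambda>s \<omega>. b s \<omega> - c s \<omega>) T \<omega> \<le>
    (\<integral>\<^sup>+s. 2 * (ennreal ((?b s - ?a s)\<^sup>2) * indicator {0..T} s) + 2 * (ennreal ((?a s - ?c s)\<^sup>2) * indicator {0..T} s) \<partial>lborel)"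
    unfolding quad_extend by (intro nn_integral_mono) (simp add: indicator_def)
  also have "\<dots> = 2 * quad (\<lambda>s \<omega>. b s \<omega> - a s \<omega>) T \<omega> + 2 * quad (\<lambda>s \<omega>. a s \<omega> - c s \<omega>) T \<omega>"
    unfolding quad_extend by (simp add: nn_integral_add nn_integral_cmult)
  finally show ?thesis .
qed

lemma quad_mono: "T \<le> T' \<Longrightarrow> quad b T \<omega> \<le> quad b T' \<omega>"
  unfolding quad_def by (intro nn_integral_mono) (auto split: split_indicator)

lemma quad_bounded:
  assumes "\<And>s. 0 \<le> s \<Longrightarrow> \<bar>b s \<omega>\<bar> \<le> K" "0 \<le> T" shows "quad b T \<omega> \<le> ennreal (K\<^sup>2 * T)"
proof -
  have "(b s \<omega>)\<^sup>2 \<le> K\<^sup>2" if "0 \<le> s" for s using assms(1)[OF that] by (metis abs_ge_self abs_le_square_iff order.trans)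
  then have "quad b T \<omega> \<le> (\<integral>\<^sup>+s. ennreal (K\<^sup>2) * indicator {0..T} s \<partial>lborel)"
    unfolding quad_def by (intro nn_integral_mono) (auto intro!: ennreal_leI split: split_indicator)
  also have "\<dots> = ennreal (K\<^sup>2 * T)" using assms(2) by (simp add: nn_integral_cmult_indicator ennreal_mult')
  finally show ?thesis .
qed

context wiener
begin

lemma H2_subset_L2: "H2_processes M F \<subseteq> L2_processes M F"
proof
  fix b assume b: "b \<in> H2_processes M F"
  then have jm: "jointly_measurable M b" by (simp add: H2_processes_def)
  have "AE \<omega> in M. quad b t \<omega> < \<infinity>" if "0 \<le> t" for t
  proof -
    have "(\<integral>\<^sup>+\<omega>. quad b t \<omega> \<partial>M) \<noteq> \<infinity>"
      using b that by (auto simp: H2_processes_def quad_def)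
    from nn_integral_noteq_infinite[OF quad_measurable[OF jm] this] show ?thesis
      by (simp add: less_top)
  qed
  then show "b \<in> L2_processes M F" using b by (simp add: H2_processes_def L2_processes_def quad_def)
qed

lemma bounded_H2:
  assumes "jointly_measurable M b" "adapted F b" "\<And>s \<omega>. 0 \<le> s \<Longrightarrow> \<omega> \<in> space M \<Longrightarrow> \<bar>b s \<omega>\<bar> \<le> K"
  shows "b \<in> H2_processes M F"
proof -
  have "(\<integral>\<^sup>+\<omega>. quad b t \<omega> \<partial>M) < \<infinity>" if "0 \<le> t" for t
  proof -
    have "(\<integral>\<^sup>+\<omega>. quad b t \<omega> \<partial>M) \<le> (\<integral>\<^sup>+\<omega>. ennreal (K\<^sup>2 * t) \<partial>M)"
      using assms(3) that by (intro nn_integral_mono quad_bounded) auto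
    also have "\<dots> < \<infinity>" by (simp add: emeasure_space_1 ennreal_mult_less_top)
    finally show ?thesis .
  qed
  then show ?thesis using assms by (simp add: H2_processes_def quad_def)
qed

text \<open>The passage from predictable coefficients to a simple process. Since c vanishes at time
  0, the term for the point 0 in the representation is 0.\<close>

lemma step_process:
  assumes g: "grid n \<tau>" and \<xi>: "\<And>i. i < n \<Longrightarrow> \<xi> i \<in> borel_measurable (F (\<tau> i))"
  defines "c \<equiv> \<lambda>t \<omega>. \<Sum>i<n. \<xi> i \<omega> * indicator {\<tau> i<..\<tau> (Suc i)} t"
  shows "step_representation M c n \<tau>" "simple_process M F c" "jointly_measurable M c" "adapted F c"
proof -
  have c_cell: "c (\<tau> (Suc i)) \<omega> = \<xi> i \<omega>" if "i < n" for i \<omega>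
    unfolding c_def using step_on_cell[OF g that grid_less[OF g lessI] order_refl, of "\<lambda>i. \<xi> i \<omega>"] that by simp
  have c0: "c (\<tau> 0) \<omega> = 0" for \<omega>
    unfolding c_def using step_beyond[OF g, of "\<tau> 0" "\<lambda>i. \<xi> i \<omega>"] grid_zero[OF g] by simp
  have sum_eq: "c s \<omega> = (\<Sum>i=1..n. c (\<tau> i) \<omega> * indicator {\<tau> (i - 1)<..\<tau> i} s)" for s \<omega>
  proof -
    have "c s \<omega> = (\<Sum>i<n. c (\<tau> (Suc i)) \<omega> * indicator {\<tau> i<..\<tau> (Suc i)} s)"
      using c_cell by (simp add: c_def)
    also have "\<dots> = (\<Sum>i=1..n. c (\<tau> i) \<omega> * indicator {\<tau> (i - 1)<..\<tau> i} s)"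
      by (rule sum.reindex_bij_witness[of _ "\<lambda>i. i - 1" Suc]) auto
    finally show ?thesis .
  qed
  have "c s \<omega> = c (\<tau> 0) \<omega> * indicator {0} s + (\<Sum>i=1..n. c (\<tau> i) \<omega> * indicator {\<tau> (i - 1)<..\<tau> i} s)" for s \<omega>
    unfolding c0 using sum_eq[of s \<omega>] by linarith
  then show rep: "step_representation M c n \<tau>"
    using g unfolding step_representation_def grid_def by blast
  have "c (\<tau> i) \<in> borel_measurable (F (\<tau> (i - 1)))" if i: "i \<in> {1..n}" for i
  proof -
    obtain j where j: "i = Suc j" "j < n" using i by (cases i) auto
    have "c (\<tau> (Suc j)) = \<xi> j" using c_cell[OF j(2)] by auto
    then show ?thesis using \<xi>[OF j(2)] j(1) by simp
  qed
  moreover have "c (\<tau> 0) = (\<lambda>_. 0)" using c0 by auto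
  ultimately show "simple_process M F c"
    unfolding simple_process_def using rep by (intro exI[of _ n] exI[of _ \<tau>]) simp
  have [measurable]: "\<xi> i \<in> borel_measurable M" if "i < n" for i
    using measurable_F_M[OF grid_nonneg[OF g] \<xi>[OF that]] that by simp
  show "jointly_measurable M c"
    unfolding c_def by (intro jointly_measurableI) measurable
  show "adapted F c"
    unfolding adapted_def c_def
  proof (intro allI impI borel_measurable_sum)
    fix t :: real and i assume t: "0 \<le> t" and "i \<in> {..<n}"
    then have i: "i < n" by simp
    show "(\<lambda>\<omega>. \<xi> i \<omega> * indicator {\<tau> i<..\<tau> (Suc i)} t) \<in> borel_measurable (F t)"
    \<comment> \<open>Cells are open on the left, so a coefficient is visible at t only if its cell
      began strictly before t.\<close>
    proof (cases "\<tau> i < t")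
      case True
      then have "\<xi> i \<in> borel_measurable (F t)"
        by (intro measurable_F_mono[OF grid_nonneg[OF g] less_imp_le \<xi>[OF i]]) (use i in simp)
      then show ?thesis by measurable
    next
      case False
      then show ?thesis by simp
    qed
  qed
qed

text \<open>The expected sampling error, averaged over the shift, tends to 0 with the mesh; hence
  some deterministic shift does at least as well as required. The result takes values in [-K,K] and
  therefore lies in \<open>H2_processes M F\<close>.\<close>

lemma approximation_bounded:
  assumes jm: "jointly_measurable M b" and ad: "adapted F b"
    and K: "\<And>t \<omega>. 0 \<le> t \<Longrightarrow> \<omega> \<in> space M \<Longrightarrow> \<bar>b t \<omega>\<bar> \<le> K" and T: "0 < T" and \<eta>: "0 < \<eta>"
  obtains c n \<tau> where "step_representation M c n \<tau>" "\<tau> n \<le> T" "simple_process M F c" "c \<in> H2_processes M F"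
    "(\<integral>\<^sup>+\<omega>. quad (\<lambda>s \<omega>. b s \<omega> - c s \<omega>) T \<omega> \<partial>M) < ennreal \<eta>"
proof -
  define f where "f \<omega> t = b (max 0 t) \<omega>" for \<omega> t
  have fm[measurable]: "(\<lambda>p. f (fst p) (snd p)) \<in> borel_measurable (M \<Otimes>\<^sub>M borel)"
    unfolding f_def by (rule jointly_measurable_extend[OF jm])
  have fpath: "f \<omega> \<in> borel_measurable borel" if "\<omega> \<in> space M" for \<omega>
    unfolding f_def by (rule path_measurable[OF jm that])
  have fK: "\<bar>f \<omega> t\<bar> \<le> K" if "\<omega> \<in> space M" for \<omega> t
    unfolding f_def by (rule K[OF _ that]) simp
  \<comment> \<open>The sampling error of one path for mesh T / N and shift s; \<open>A\<close> is
    the integrated translation error that bounds its integral over s.\<close>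
  define err where "err N s \<omega> = (\<integral>\<^sup>+t. ennreal ((f \<omega> t - sampled T N s (f \<omega>) t)\<^sup>2) * indicator {0..T} t \<partial>lborel)" for N s \<omega>
  define A where "A N \<omega> = (\<integral>\<^sup>+u. (\<integral>\<^sup>+v. ennreal ((f \<omega> (v + u) - f \<omega> v)\<^sup>2) * indicator {0..T} v \<partial>lborel) * indicator {0..T / real N} u \<partial>lborel)" for N \<omega>
  have comp: "(\<lambda>x. f (X x) (Y x)) \<in> borel_measurable L" if "X \<in> L \<rightarrow>\<^sub>M M" "Y \<in> borel_measurable L" for L :: "(('a \<times> real) \<times> real) measure" and X Y
    using measurable_compose[OF measurable_Pair[OF that] fm] by simp
  have errm[measurable]: "(\<lambda>(\<omega>, s). err N s \<omega>) \<in> borel_measurable (M \<Otimes>\<^sub>M lborel)" for N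
  proof -
    have "(\<lambda>(p, t). ennreal ((f (fst p) t - sampled T N (snd p) (f (fst p)) t)\<^sup>2) * indicator {0..T} t)
      \<in> borel_measurable ((M \<Otimes>\<^sub>M (lborel :: real measure)) \<Otimes>\<^sub>M (lborel :: real measure))"
    proof -
      have [measurable]: "(\<lambda>x. f (fst (fst x)) (snd x)) \<in> borel_measurable ((M \<Otimes>\<^sub>M (lborel :: real measure)) \<Otimes>\<^sub>M (lborel :: real measure))"
        by (rule comp) measurable
      have sg[measurable]: "(\<lambda>x. shifted_grid T N (snd (fst x)) i) \<in> borel_measurable ((M \<Otimes>\<^sub>M (lborel :: real measure)) \<Otimes>\<^sub>M (lborel :: real measure))" for i
        unfolding shifted_grid_def by measurable
      have [measurable]: "(\<lambda>x. f (fst (fst x)) (shifted_grid T N (snd (fst x)) i)) \<in> borel_measurable ((M \<Otimes>\<^sub>M (lborel :: real measure)) \<Otimes>\<^sub>M (lborel :: real measure))" for i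
        by (rule comp[OF _ sg]) measurable
      have ind: "indicator {a<..b} t = (if a < t \<and> t \<le> b then 1 else 0 :: real)" for a b t :: real
        by (simp add: indicator_def)
      show ?thesis
        unfolding case_prod_beta' sampled_def ind by measurable
    qed
    from lborel.borel_measurable_nn_integral[OF this] show ?thesis
      unfolding err_def case_prod_beta' .
  qed
  have Am[measurable]: "A N \<in> borel_measurable M" for N
  proof -
    have [measurable]: "(\<lambda>x. f (fst (fst x)) (snd x + snd (fst x))) \<in> borel_measurable ((M \<Otimes>\<^sub>M (lborel :: real measure)) \<Otimes>\<^sub>M (lborel :: real measure))"
        "(\<lambda>x. f (fst (fst x)) (snd x)) \<in> borel_measurable ((M \<Otimes>\<^sub>M (lborel :: real measure)) \<Otimes>\<^sub>M (lborel :: real measure))"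
      by (rule comp; measurable)+
    have "(\<lambda>(p, v). ennreal ((f (fst p) (v + snd p) - f (fst p) v)\<^sup>2) * indicator {0..T} v)
        \<in> borel_measurable ((M \<Otimes>\<^sub>M (lborel :: real measure)) \<Otimes>\<^sub>M (lborel :: real measure))"
      unfolding case_prod_beta' by measurable
    from lborel.borel_measurable_nn_integral[OF this]
    have [measurable]: "(\<lambda>p. \<integral>\<^sup>+v. ennreal ((f (fst p) (v + snd p) - f (fst p) v)\<^sup>2) * indicator {0..T} v \<partial>lborel)
        \<in> borel_measurable (M \<Otimes>\<^sub>M lborel)" .
    have "(\<lambda>(\<omega>, u). (\<integral>\<^sup>+v. ennreal ((f \<omega> (v + u) - f \<omega> v)\<^sup>2) * indicator {0..T} v \<partial>lborel) * indicator {0..T / real N} u)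
        \<in> borel_measurable (M \<Otimes>\<^sub>M lborel)"
      unfolding case_prod_beta' by measurable
    from lborel.borel_measurable_nn_integral[OF this] show ?thesis unfolding A_def[abs_def] .
  qed
  define h where "h N = T / real N" for N
  have hpos: "0 < h (Suc m)" for m using T by (simp add: h_def)
  have hlim: "(\<lambda>m. h (Suc m)) \<longlonglongrightarrow> 0"
    unfolding h_def using LIMSEQ_Suc[OF lim_const_over_n[of T]] by simp
  \<comment> \<open>The mean over translations u in [0,h] of the translation error of the path. The
    index \<open>Suc m\<close> keeps the number of cells positive.\<close>
  define a where "a m \<omega> = ennreal (1 / h (Suc m)) * A (Suc m) \<omega>" for m \<omega>
  have am[measurable]: "a m \<in> borel_measurable M" for m unfolding a_def by measurable
  have a_le: "a m \<omega> \<le> C" if C: "\<And>u. u \<in> {0..h (Suc m)} \<Longrightarrow>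
      (\<integral>\<^sup>+v. ennreal ((f \<omega> (v + u) - f \<omega> v)\<^sup>2) * indicator {0..T} v \<partial>lborel) \<le> C" for m \<omega> C
  proof -
    have "A (Suc m) \<omega> \<le> (\<integral>\<^sup>+u. C * indicator {0..h (Suc m)} u \<partial>lborel)"
      unfolding A_def h_def[symmetric] by (intro nn_integral_mono) (auto intro: C split: split_indicator)
    also have "\<dots> = C * ennreal (h (Suc m))" using hpos[of m] by (simp add: nn_integral_cmult_indicator)
    finally have "a m \<omega> \<le> ennreal (1 / h (Suc m)) * (C * ennreal (h (Suc m)))"
      unfolding a_def by (rule mult_left_mono) simp
    also have "\<dots> = C * (ennreal (1 / h (Suc m)) * ennreal (h (Suc m)))" by (simp add: ac_simps)
    also have "ennreal (1 / h (Suc m)) * ennreal (h (Suc m)) = 1"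
      using hpos[of m] by (simp flip: ennreal_mult'')
    finally show ?thesis by simp
  qed
  have "(\<lambda>m. \<integral>\<^sup>+\<omega>. a m \<omega> \<partial>M) \<longlonglongrightarrow> (\<integral>\<^sup>+\<omega>. 0 \<partial>M)"
  proof (rule nn_integral_dominated_convergence[where w = "\<lambda>_. ennreal ((2 * K)\<^sup>2 * T)"])
    show "AE \<omega> in M. a m \<omega> \<le> ennreal ((2 * K)\<^sup>2 * T)" for m
    proof (intro AE_I2 a_le)
      fix \<omega> u assume \<omega>: "\<omega> \<in> space M"
      have "(f \<omega> (v + u) - f \<omega> v)\<^sup>2 \<le> (2 * K)\<^sup>2" for v
      proof -
        have "\<bar>f \<omega> (v + u) - f \<omega> v\<bar> \<le> \<bar>2 * K\<bar>" using fK[OF \<omega>, of "v + u"] fK[OF \<omega>, of v] by linarith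
        then show ?thesis by (simp add: abs_le_square_iff)
      qed
      then have "(\<integral>\<^sup>+v. ennreal ((f \<omega> (v + u) - f \<omega> v)\<^sup>2) * indicator {0..T} v \<partial>lborel) \<le>
        (\<integral>\<^sup>+v. ennreal ((2 * K)\<^sup>2) * indicator {0..T} v \<partial>lborel)"
        by (intro nn_integral_mono mult_right_mono ennreal_leI) auto
      also have "\<dots> = ennreal ((2 * K)\<^sup>2 * T)" using T by (simp add: nn_integral_cmult_indicator ennreal_mult')
      finally show "(\<integral>\<^sup>+v. ennreal ((f \<omega> (v + u) - f \<omega> v)\<^sup>2) * indicator {0..T} v \<partial>lborel) \<le> ennreal ((2 * K)\<^sup>2 * T)" .
    qed
    show "AE \<omega> in M. (\<lambda>m. a m \<omega>) \<longlonglongrightarrow> 0"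
    proof (rule AE_I2)
      fix \<omega> assume \<omega>: "\<omega> \<in> space M"
      show "(\<lambda>m. a m \<omega>) \<longlonglongrightarrow> 0"
      proof (rule order_tendstoI)
        fix y :: ennreal assume "0 < y"
        then obtain y' where y': "0 < y'" "y' < y" using dense by blast
        then obtain e where "y' = ennreal e" by (cases y') auto
        then have e: "0 < e" "ennreal e < y" using y' by auto
        obtain d where d: "0 < d"
            "\<forall>u\<in>{0..d}. (\<integral>\<^sup>+v\<in>{0..T}. ennreal ((f \<omega> (v + u) - f \<omega> v)\<^sup>2) \<partial>lborel) \<le> ennreal e"
          by (rule translation_L2_continuous[OF fpath[OF \<omega>] fK[OF \<omega>] T e(1)])
        have "\<forall>\<^sub>F m in sequentially. h (Suc m) < d" by (rule order_tendstoD(2)[OF hlim d(1)])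
        then show "\<forall>\<^sub>F m in sequentially. a m \<omega> < y"
        proof eventually_elim
          case (elim m)
          have "a m \<omega> \<le> ennreal e"
          proof (rule a_le)
            fix u assume "u \<in> {0..h (Suc m)}"
            then have "u \<in> {0..d}" using elim by simp
            with d(2) show "(\<integral>\<^sup>+v\<in>{0..T}. ennreal ((f \<omega> (v + u) - f \<omega> v)\<^sup>2) \<partial>lborel) \<le> ennreal e"
              by (rule bspec)
          qed
          then show ?case using e(2) by simp
        qed
      qed simp
    qed
  qed (auto simp: emeasure_space_1 ennreal_mult_less_top)
  then have alim: "(\<lambda>m. \<integral>\<^sup>+\<omega>. a m \<omega> \<partial>M) \<longlonglongrightarrow> 0" by simp
  \<comment> \<open>The initial stretch and the translation error get \<eta>/4 each, so the mean
    over shifts is at most \<eta>/2.\<close>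
  have "\<forall>\<^sub>F m in sequentially. (\<integral>\<^sup>+\<omega>. a m \<omega> \<partial>M) < ennreal (\<eta> / 4)"
    by (rule order_tendstoD(2)[OF alim]) (use \<eta> in simp)
  moreover have "(\<lambda>m. K\<^sup>2 * h (Suc m)) \<longlonglongrightarrow> K\<^sup>2 * 0" by (intro tendsto_intros hlim)
  then have "\<forall>\<^sub>F m in sequentially. K\<^sup>2 * h (Suc m) < \<eta> / 4"
    by (rule order_tendstoD(2)) (use \<eta> in simp)
  ultimately have "\<forall>\<^sub>F m in sequentially. (\<integral>\<^sup>+\<omega>. a m \<omega> \<partial>M) < ennreal (\<eta> / 4) \<and> K\<^sup>2 * h (Suc m) < \<eta> / 4"
    by (rule eventually_conj)
  then obtain m where m: "(\<integral>\<^sup>+\<omega>. a m \<omega> \<partial>M) < ennreal (\<eta> / 4)" "K\<^sup>2 * h (Suc m) < \<eta> / 4"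
    by (auto simp: eventually_sequentially)
  let ?N = "Suc m" and ?h = "h (Suc m)"
  interpret P: pair_sigma_finite M lborel by standard
  have "(\<integral>\<^sup>+s. (\<integral>\<^sup>+\<omega>. err ?N s \<omega> \<partial>M) * indicator {0<..<?h} s \<partial>lborel) =
      (\<integral>\<^sup>+s. (\<integral>\<^sup>+\<omega>. err ?N s \<omega> * indicator {0<..<?h} s \<partial>M) \<partial>lborel)"
  proof (intro nn_integral_cong nn_integral_multc[symmetric])
    fix s :: real
    have "(\<lambda>\<omega>. (\<omega>, s)) \<in> M \<rightarrow>\<^sub>M M \<Otimes>\<^sub>M lborel" by measurable
    from measurable_compose[OF this errm] show "err ?N s \<in> borel_measurable M" by simp
  qed
  also have "\<dots> = (\<integral>\<^sup>+\<omega>. (\<integral>\<^sup>+s. err ?N s \<omega> * indicator {0<..<?h} s \<partial>lborel) \<partial>M)"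
    by (rule P.Fubini') (use errm[of ?N] in \<open>simp add: case_prod_beta'; measurable\<close>)
  also have "\<dots> \<le> (\<integral>\<^sup>+\<omega>. ennreal (K\<^sup>2 * ?h\<^sup>2) + A ?N \<omega> \<partial>M)"
    using sampled_error_average[OF fpath fK T, where N = "Suc m"]
    by (intro nn_integral_mono) (simp add: err_def A_def h_def)
  also have "\<dots> = ennreal ?h * (ennreal (K\<^sup>2 * ?h) + (\<integral>\<^sup>+\<omega>. a m \<omega> \<partial>M))"
  proof -
    have "A ?N \<omega> = ennreal ?h * a m \<omega>" for \<omega>
      unfolding a_def using hpos[of m] by (simp add: mult.assoc[symmetric] flip: ennreal_mult'')
    then have "(\<integral>\<^sup>+\<omega>. A ?N \<omega> \<partial>M) = ennreal ?h * (\<integral>\<^sup>+\<omega>. a m \<omega> \<partial>M)"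
      by (simp add: nn_integral_cmult)
    moreover have "ennreal (K\<^sup>2 * ?h\<^sup>2) = ennreal ?h * ennreal (K\<^sup>2 * ?h)"
      using hpos[of m] by (simp add: power2_eq_square ac_simps flip: ennreal_mult')
    ultimately show ?thesis
      by (simp add: nn_integral_add emeasure_space_1 distrib_left)
  qed
  also have "\<dots> \<le> ennreal ?h * (ennreal (\<eta> / 4) + ennreal (\<eta> / 4))"
    using m by (intro mult_left_mono add_mono ennreal_leI) auto
  also have "\<dots> = ennreal (?h * (\<eta> / 2))"
    using \<eta> hpos[of m] by (simp flip: ennreal_plus ennreal_mult')
  finally have avg: "(\<integral>\<^sup>+s. (\<integral>\<^sup>+\<omega>. err ?N s \<omega> \<partial>M) * indicator {0<..<?h} s \<partial>lborel) \<le> ennreal (?h * (\<eta> / 2))" .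
  \<comment> \<open>If every shift had error at least \<eta>, the integral over an interval of
    length h would be at least h \<eta>, against the bound h \<eta>/2.\<close>
  have "\<exists>s\<in>{0<..<?h}. (\<integral>\<^sup>+\<omega>. err ?N s \<omega> \<partial>M) < ennreal \<eta>"
  proof (rule ccontr)
    assume "\<not> ?thesis"
    then have ge: "ennreal \<eta> \<le> (\<integral>\<^sup>+\<omega>. err ?N s \<omega> \<partial>M)" if "s \<in> {0<..<?h}" for s
      using that by (meson not_le)
    have "ennreal (?h * \<eta>) = (\<integral>\<^sup>+s. ennreal \<eta> * indicator {0<..<?h} s \<partial>lborel)"
      using hpos[of m] \<eta> by (simp add: nn_integral_cmult_indicator ennreal_mult' mult.commute)
    also have "\<dots> \<le> (\<integral>\<^sup>+s. (\<integral>\<^sup>+\<omega>. err ?N s \<omega> \<partial>M) * indicator {0<..<?h} s \<partial>lborel)"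
      by (intro nn_integral_mono) (auto intro: ge split: split_indicator)
    also note avg
    finally have "?h * \<eta> \<le> ?h * (\<eta> / 2)" using \<eta> hpos[of m] by (subst (asm) ennreal_le_iff) auto
    then show False using \<eta> hpos[of m] by (simp add: mult_le_cancel_left)
  qed
  then obtain s where s: "0 < s" "s < T / real ?N" "(\<integral>\<^sup>+\<omega>. err ?N s \<omega> \<partial>M) < ennreal \<eta>"
    by (auto simp: h_def)
  let ?\<tau> = "shifted_grid T ?N s"
  have g: "grid (Suc ?N) ?\<tau>" by (rule grid_shifted_grid[OF T _ s(1,2)]) simp
  \<comment> \<open>The sampling times are nonnegative, so \<open>f\<close> agrees there with b, and
    adaptedness makes each coefficient known at the left end of its cell.\<close>
  define \<xi> where "\<xi> i \<omega> = (if i = 0 then 0 else f \<omega> (?\<tau> i))" for i \<omega>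
  define c where "c t \<omega> = (\<Sum>i<Suc ?N. \<xi> i \<omega> * indicator {?\<tau> i<..?\<tau> (Suc i)} t)" for t \<omega>
  have c: "c t \<omega> = sampled T ?N s (f \<omega>) t" for t \<omega> by (simp only: c_def \<xi>_def sampled_def)
  have "\<xi> i \<in> borel_measurable (F (?\<tau> i))" if "i < Suc ?N" for i
  proof -
    have "0 \<le> ?\<tau> i" using grid_nonneg[OF g, of i] that by simp
    then have "b (?\<tau> i) \<in> borel_measurable (F (?\<tau> i))" "max 0 (?\<tau> i) = ?\<tau> i"
      using ad by (auto simp: adapted_def)
    then show ?thesis by (cases "i = 0") (simp_all add: \<xi>_def[abs_def] f_def)
  qed
  note c_props = step_process[OF g this, folded c_def[abs_def]]
  show thesis
  proof (rule that[OF c_props(1) _ c_props(2)])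
    show "?\<tau> (Suc ?N) \<le> T" by (simp add: shifted_grid_def)
    show "c \<in> H2_processes M F"
      by (rule bounded_H2[OF c_props(3,4)]) (use sampled_bound[OF T _ s(1,2) fK] in \<open>auto simp: c\<close>)
    have "quad (\<lambda>s \<omega>. b s \<omega> - c s \<omega>) T \<omega> = err ?N s \<omega>" for \<omega>
      unfolding quad_def err_def c by (intro nn_integral_cong) (simp add: f_def indicator_def)
    then show "(\<integral>\<^sup>+\<omega>. quad (\<lambda>s \<omega>. b s \<omega> - c s \<omega>) T \<omega> \<partial>M) < ennreal \<eta>" using s(3) by simp
  qed
qed

end

section \<open>Convergence in probability\<close>

lemma eventually_le_real: "\<forall>\<^sub>F n in sequentially. x \<le> real n"
  using filterlim_real_sequentially by (simp add: filterlim_at_top)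

lemma clip_bounds:
  fixes x k :: real
  assumes "0 \<le> k"
  shows "\<bar>max (- k) (min k x)\<bar> \<le> k" "\<bar>x - max (- k) (min k x)\<bar> \<le> \<bar>x\<bar>"
    "\<bar>x\<bar> \<le> k \<Longrightarrow> max (- k) (min k x) = x"
  using assms by linarith+

lemma quad_commute: "quad (\<lambda>s \<omega>. b s \<omega> - c s \<omega>) T \<omega> = quad (\<lambda>s \<omega>. c s \<omega> - b s \<omega>) T \<omega>"
  unfolding quad_def by (simp add: power2_commute)

text \<open>Convergence in probability of the quadratic error, phrased with \<open>quad\<close> to
  avoid pathwise integrability; \<open>quad_tendsto_iff\<close> links it to the Bochner integral of
  the definition.\<close>

definition quad_tendsto :: "'a measure \<Rightarrow> 'a process \<Rightarrow> (nat \<Rightarrow> 'a process) \<Rightarrow> real \<Rightarrow> bool" where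
  "quad_tendsto M b B t \<longleftrightarrow> (\<forall>\<epsilon>>0.
     (\<lambda>n. measure M {\<omega>\<in>space M. ennreal \<epsilon> < quad (\<lambda>s \<omega>. b s \<omega> - B n s \<omega>) t \<omega>}) \<longlonglongrightarrow> 0)"

context prob_space
begin

text \<open>By \<open>quad_diff_le\<close> two errors of at most \<delta> add up to at most 2
  \<delta> + 2 \<delta>, which explains the factor 4.\<close>

lemma quad_prob_diff_le:
  assumes jm: "jointly_measurable M a" "jointly_measurable M b" "jointly_measurable M c" and \<delta>: "0 \<le> \<delta>"
  shows "prob {\<omega>\<in>space M. ennreal (4 * \<delta>) < quad (\<lambda>s \<omega>. b s \<omega> - c s \<omega>) T \<omega>} \<le>
    prob {\<omega>\<in>space M. ennreal \<delta> < quad (\<lambda>s \<omega>. a s \<omega> - b s \<omega>) T \<omega>} +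
    prob {\<omega>\<in>space M. ennreal \<delta> < quad (\<lambda>s \<omega>. a s \<omega> - c s \<omega>) T \<omega>}"
proof -
  let ?q = "\<lambda>x y \<omega>. quad (\<lambda>s \<omega>. x s \<omega> - y s \<omega>) T \<omega>"
  have [measurable]: "?q a b \<in> borel_measurable M" "?q a c \<in> borel_measurable M" "?q b c \<in> borel_measurable M"
    by (rule quad_measurable jointly_measurable_diff jm)+
  have "{\<omega>\<in>space M. ennreal (4 * \<delta>) < ?q b c \<omega>} \<subseteq>
    {\<omega>\<in>space M. ennreal \<delta> < ?q a b \<omega>} \<union> {\<omega>\<in>space M. ennreal \<delta> < ?q a c \<omega>}"
  proof (rule subsetI, rule ccontr)
    fix \<omega> assume 1: "\<omega> \<in> {\<omega>\<in>space M. ennreal (4 * \<delta>) < ?q b c \<omega>}"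
      and 2: "\<omega> \<notin> {\<omega>\<in>space M. ennreal \<delta> < ?q a b \<omega>} \<union> {\<omega>\<in>space M. ennreal \<delta> < ?q a c \<omega>}"
    then have \<omega>: "\<omega> \<in> space M" and le: "?q a b \<omega> \<le> ennreal \<delta>" "?q a c \<omega> \<le> ennreal \<delta>"
      by (auto simp: not_less)
    have "?q b c \<omega> \<le> 2 * ?q b a \<omega> + 2 * ?q a c \<omega>"
      by (rule quad_diff_le[OF jm(2,1,3) \<omega>])
    also have "\<dots> \<le> 2 * ennreal \<delta> + 2 * ennreal \<delta>"
      using le unfolding quad_commute[of b a] by (intro add_mono mult_left_mono) auto
    also have "\<dots> = ennreal (2 * \<delta>) + ennreal (2 * \<delta>)" by (simp add: ennreal_mult')
    also have "\<dots> = ennreal (4 * \<delta>)" using \<delta> by (subst ennreal_plus[symmetric]) simp_all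
    finally show False using 1 by (auto simp: not_less[symmetric])
  qed
  then have "prob {\<omega>\<in>space M. ennreal (4 * \<delta>) < ?q b c \<omega>} \<le>
    prob ({\<omega>\<in>space M. ennreal \<delta> < ?q a b \<omega>} \<union> {\<omega>\<in>space M. ennreal \<delta> < ?q a c \<omega>})"
    by (intro finite_measure_mono) measurable
  also have "\<dots> \<le> prob {\<omega>\<in>space M. ennreal \<delta> < ?q a b \<omega>} + prob {\<omega>\<in>space M. ennreal \<delta> < ?q a c \<omega>}"
    by (intro measure_Un_le) measurable
  finally show ?thesis .
qed

lemma prob_abs_triangle:
  fixes X Y Z :: "'a \<Rightarrow> real"
  assumes [measurable]: "X \<in> borel_measurable M" "Y \<in> borel_measurable M" "Z \<in> borel_measurable M"
  shows "prob {\<omega>\<in>space M. \<epsilon> < \<bar>X \<omega> - Z \<omega>\<bar>} \<le>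
    prob {\<omega>\<in>space M. \<epsilon> / 2 < \<bar>X \<omega> - Y \<omega>\<bar>} + prob {\<omega>\<in>space M. \<epsilon> / 2 < \<bar>Y \<omega> - Z \<omega>\<bar>}"
proof -
  have "prob {\<omega>\<in>space M. \<epsilon> < \<bar>X \<omega> - Z \<omega>\<bar>} \<le>
    prob ({\<omega>\<in>space M. \<epsilon> / 2 < \<bar>X \<omega> - Y \<omega>\<bar>} \<union> {\<omega>\<in>space M. \<epsilon> / 2 < \<bar>Y \<omega> - Z \<omega>\<bar>})"
  proof (rule finite_measure_mono)
    show "{\<omega>\<in>space M. \<epsilon> < \<bar>X \<omega> - Z \<omega>\<bar>} \<subseteq>
      {\<omega>\<in>space M. \<epsilon> / 2 < \<bar>X \<omega> - Y \<omega>\<bar>} \<union> {\<omega>\<in>space M. \<epsilon> / 2 < \<bar>Y \<omega> - Z \<omega>\<bar>}"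
    proof
      fix \<omega> assume \<omega>: "\<omega> \<in> {\<omega>\<in>space M. \<epsilon> < \<bar>X \<omega> - Z \<omega>\<bar>}"
      then have "\<epsilon> / 2 < \<bar>X \<omega> - Y \<omega>\<bar> \<or> \<epsilon> / 2 < \<bar>Y \<omega> - Z \<omega>\<bar>"
        unfolding mem_Collect_eq by linarith
      then show "\<omega> \<in> {\<omega>\<in>space M. \<epsilon> / 2 < \<bar>X \<omega> - Y \<omega>\<bar>} \<union> {\<omega>\<in>space M. \<epsilon> / 2 < \<bar>Y \<omega> - Z \<omega>\<bar>}"
        using \<omega> by blast
    qed
  qed measurable
  also have "\<dots> \<le> prob {\<omega>\<in>space M. \<epsilon> / 2 < \<bar>X \<omega> - Y \<omega>\<bar>} + prob {\<omega>\<in>space M. \<epsilon> / 2 < \<bar>Y \<omega> - Z \<omega>\<bar>}"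
    by (intro measure_Un_le) measurable
  finally show ?thesis .
qed

lemma converges_in_probability_unique:
  assumes X: "\<And>n. X n \<in> borel_measurable M" and [measurable]: "Y \<in> borel_measurable M" "Z \<in> borel_measurable M"
    and "converges_in_probability M X Y" "converges_in_probability M X Z"
  shows "AE \<omega> in M. Y \<omega> = Z \<omega>"
proof -
  have zero: "prob {\<omega>\<in>space M. \<epsilon> < \<bar>Y \<omega> - Z \<omega>\<bar>} = 0" if "0 < \<epsilon>" for \<epsilon>
  proof -
    have "0 < \<epsilon> / 2" using that by simp
    then have "(\<lambda>n. prob {\<omega>\<in>space M. \<epsilon> / 2 < \<bar>X n \<omega> - Y \<omega>\<bar>} + prob {\<omega>\<in>space M. \<epsilon> / 2 < \<bar>X n \<omega> - Z \<omega>\<bar>}) \<longlonglongrightarrow> 0 + 0"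
      using assms(4,5) unfolding converges_in_probability_def by (intro tendsto_add) blast+
    moreover have "prob {\<omega>\<in>space M. \<epsilon> < \<bar>Y \<omega> - Z \<omega>\<bar>} \<le>
      prob {\<omega>\<in>space M. \<epsilon> / 2 < \<bar>X n \<omega> - Y \<omega>\<bar>} + prob {\<omega>\<in>space M. \<epsilon> / 2 < \<bar>X n \<omega> - Z \<omega>\<bar>}" for n
      using prob_abs_triangle[OF assms(2) X assms(3), of \<epsilon> n] by (simp add: abs_minus_commute)
    ultimately have "prob {\<omega>\<in>space M. \<epsilon> < \<bar>Y \<omega> - Z \<omega>\<bar>} \<le> 0 + 0"
      by (intro LIMSEQ_le_const) blast+
    then show ?thesis by (simp add: measure_le_0_iff)
  qed
  have "AE \<omega> in M. \<not> 1 / real (Suc k) < \<bar>Y \<omega> - Z \<omega>\<bar>" for k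
  proof -
    have "{\<omega>\<in>space M. 1 / real (Suc k) < \<bar>Y \<omega> - Z \<omega>\<bar>} \<in> null_sets M"
      using zero[of "1 / real (Suc k)"] by (intro null_setsI) (auto simp: emeasure_eq_measure)
    then show ?thesis by (rule AE_I') auto
  qed
  then have "AE \<omega> in M. \<forall>k. \<not> 1 / real (Suc k) < \<bar>Y \<omega> - Z \<omega>\<bar>" by (simp add: AE_all_countable)
  then show ?thesis
  proof eventually_elim
    case (elim \<omega>)
    show ?case
    proof (rule ccontr)
      assume "Y \<omega> \<noteq> Z \<omega>"
      then have "0 < \<bar>Y \<omega> - Z \<omega>\<bar>" by simp
      then obtain k where "inverse (real (Suc k)) < \<bar>Y \<omega> - Z \<omega>\<bar>" using reals_Archimedean by blast
      then show False using elim by (simp add: inverse_eq_divide)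
    qed
  qed
qed

lemma converges_in_probability_AE:
  assumes [measurable]: "\<And>n. X n \<in> borel_measurable M" "Y \<in> borel_measurable M"
    and lim: "AE \<omega> in M. (\<lambda>n. X n \<omega>) \<longlonglongrightarrow> Y \<omega>"
  shows "converges_in_probability M X Y"
  unfolding converges_in_probability_def
proof (intro allI impI)
  fix \<epsilon> :: real assume \<epsilon>: "0 < \<epsilon>"
  have "AE \<omega> in M. (\<lambda>n. ennreal \<bar>X n \<omega> - Y \<omega>\<bar>) \<longlonglongrightarrow> 0"
    using lim
  proof eventually_elim
    case (elim \<omega>)
    then have "(\<lambda>n. ennreal \<bar>X n \<omega> - Y \<omega>\<bar>) \<longlonglongrightarrow> ennreal \<bar>Y \<omega> - Y \<omega>\<bar>"
      by (intro tendsto_ennrealI tendsto_intros)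
    then show ?case by simp
  qed
  then have "(\<lambda>n. prob {\<omega>\<in>space M. ennreal \<epsilon> < ennreal \<bar>X n \<omega> - Y \<omega>\<bar>}) \<longlonglongrightarrow> 0"
    by (intro tendsto_AE_imp_tendsto_prob \<epsilon>) measurable
  then show "(\<lambda>n. prob {\<omega>\<in>space M. \<epsilon> < \<bar>X n \<omega> - Y \<omega>\<bar>}) \<longlonglongrightarrow> 0"
    using \<epsilon> by (simp add: ennreal_less_iff)
qed

lemma converges_in_probability_cong_AE:
  assumes [measurable]: "\<And>n. X n \<in> borel_measurable M" "\<And>n. X' n \<in> borel_measurable M" "Y \<in> borel_measurable M"
    and eq: "\<And>n. AE \<omega> in M. X n \<omega> = X' n \<omega>" and X: "converges_in_probability M X Y"
  shows "converges_in_probability M X' Y"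
proof -
  have "prob {\<omega>\<in>space M. \<epsilon> < \<bar>X' n \<omega> - Y \<omega>\<bar>} = prob {\<omega>\<in>space M. \<epsilon> < \<bar>X n \<omega> - Y \<omega>\<bar>}" for \<epsilon> n
  proof (rule finite_measure_eq_AE)
    show "AE \<omega> in M. (\<omega> \<in> {\<omega>\<in>space M. \<epsilon> < \<bar>X' n \<omega> - Y \<omega>\<bar>}) = (\<omega> \<in> {\<omega>\<in>space M. \<epsilon> < \<bar>X n \<omega> - Y \<omega>\<bar>})"
      using eq[of n] by eventually_elim simp
  qed measurable
  then show ?thesis using X by (simp add: converges_in_probability_def)
qed

lemma converges_in_probability_trans:
  assumes [measurable]: "\<And>n. X n \<in> borel_measurable M" "\<And>n. Y n \<in> borel_measurable M" "Z \<in> borel_measurable M"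
    and XY: "\<And>\<epsilon>. 0 < \<epsilon> \<Longrightarrow> (\<lambda>n. prob {\<omega>\<in>space M. \<epsilon> < \<bar>X n \<omega> - Y n \<omega>\<bar>}) \<longlonglongrightarrow> 0"
    and YZ: "converges_in_probability M Y Z"
  shows "converges_in_probability M X Z"
  unfolding converges_in_probability_def
proof (intro allI impI)
  fix \<epsilon> :: real assume \<epsilon>: "0 < \<epsilon>"
  have "0 < \<epsilon> / 2" using \<epsilon> by simp
  then have "(\<lambda>n. prob {\<omega>\<in>space M. \<epsilon> / 2 < \<bar>X n \<omega> - Y n \<omega>\<bar>} + prob {\<omega>\<in>space M. \<epsilon> / 2 < \<bar>Y n \<omega> - Z \<omega>\<bar>}) \<longlonglongrightarrow> 0 + 0"
    using YZ unfolding converges_in_probability_def by (intro tendsto_add XY) blast+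
  then show "(\<lambda>n. prob {\<omega>\<in>space M. \<epsilon> < \<bar>X n \<omega> - Z \<omega>\<bar>}) \<longlonglongrightarrow> 0"
    unfolding add_0
  proof (rule tendsto_sandwich[OF _ _ tendsto_const, rotated 2])
    show "\<forall>\<^sub>F n in sequentially. prob {\<omega>\<in>space M. \<epsilon> < \<bar>X n \<omega> - Z \<omega>\<bar>} \<le>
      prob {\<omega>\<in>space M. \<epsilon> / 2 < \<bar>X n \<omega> - Y n \<omega>\<bar>} + prob {\<omega>\<in>space M. \<epsilon> / 2 < \<bar>Y n \<omega> - Z \<omega>\<bar>}"
      by (intro always_eventually allI prob_abs_triangle assms)
    show "\<forall>\<^sub>F n in sequentially. 0 \<le> prob {\<omega>\<in>space M. \<epsilon> < \<bar>X n \<omega> - Z \<omega>\<bar>}" by simp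
  qed
qed

end

context wiener
begin

lemma L2_D:
  assumes "b \<in> L2_processes M F"
  shows "jointly_measurable M b" "adapted F b" "\<And>t. 0 \<le> t \<Longrightarrow> AE \<omega> in M. quad b t \<omega> < \<infinity>"
  using assms by (auto simp: L2_processes_def quad_def)

text \<open>Truncation at level k converges path by path, since the error is dominated by b^2. A
  bounded truncation is then approximated in mean, which Markov's inequality turns into
  probability.\<close>

lemma approximation:
  assumes b: "b \<in> L2_processes M F" and T: "0 < T" and \<epsilon>: "0 < \<epsilon>"
  obtains c n \<tau> where "step_representation M c n \<tau>" "\<tau> n \<le> T" "simple_process M F c" "c \<in> H2_processes M F"
    "prob {\<omega>\<in>space M. ennreal \<epsilon> < quad (\<lambda>s \<omega>. b s \<omega> - c s \<omega>) T \<omega>} < \<epsilon>"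
proof -
  note jm = L2_D(1)[OF b]
  define clip where "clip k s \<omega> = max (- real k) (min (real k) (b s \<omega>))" for k :: nat and s \<omega>
  have jm_clip: "jointly_measurable M (clip k)" for k
    using jm unfolding jointly_measurable_def clip_def case_prod_beta' by measurable
  have ad_clip: "adapted F (clip k)" for k
  proof -
    have "clip k t \<in> borel_measurable (F t)" if "0 \<le> t" for t
    proof -
      have [measurable]: "b t \<in> borel_measurable (F t)" using L2_D(2)[OF b] that by (simp add: adapted_def)
      show ?thesis unfolding clip_def by measurable
    qed
    then show ?thesis by (simp add: adapted_def)
  qed
  have clim: "AE \<omega> in M. (\<lambda>k. quad (\<lambda>s \<omega>. b s \<omega> - clip k s \<omega>) T \<omega>) \<longlonglongrightarrow> 0"
    using L2_D(3)[OF b less_imp_le[OF T]] AE_space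
  proof eventually_elim
    case (elim \<omega>)
    let ?b = "\<lambda>s. b (max 0 s) \<omega>" and ?c = "\<lambda>k s. clip k (max 0 s) \<omega>"
    have [measurable]: "?b \<in> borel_measurable borel" "?c k \<in> borel_measurable borel" for k
      using path_measurable[OF jm elim(2)] path_measurable[OF jm_clip elim(2)] by auto
    have "(\<lambda>k. \<integral>\<^sup>+s. ennreal ((?b s - ?c k s)\<^sup>2) * indicator {0..T} s \<partial>lborel) \<longlonglongrightarrow> integral\<^sup>N lborel (\<lambda>_::real. 0)"
    proof (rule nn_integral_dominated_convergence[where w = "\<lambda>s. ennreal ((?b s)\<^sup>2) * indicator {0..T} s"])
      show "AE s in lborel. ennreal ((?b s - ?c k s)\<^sup>2) * indicator {0..T} s \<le> ennreal ((?b s)\<^sup>2) * indicator {0..T} s" for k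
      proof (intro AE_I2 mult_right_mono ennreal_leI)
        fix s
        have "\<bar>?b s - ?c k s\<bar> \<le> \<bar>?b s\<bar>" unfolding clip_def by (rule clip_bounds) simp
        then show "(?b s - ?c k s)\<^sup>2 \<le> (?b s)\<^sup>2" by (simp add: abs_le_square_iff)
      qed simp
      show "(\<integral>\<^sup>+s. ennreal ((?b s)\<^sup>2) * indicator {0..T} s \<partial>lborel) < \<infinity>"
        using elim(1) unfolding quad_extend .
      show "AE s in lborel. (\<lambda>k. ennreal ((?b s - ?c k s)\<^sup>2) * indicator {0..T} s) \<longlonglongrightarrow> 0"
      proof (rule AE_I2)
        fix s
        have "\<forall>\<^sub>F k in sequentially. \<bar>?b s\<bar> \<le> real k" by (rule eventually_le_real)
        then have "\<forall>\<^sub>F k in sequentially. ennreal ((?b s - ?c k s)\<^sup>2) * indicator {0..T} s = 0"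
        proof eventually_elim
          case (elim k)
          then have "?c k s = ?b s" unfolding clip_def by (intro clip_bounds(3)) simp_all
          then show ?case by simp
        qed
        then show "(\<lambda>k. ennreal ((?b s - ?c k s)\<^sup>2) * indicator {0..T} s) \<longlonglongrightarrow> 0" by (rule tendsto_eventually)
      qed
    qed simp_all
    then show ?case unfolding quad_extend by simp
  qed
  have qm: "(\<lambda>\<omega>. quad (\<lambda>s \<omega>. b s \<omega> - clip k s \<omega>) T \<omega>) \<in> borel_measurable M" for k
    by (rule quad_measurable jointly_measurable_diff jm jm_clip)+
  have "(\<lambda>k. prob {\<omega>\<in>space M. ennreal (\<epsilon> / 4) < quad (\<lambda>s \<omega>. b s \<omega> - clip k s \<omega>) T \<omega>}) \<longlonglongrightarrow> 0"
    by (rule tendsto_AE_imp_tendsto_prob[OF qm clim]) (use \<epsilon> in simp)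
  then have "\<forall>\<^sub>F k in sequentially. prob {\<omega>\<in>space M. ennreal (\<epsilon> / 4) < quad (\<lambda>s \<omega>. b s \<omega> - clip k s \<omega>) T \<omega>} < \<epsilon> / 2"
    by (rule order_tendstoD(2)) (use \<epsilon> in simp)
  then obtain k where k: "prob {\<omega>\<in>space M. ennreal (\<epsilon> / 4) < quad (\<lambda>s \<omega>. b s \<omega> - clip k s \<omega>) T \<omega>} < \<epsilon> / 2"
    using eventually_happens'[OF sequentially_bot] by blast
  have kbd: "\<bar>clip k s \<omega>\<bar> \<le> real k" for s \<omega> unfolding clip_def by (rule clip_bounds) simp
  \<comment> \<open>Markov's inequality at level \<epsilon>/4 turns this bound on the mean into
    probability less than \<epsilon>/2.\<close>
  have "0 < \<epsilon> * \<epsilon> / 8" using \<epsilon> by simp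
  then obtain c n \<tau> where c: "step_representation M c n \<tau>" "\<tau> n \<le> T" "simple_process M F c" "c \<in> H2_processes M F"
    and cE: "(\<integral>\<^sup>+\<omega>. quad (\<lambda>s \<omega>. clip k s \<omega> - c s \<omega>) T \<omega> \<partial>M) < ennreal (\<epsilon> * \<epsilon> / 8)"
    by (rule approximation_bounded[OF jm_clip ad_clip kbd T])
  have jm_c: "jointly_measurable M c" using c(4) by (simp add: H2_processes_def)
  let ?q = "\<lambda>\<omega>. quad (\<lambda>s \<omega>. clip k s \<omega> - c s \<omega>) T \<omega>"
  have [measurable]: "?q \<in> borel_measurable M"
    by (rule quad_measurable jointly_measurable_diff jm_c jm_clip)+
  have ev: "{\<omega>\<in>space M. ennreal (\<epsilon> / 4) < ?q \<omega>} \<in> events" by measurable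
  have "ennreal (\<epsilon> / 4) * ennreal (prob {\<omega>\<in>space M. ennreal (\<epsilon> / 4) < ?q \<omega>}) =
    (\<integral>\<^sup>+\<omega>. ennreal (\<epsilon> / 4) * indicator {\<omega>\<in>space M. ennreal (\<epsilon> / 4) < ?q \<omega>} \<omega> \<partial>M)"
    unfolding nn_integral_cmult_indicator[OF ev] emeasure_eq_measure ..
  also have "\<dots> \<le> (\<integral>\<^sup>+\<omega>. ?q \<omega> \<partial>M)"
    by (intro nn_integral_mono) (simp add: indicator_def less_imp_le)
  also note cE
  finally have "ennreal (\<epsilon> / 4) * ennreal (prob {\<omega>\<in>space M. ennreal (\<epsilon> / 4) < ?q \<omega>}) < ennreal (\<epsilon> * \<epsilon> / 8)" .
  then have "ennreal (\<epsilon> / 4 * prob {\<omega>\<in>space M. ennreal (\<epsilon> / 4) < ?q \<omega>}) < ennreal (\<epsilon> * \<epsilon> / 8)"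
    by (subst ennreal_mult'') (rule measure_nonneg)
  then have "\<epsilon> / 4 * prob {\<omega>\<in>space M. ennreal (\<epsilon> / 4) < ?q \<omega>} < \<epsilon> * \<epsilon> / 8"
  proof (rule ennreal_less_iff[THEN iffD1, rotated])
    show "0 \<le> \<epsilon> / 4 * prob {\<omega>\<in>space M. ennreal (\<epsilon> / 4) < ?q \<omega>}"
      by (rule mult_nonneg_nonneg[OF _ measure_nonneg]) (use \<epsilon> in simp)
  qed
  also have "\<dots> = \<epsilon> / 4 * (\<epsilon> / 2)" by simp
  finally have "prob {\<omega>\<in>space M. ennreal (\<epsilon> / 4) < ?q \<omega>} < \<epsilon> / 2"
    by (rule mult_left_less_imp_less) (use \<epsilon> in simp)
  moreover have "prob {\<omega>\<in>space M. ennreal (4 * (\<epsilon> / 4)) < quad (\<lambda>s \<omega>. b s \<omega> - c s \<omega>) T \<omega>} \<le>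
      prob {\<omega>\<in>space M. ennreal (\<epsilon> / 4) < quad (\<lambda>s \<omega>. clip k s \<omega> - b s \<omega>) T \<omega>} +
      prob {\<omega>\<in>space M. ennreal (\<epsilon> / 4) < quad (\<lambda>s \<omega>. clip k s \<omega> - c s \<omega>) T \<omega>}"
    by (rule quad_prob_diff_le[OF jm_clip jm jm_c]) (use \<epsilon> in simp)
  moreover have "4 * (\<epsilon> / 4) = \<epsilon>" by simp
  ultimately have "prob {\<omega>\<in>space M. ennreal \<epsilon> < quad (\<lambda>s \<omega>. b s \<omega> - c s \<omega>) T \<omega>} < \<epsilon>"
    using k by (simp only: quad_commute[of "clip k" b])
  then show thesis by (rule that[OF c])
qed

section \<open>The stochastic integral\<close>

lemma elementary_integral_M:
  assumes "simple_process M F b" "0 \<le> t" shows "elementary_integral W b t \<in> borel_measurable M"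
proof -
  obtain n \<tau> where "simple_rep M F b n \<tau>" by (rule simple_rep_exists[OF assms(1)])
  from measurable_F_M[OF assms(2) elementary_integral_adapted[OF this assms(2)]] show ?thesis .
qed

text \<open>Two approximating sequences have a difference that is simple with small quadratic
  integral, so the maximal inequality at the single time t applies. This makes the limit independent
  of the sequence.\<close>

lemma elementary_integral_close:
  assumes b: "jointly_measurable M b"
    and B: "\<And>n. simple_process M F (B n)" "\<And>n. jointly_measurable M (B n)" "quad_tendsto M b B t"
    and C: "\<And>n. simple_process M F (C n)" "\<And>n. jointly_measurable M (C n)" "quad_tendsto M b C t"
    and t: "0 \<le> t" and \<epsilon>: "0 < \<epsilon>"
  shows "(\<lambda>n. prob {\<omega>\<in>space M. \<epsilon> < \<bar>elementary_integral W (B n) t \<omega> - elementary_integral W (C n) t \<omega>\<bar>}) \<longlonglongrightarrow> 0"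
proof (rule order_tendstoI)
  fix e :: real assume e: "0 < e"
  \<comment> \<open>The level in the maximal inequality is 4 \<delta>, so its second term 4 *
    \<delta> / \<epsilon>^2 equals e/2.\<close>
  define \<delta> where "\<delta> = e * \<epsilon>\<^sup>2 / 8"
  have \<delta>: "0 < \<delta>" using e \<epsilon> by (simp add: \<delta>_def)
  let ?p = "\<lambda>B n. prob {\<omega>\<in>space M. ennreal \<delta> < quad (\<lambda>s \<omega>. b s \<omega> - B n s \<omega>) t \<omega>}"
  have "(\<lambda>n. ?p B n + ?p C n) \<longlonglongrightarrow> 0 + 0"
    using B(3) C(3) \<delta> unfolding quad_tendsto_def by (intro tendsto_add) auto
  then have "\<forall>\<^sub>F n in sequentially. ?p B n + ?p C n < e / 2"
    by (rule order_tendstoD(2)) (use e in simp)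
  then show "\<forall>\<^sub>F n in sequentially.
    prob {\<omega>\<in>space M. \<epsilon> < \<bar>elementary_integral W (B n) t \<omega> - elementary_integral W (C n) t \<omega>\<bar>} < e"
  proof eventually_elim
    case (elim n)
    obtain N x where Bn: "simple_rep M F (B n) N x" by (rule simple_rep_exists[OF B(1)])
    obtain N' x' where Cn: "simple_rep M F (C n) N' x'" by (rule simple_rep_exists[OF C(1)])
    obtain N'' x'' where D: "simple_rep M F (\<lambda>s \<omega>. B n s \<omega> - C n s \<omega>) N'' x''"
      by (rule simple_rep_diff[OF Bn Cn])
    have "{\<omega>\<in>space M. \<epsilon> < \<bar>elementary_integral W (B n) t \<omega> - elementary_integral W (C n) t \<omega>\<bar>} =
      {\<omega>\<in>space M. \<exists>q\<in>{t}. \<epsilon> < \<bar>elementary_integral W (\<lambda>s \<omega>. B n s \<omega> - C n s \<omega>) q \<omega>\<bar>}"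
      using elementary_integral_diff[OF Bn Cn _ t] by auto
    then have "prob {\<omega>\<in>space M. \<epsilon> < \<bar>elementary_integral W (B n) t \<omega> - elementary_integral W (C n) t \<omega>\<bar>} \<le>
      prob {\<omega>\<in>space M. ennreal (4 * \<delta>) < quad (\<lambda>s \<omega>. B n s \<omega> - C n s \<omega>) t \<omega>} + 4 * \<delta> / \<epsilon>\<^sup>2"
      using elementary_integral_maximal_finite[OF D t, of "{t}" \<epsilon> "4 * \<delta>"] t \<epsilon> \<delta> by simp
    also have "\<dots> \<le> (?p B n + ?p C n) + 4 * \<delta> / \<epsilon>\<^sup>2"
      using quad_prob_diff_le[OF b B(2) C(2), of \<delta> n n t] \<delta> by simp
    also have "4 * \<delta> / \<epsilon>\<^sup>2 = e / 2" using \<epsilon> by (simp add: \<delta>_def)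
    finally show ?case using elim by linarith
  qed
qed (simp add: order.strict_trans2[OF _ measure_nonneg])

text \<open>The approximants are not confined to \<open>H2_processes M F\<close>, so that a simple b
  in \<open>L2_processes M F\<close> can be its own approximation.\<close>

definition limit_of_elementary :: "'a process \<Rightarrow> 'a process \<Rightarrow> bool" where
  "limit_of_elementary b X \<longleftrightarrow> X \<in> continuous_adapted_processes M F \<and>
    (\<forall>t B. 0 \<le> t \<and> (\<forall>n. simple_process M F (B n) \<and> jointly_measurable M (B n)) \<and> quad_tendsto M b B t \<longrightarrow>
       converges_in_probability M (\<lambda>n. elementary_integral W (B n) t) (X t))"

text \<open>Approximants are chosen so fast that the maximal inequality and Borel-Cantelli give
  uniform convergence on every compact interval almost surely.\<close>

lemma limit_of_elementary_exists:
  assumes b: "b \<in> L2_processes M F"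
  shows "\<exists>X. limit_of_elementary b X"
proof -
  note jm = L2_D(1)[OF b]
  \<comment> \<open>The horizon n + 1 grows so that every [0,T] is eventually covered. The rate 8^-n
    suits increments of size 2^-n: the maximal inequality divides it by 4^-n, leaving the summable
    2^-n.\<close>
  define Q where "Q c n = prob {\<omega>\<in>space M. ennreal ((1/8) ^ n) < quad (\<lambda>s \<omega>. b s \<omega> - c s \<omega>) (real (Suc n)) \<omega>}" for c n
  have "\<exists>c. simple_process M F c \<and> jointly_measurable M c \<and> Q c n < (1/8) ^ n" for n
  proof -
    have "(0::real) < real (Suc n)" "(0::real) < (1/8) ^ n" by simp_all
    then show ?thesis
      by (rule approximation[OF b]) (auto simp: Q_def H2_processes_def)
  qed
  then obtain B where B: "\<And>n. simple_process M F (B n)" "\<And>n. jointly_measurable M (B n)" "\<And>n. Q (B n) n < (1/8) ^ n"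
    by metis
  have "\<exists>N x. simple_rep M F (B n) N x" for n using simple_rep_exists[OF B(1)] by metis
  then obtain N x where R: "\<And>n. simple_rep M F (B n) (N n) (x n)" by metis
  let ?E = "\<lambda>n t \<omega>. elementary_integral W (B n) t \<omega>"
  define D where "D n s \<omega> = B (Suc n) s \<omega> - B n s \<omega>" for n s \<omega>
  have "\<exists>N x. simple_rep M F (D n) N x" for n
    unfolding D_def using simple_rep_diff[OF R R] by metis
  then obtain N' x' where RD: "\<And>n. simple_rep M F (D n) (N' n) (x' n)" by metis
  have ED: "elementary_integral W (D n) t \<omega> = ?E (Suc n) t \<omega> - ?E n t \<omega>" if "\<omega> \<in> space M" "0 \<le> t" for n t \<omega>
    unfolding D_def by (rule elementary_integral_diff[OF R R that])
  define bad where "bad n = {\<omega>\<in>space M. \<exists>q\<in>{0..real (Suc n)}. (1/2) ^ n < \<bar>elementary_integral W (D n) q \<omega>\<bar>}" for n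
  have [measurable]: "bad n \<in> events" for n
    unfolding bad_def by (rule elementary_integral_maximal(1)[OF RD _ _ order_refl]) simp_all
  have pos8: "(0::real) \<le> (1/8) ^ n" "(0::real) < (1/2) ^ n" for n by simp_all
  have qm[measurable]: "(\<lambda>\<omega>. quad (\<lambda>s \<omega>. b s \<omega> - B n s \<omega>) T \<omega>) \<in> borel_measurable M" for n T
    by (rule quad_measurable jointly_measurable_diff jm B)+
  \<comment> \<open>The constant 6 consists of 4 from the second term of the maximal inequality and
    1 for each of the two approximation errors.\<close>
  have pbad: "prob (bad n) \<le> 6 * (1/2) ^ n" for n
  proof -
    have "prob (bad n) \<le> prob {\<omega>\<in>space M. ennreal (4 * (1/8) ^ n) < quad (D n) (real (Suc n)) \<omega>} + 4 * (1/8) ^ n / ((1/2) ^ n)\<^sup>2"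
      unfolding bad_def by (rule elementary_integral_maximal(2)[OF RD]) simp_all
    also have "4 * (1/8) ^ n / ((1/2) ^ n)\<^sup>2 = 4 * (1/2 :: real) ^ n"
    proof -
      have "(1/8 :: real) ^ n = (1/2) ^ n * ((1/2) ^ n)\<^sup>2"
        unfolding power2_eq_square power_mult_distrib[symmetric] by simp
      then show ?thesis by simp
    qed
    also have "prob {\<omega>\<in>space M. ennreal (4 * (1/8) ^ n) < quad (D n) (real (Suc n)) \<omega>} \<le>
      prob {\<omega>\<in>space M. ennreal ((1/8) ^ n) < quad (\<lambda>s \<omega>. b s \<omega> - B (Suc n) s \<omega>) (real (Suc n)) \<omega>} + Q (B n) n"
      unfolding D_def Q_def by (rule quad_prob_diff_le[OF jm B(2) B(2) pos8(1)])
    \<comment> \<open>Passing to the parameters of index \<open>Suc n\<close> lowers the level and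
      lengthens the horizon, so the event only grows.\<close>
    also have "prob {\<omega>\<in>space M. ennreal ((1/8) ^ n) < quad (\<lambda>s \<omega>. b s \<omega> - B (Suc n) s \<omega>) (real (Suc n)) \<omega>} \<le> Q (B (Suc n)) (Suc n)"
      unfolding Q_def
    proof (rule finite_measure_mono; safe?)
      fix \<omega> assume "ennreal ((1/8) ^ n) < quad (\<lambda>s \<omega>. b s \<omega> - B (Suc n) s \<omega>) (real (Suc n)) \<omega>"
      moreover have "ennreal ((1/8) ^ Suc n) \<le> ennreal ((1/8) ^ n)" by (intro ennreal_leI power_decreasing) simp_all
      moreover have "quad (\<lambda>s \<omega>. b s \<omega> - B (Suc n) s \<omega>) (real (Suc n)) \<omega> \<le> quad (\<lambda>s \<omega>. b s \<omega> - B (Suc n) s \<omega>) (real (Suc (Suc n))) \<omega>"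
        by (rule quad_mono) simp
      ultimately show "ennreal ((1/8) ^ Suc n) < quad (\<lambda>s \<omega>. b s \<omega> - B (Suc n) s \<omega>) (real (Suc (Suc n))) \<omega>"
        by (meson order.strict_trans1 order.strict_trans2)
    qed measurable
    also have "Q (B (Suc n)) (Suc n) + Q (B n) n + 4 * (1/2) ^ n \<le> (1/8) ^ Suc n + (1/8) ^ n + 4 * (1/2) ^ n"
      using B(3)[of n] B(3)[of "Suc n"] by simp
    also have "\<dots> \<le> (1/2) ^ n + (1/2) ^ n + 4 * (1/2) ^ n"
    proof -
      have "(1/8) ^ n \<le> (1/2 :: real) ^ n" by (rule power_mono) simp_all
      moreover have "(1/8) ^ Suc n \<le> (1/8 :: real) ^ n" by (intro power_decreasing) simp_all
      ultimately show ?thesis by linarith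
    qed
    finally show ?thesis by simp
  qed
  have "summable (\<lambda>n. prob (bad n))"
  proof (rule summable_comparison_test')
    show "summable (\<lambda>n. 6 * (1/2 :: real) ^ n)" by (intro summable_mult summable_geometric) simp
    show "norm (prob (bad n)) \<le> 6 * (1/2) ^ n" if "0 \<le> n" for n using pbad by simp
  qed
  then have BC: "AE \<omega> in M. \<forall>\<^sub>F n in sequentially. \<omega> \<in> space M - bad n"
    by (intro borel_cantelli_AE1) (auto simp: emeasure_eq_measure)
  define good where "good = {\<omega>\<in>space M. \<forall>\<^sub>F n in sequentially. \<omega> \<in> space M - bad n}"
  have good_M: "good \<in> events"
    unfolding good_def eventually_sequentially by measurable
  have AE_good: "AE \<omega> in M. \<omega> \<in> good"
    using BC AE_space by eventually_elim (simp add: good_def)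
  have null: "space M - good \<in> null_sets M"
    using AE_good good_M by (subst AE_iff_null_sets) auto
  \<comment> \<open>Augmentation enters here: the complement of \<open>good\<close> is a null set
    and hence belongs to every \<open>F t\<close>.\<close>
  have good_F: "good \<in> sets (F t)" if "0 \<le> t" for t
  proof -
    have "space M - good \<in> sets (F t)" using null augmented that by (auto simp: augmented_filtration_def)
    then have "space (F t) - (space M - good) \<in> sets (F t)" by (rule sets.compl_sets)
    moreover have "space (F t) - (space M - good) = good" using space_F[OF that] by (auto simp: good_def)
    ultimately show ?thesis by simp
  qed
  \<comment> \<open>The series telescopes, its partial sums being \<open>?E n\<close>. The value 0
    off \<open>good\<close> makes every path continuous, as \<open>continuous_process\<close>
    demands of all \<omega> in the space.\<close>
  define X where "X t \<omega> = (if \<omega> \<in> good then ?E 0 t \<omega> + (\<Sum>i. elementary_integral W (D i) t \<omega>) else 0)" for t \<omega>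
  have unif: "uniform_limit {0..T} (\<lambda>n t. ?E n t \<omega>) (\<lambda>t. X t \<omega>) sequentially" if \<omega>: "\<omega> \<in> good" for \<omega> T
  proof -
    have \<omega>M: "\<omega> \<in> space M" using \<omega> by (simp add: good_def)
    have ev: "\<forall>\<^sub>F n in sequentially. \<omega> \<in> space M - bad n" using \<omega> unfolding good_def by blast
    have "\<forall>\<^sub>F n in sequentially. T \<le> real n" by (rule eventually_le_real)
    with ev have "\<forall>\<^sub>F n in sequentially. \<forall>t\<in>{0..T}. norm (elementary_integral W (D n) t \<omega>) \<le> (1/2) ^ n"
    proof eventually_elim
      case (elim n)
      show ?case
      proof
        fix t assume "t \<in> {0..T}"
        then have "t \<in> {0..real (Suc n)}" using elim(2) by simp
        then show "norm (elementary_integral W (D n) t \<omega>) \<le> (1/2) ^ n"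
          using elim(1) unfolding bad_def by (auto simp: not_less)
      qed
    qed
    then have "uniform_limit {0..T} (\<lambda>n t. \<Sum>i<n. elementary_integral W (D i) t \<omega>)
        (\<lambda>t. \<Sum>i. elementary_integral W (D i) t \<omega>) sequentially"
      by (rule Weierstrass_m_test_ev) (intro summable_geometric, simp)
    then have "uniform_limit {0..T} (\<lambda>n t. ?E 0 t \<omega> + (\<Sum>i<n. elementary_integral W (D i) t \<omega>))
        (\<lambda>t. ?E 0 t \<omega> + (\<Sum>i. elementary_integral W (D i) t \<omega>)) sequentially"
      by (intro uniform_limit_add uniform_limit_const)
    then show ?thesis
    proof (rule uniform_limit_cong'[THEN iffD1, rotated 2])
      show "?E 0 t \<omega> + (\<Sum>i<n. elementary_integral W (D i) t \<omega>) = ?E n t \<omega>" if "t \<in> {0..T}" for n t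
        using that ED[OF \<omega>M] sum_lessThan_telescope[of "\<lambda>n. ?E n t \<omega>" n] by simp
      show "?E 0 t \<omega> + (\<Sum>i. elementary_integral W (D i) t \<omega>) = X t \<omega>" if "t \<in> {0..T}" for t
        using \<omega> by (simp add: X_def)
    qed
  qed
  have lim: "(\<lambda>n. ?E n t \<omega>) \<longlonglongrightarrow> X t \<omega>" if "\<omega> \<in> good" "0 \<le> t" for t \<omega>
    by (rule tendsto_uniform_limitI[OF unif[OF that(1), of t]]) (use that in simp)
  have cont: "continuous_on {0..} (\<lambda>t. X t \<omega>)" if "\<omega> \<in> space M" for \<omega>
  proof (cases "\<omega> \<in> good")
    case True
    have cT: "continuous_on {0..T} (\<lambda>t. X t \<omega>)" for T
    proof (rule uniform_limit_theorem[OF _ unif[OF True]])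
      show "\<forall>\<^sub>F n in sequentially. continuous_on {0..T} (\<lambda>t. ?E n t \<omega>)"
        by (intro always_eventually allI continuous_on_subset[OF elementary_integral_continuous[OF R that]]) auto
    qed simp
    show ?thesis
      unfolding continuous_on_eq_continuous_within
    proof
      fix t :: real assume t: "t \<in> {0..}"
      have "at t within {0..} = at t within {0..t + 1}"
        by (rule at_within_nhd[of t "{..<t + 1}"]) auto
      moreover have "continuous (at t within {0..t + 1}) (\<lambda>t. X t \<omega>)"
        using cT[of "t + 1"] t unfolding continuous_on_eq_continuous_within by auto
      ultimately show "continuous (at t within {0..}) (\<lambda>t. X t \<omega>)" by simp
    qed
  qed (simp add: X_def)
  have XF: "X t \<in> borel_measurable (F t)" if t: "0 \<le> t" for t
  proof (rule borel_measurable_LIMSEQ_real)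
    \<comment> \<open>Cutting the approximants off outside \<open>good\<close> turns almost sure
      convergence into convergence everywhere, so measurability with respect to \<open>F t\<close>
      is inherited.\<close>
    show "(\<lambda>n. if \<omega> \<in> good then ?E n t \<omega> else 0) \<longlonglongrightarrow> X t \<omega>" if "\<omega> \<in> space (F t)" for \<omega>
      using lim[OF _ t, of \<omega>] by (cases "\<omega> \<in> good") (simp_all add: X_def)
    show "(\<lambda>\<omega>. if \<omega> \<in> good then ?E n t \<omega> else 0) \<in> borel_measurable (F t)" for n
      by (rule measurable_If_set[OF elementary_integral_adapted[OF R t]])
         (use good_F[OF t] in \<open>simp_all add: sets.Int_space_eq2\<close>)
  qed
  have Bt: "quad_tendsto M b B t" if t: "0 \<le> t" for t
    unfolding quad_tendsto_def
  proof (intro allI impI)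
    fix \<epsilon> :: real assume \<epsilon>: "0 < \<epsilon>"
    have p0: "(\<lambda>n. (1/8 :: real) ^ n) \<longlonglongrightarrow> 0" by (rule LIMSEQ_power_zero) simp
    have "\<forall>\<^sub>F n in sequentially. (1/8) ^ n < \<epsilon>" by (rule order_tendstoD(2)[OF p0 \<epsilon>])
    moreover have "\<forall>\<^sub>F n in sequentially. t \<le> real n" by (rule eventually_le_real)
    ultimately have ev: "\<forall>\<^sub>F n in sequentially.
      prob {\<omega>\<in>space M. ennreal \<epsilon> < quad (\<lambda>s \<omega>. b s \<omega> - B n s \<omega>) t \<omega>} \<le> (1/8) ^ n"
    proof eventually_elim
      case (elim n)
      have "prob {\<omega>\<in>space M. ennreal \<epsilon> < quad (\<lambda>s \<omega>. b s \<omega> - B n s \<omega>) t \<omega>} \<le> Q (B n) n"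
        unfolding Q_def
      proof (rule finite_measure_mono; safe?)
        fix \<omega> assume "ennreal \<epsilon> < quad (\<lambda>s \<omega>. b s \<omega> - B n s \<omega>) t \<omega>"
        moreover have "ennreal ((1/8) ^ n) \<le> ennreal \<epsilon>" using elim(1) by (intro ennreal_leI) simp
        moreover have "quad (\<lambda>s \<omega>. b s \<omega> - B n s \<omega>) t \<omega> \<le> quad (\<lambda>s \<omega>. b s \<omega> - B n s \<omega>) (real (Suc n)) \<omega>"
          by (rule quad_mono) (use elim(2) in simp)
        ultimately show "ennreal ((1/8) ^ n) < quad (\<lambda>s \<omega>. b s \<omega> - B n s \<omega>) (real (Suc n)) \<omega>"
          by (meson order.strict_trans1 order.strict_trans2)
      qed measurable
      then show ?case using B(3)[of n] by simp
    qed
    show "(\<lambda>n. prob {\<omega>\<in>space M. ennreal \<epsilon> < quad (\<lambda>s \<omega>. b s \<omega> - B n s \<omega>) t \<omega>}) \<longlonglongrightarrow> 0"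
      by (rule tendsto_sandwich[OF _ ev tendsto_const p0]) simp
  qed
  \<comment> \<open>An arbitrary approximating sequence C stays close in probability to the
    particular B, whose integrals converge almost surely.\<close>
  have "converges_in_probability M (\<lambda>n. elementary_integral W (C n) t) (X t)"
    if t: "0 \<le> t" and C: "\<And>n. simple_process M F (C n)" "\<And>n. jointly_measurable M (C n)" "quad_tendsto M b C t" for t C
  proof (rule converges_in_probability_trans)
    show "converges_in_probability M (\<lambda>n. ?E n t) (X t)"
      by (rule converges_in_probability_AE[OF elementary_integral_M[OF B(1) t] measurable_F_M[OF t XF[OF t]]])
         (use AE_good in \<open>eventually_elim, auto intro: lim t\<close>)
    show "(\<lambda>n. prob {\<omega>\<in>space M. \<epsilon> < \<bar>elementary_integral W (C n) t \<omega> - ?E n t \<omega>\<bar>}) \<longlonglongrightarrow> 0" if "0 < \<epsilon>" for \<epsilon>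
      by (rule elementary_integral_close[OF jm C B(1,2) Bt[OF t] t that])
  qed (use elementary_integral_M[OF C(1) t] elementary_integral_M[OF B(1) t] measurable_F_M[OF t XF[OF t]] in auto)
  then have "limit_of_elementary b X"
    unfolding limit_of_elementary_def continuous_adapted_processes_def adapted_def continuous_process_def
    using XF cont by blast
  then show ?thesis by blast
qed

section \<open>The two properties of the mapping\<close>

lemma limit_of_elementary_M:
  assumes "limit_of_elementary b X" "0 \<le> t" shows "X t \<in> borel_measurable M"
proof -
  have "adapted F X" using assms(1) by (simp add: limit_of_elementary_def continuous_adapted_processes_def)
  then have "X t \<in> borel_measurable (F t)" using assms(2) by (simp add: adapted_def)
  then show ?thesis by (rule measurable_F_M[OF assms(2)])
qed

lemma limit_of_elementaryD:
  assumes "limit_of_elementary b X" "0 \<le> t" "\<And>n. simple_process M F (B n)" "\<And>n. jointly_measurable M (B n)"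
    "quad_tendsto M b B t"
  shows "converges_in_probability M (\<lambda>n. elementary_integral W (B n) t) (X t)"
  using assms(1)[unfolded limit_of_elementary_def, THEN conjunct2, rule_format, of t B] assms(2-5) by blast

text \<open>The constant sequence b approximates b with error 0, and limits in probability are
  almost surely unique.\<close>

lemma limit_of_elementary_simple:
  assumes X: "limit_of_elementary b X" and b: "simple_process M F b" "jointly_measurable M b" and t: "0 \<le> t"
  shows "AE \<omega> in M. X t \<omega> = elementary_integral W b t \<omega>"
proof -
  have "quad_tendsto M b (\<lambda>_. b) t" by (simp add: quad_tendsto_def quad_def)
  then have "converges_in_probability M (\<lambda>n. elementary_integral W b t) (X t)"
    by (rule limit_of_elementaryD[OF X t b])
  moreover have "converges_in_probability M (\<lambda>n::nat. elementary_integral W b t) (elementary_integral W b t)"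
    by (simp add: converges_in_probability_def)
  ultimately show ?thesis
    by (rule converges_in_probability_unique[OF elementary_integral_M[OF b(1) t]
          limit_of_elementary_M[OF X t] elementary_integral_M[OF b(1) t]])
qed

text \<open>The Bochner integral is \<open>enn2real\<close> of the quadratic error, hence 0 where
  the latter is infinite. For processes in \<open>L2_processes M F\<close> this happens only on a
  null set, so the probabilities agree.\<close>

lemma quad_tendsto_iff:
  assumes b: "b \<in> L2_processes M F" and B: "\<And>n. B n \<in> L2_processes M F" and t: "0 \<le> t"
  shows "converges_in_probability M (\<lambda>n \<omega>. \<integral>s\<in>{0..t}. (b s \<omega> - B n s \<omega>)\<^sup>2 \<partial>lborel) (\<lambda>\<omega>. 0) \<longleftrightarrow> quad_tendsto M b B t"
proof -
  let ?q = "\<lambda>n \<omega>. quad (\<lambda>s \<omega>. b s \<omega> - B n s \<omega>) t \<omega>"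
  note jm = L2_D(1)[OF b] L2_D(1)[OF B]
  have qm[measurable]: "?q n \<in> borel_measurable M" for n
    by (rule quad_measurable jointly_measurable_diff jm)+
  have int: "(\<integral>s\<in>{0..t}. (b s \<omega> - B n s \<omega>)\<^sup>2 \<partial>lborel) = enn2real (?q n \<omega>)" if \<omega>: "\<omega> \<in> space M" for n \<omega>
  proof -
    let ?d = "\<lambda>s. b (max 0 s) \<omega> - B n (max 0 s) \<omega>"
    have [measurable]: "?d \<in> borel_measurable borel"
      using path_measurable[OF jointly_measurable_diff[OF jm] \<omega>] .
    have "(\<integral>s\<in>{0..t}. (b s \<omega> - B n s \<omega>)\<^sup>2 \<partial>lborel) = (\<integral>s. indicator {0..t} s * (?d s)\<^sup>2 \<partial>lborel)"
      unfolding set_lebesgue_integral_def by (intro Bochner_Integration.integral_cong) (auto simp: indicator_def)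
    also have "\<dots> = enn2real (\<integral>\<^sup>+s. ennreal (indicator {0..t} s * (?d s)\<^sup>2) \<partial>lborel)"
      by (rule integral_eq_nn_integral) auto
    also have "(\<integral>\<^sup>+s. ennreal (indicator {0..t} s * (?d s)\<^sup>2) \<partial>lborel) = ?q n \<omega>"
      unfolding quad_extend by (intro nn_integral_cong) (simp add: indicator_def)
    finally show ?thesis .
  qed
  have fin: "AE \<omega> in M. ?q n \<omega> < \<infinity>" for n
    using L2_D(3)[OF b t] L2_D(3)[OF B t, of n] AE_space
  proof eventually_elim
    case (elim \<omega>)
    \<comment> \<open>Finiteness of the error comes from \<open>quad_diff_le\<close> with the zero
      process in the middle.\<close>
    have "jointly_measurable M (\<lambda>_ _. 0)" by (simp add: jointly_measurable_def)
    from quad_diff_le[OF jm(1) this jm(2)[of n] elim(3), of t]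
    have "?q n \<omega> \<le> 2 * quad b t \<omega> + 2 * quad (B n) t \<omega>" unfolding quad_def diff_0_right diff_0 power2_minus .
    also have "\<dots> < \<infinity>" using elim by (simp add: ennreal_mult_less_top)
    finally show ?case .
  qed
  have "prob {\<omega>\<in>space M. \<epsilon> < \<bar>(\<integral>s\<in>{0..t}. (b s \<omega> - B n s \<omega>)\<^sup>2 \<partial>lborel) - 0\<bar>} = prob {\<omega>\<in>space M. ennreal \<epsilon> < ?q n \<omega>}"
    if \<epsilon>: "0 < \<epsilon>" for \<epsilon> n
  proof -
    have "{\<omega>\<in>space M. \<epsilon> < \<bar>(\<integral>s\<in>{0..t}. (b s \<omega> - B n s \<omega>)\<^sup>2 \<partial>lborel) - 0\<bar>} = {\<omega>\<in>space M. \<epsilon> < enn2real (?q n \<omega>)}"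
      using int by (intro Collect_cong conj_cong refl) simp
    moreover have "prob {\<omega>\<in>space M. \<epsilon> < enn2real (?q n \<omega>)} = prob {\<omega>\<in>space M. ennreal \<epsilon> < ?q n \<omega>}"
    proof (rule finite_measure_eq_AE)
      show "AE \<omega> in M. (\<omega> \<in> {\<omega>\<in>space M. \<epsilon> < enn2real (?q n \<omega>)}) = (\<omega> \<in> {\<omega>\<in>space M. ennreal \<epsilon> < ?q n \<omega>})"
        using fin[of n]
      proof eventually_elim
        case (elim \<omega>)
        then have "\<epsilon> < enn2real (?q n \<omega>) \<longleftrightarrow> ennreal \<epsilon> < ?q n \<omega>"
          using \<epsilon> by (cases "?q n \<omega>") (simp_all add: ennreal_less_iff)
        then show ?case by blast
      qed
    qed measurable
    ultimately show ?thesis by simp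
  qed
  then show ?thesis unfolding converges_in_probability_def quad_tendsto_def by simp
qed

lemma stochastic_integral_mapping_of_limits:
  assumes I: "\<And>b. b \<in> L2_processes M F \<Longrightarrow> limit_of_elementary b (I b)"
  shows "stochastic_integral_mapping M F W I"
  unfolding stochastic_integral_mapping_def
proof (intro conjI allI impI)
  show "I \<in> L2_processes M F \<rightarrow> continuous_adapted_processes M F"
    using I by (intro Pi_I) (simp add: limit_of_elementary_def)
next
  fix b t n \<tau>
  assume *: "b \<in> L2_processes M F \<and> simple_process M F b \<and> 0 \<le> t \<and> step_representation M b n \<tau> \<and> \<tau> n \<le> t"
  then have "AE \<omega> in M. I b t \<omega> = elementary_integral W b t \<omega>"
    by (intro limit_of_elementary_simple I L2_D(1)) (elim conjE, assumption)+
  then show "AE \<omega> in M. I b t \<omega> = (\<Sum>i=1..n. b (\<tau> i) \<omega> * (W (\<tau> i) \<omega> - W (\<tau> (i - 1)) \<omega>))"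
    using AE_space
  proof eventually_elim
    case (elim \<omega>)
    then show ?case using elementary_integral_eq_sum[of b n \<tau> t \<omega>] * by simp
  qed
next
  fix t b B
  assume *: "0 \<le> t \<and> b \<in> L2_processes M F \<and> (\<forall>n. simple_process M F (B n) \<and> B n \<in> H2_processes M F) \<and>
    converges_in_probability M (\<lambda>n \<omega>. \<integral>s\<in>{0..t}. (b s \<omega> - B n s \<omega>)\<^sup>2 \<partial>lborel) (\<lambda>\<omega>. 0)"
  then have t: "0 \<le> t" and b: "b \<in> L2_processes M F" and Bs: "\<And>n. simple_process M F (B n)"
    and B: "\<And>n. B n \<in> L2_processes M F" and conv: "converges_in_probability M (\<lambda>n \<omega>. \<integral>s\<in>{0..t}. (b s \<omega> - B n s \<omega>)\<^sup>2 \<partial>lborel) (\<lambda>\<omega>. 0)"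
    using subsetD[OF H2_subset_L2] by simp_all
  have "quad_tendsto M b B t" using quad_tendsto_iff[OF b B t] conv by (rule iffD1)
  then have "converges_in_probability M (\<lambda>n. elementary_integral W (B n) t) (I b t)"
    by (rule limit_of_elementaryD[OF I[OF b] t Bs L2_D(1)[OF B]])
  moreover have "AE \<omega> in M. elementary_integral W (B n) t \<omega> = I (B n) t \<omega>" for n
    using limit_of_elementary_simple[OF I[OF B] Bs L2_D(1)[OF B] t] by eventually_elim (rule sym)
  ultimately show "converges_in_probability M (\<lambda>n. I (B n) t) (I b t)"
    by (intro converges_in_probability_cong_AE[OF elementary_integral_M[OF Bs t] limit_of_elementary_M[OF I[OF B] t]
          limit_of_elementary_M[OF I[OF b] t]])
qed

section \<open>Uniqueness\<close>

lemma stochastic_integral_mappingD: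
  assumes J: "stochastic_integral_mapping M F W J" and t: "0 \<le> t" and b: "b \<in> L2_processes M F"
  shows "simple_process M F b \<Longrightarrow> step_representation M b n \<tau> \<Longrightarrow> \<tau> n \<le> t \<Longrightarrow>
      AE \<omega> in M. J b t \<omega> = (\<Sum>i=1..n. b (\<tau> i) \<omega> * (W (\<tau> i) \<omega> - W (\<tau> (i - 1)) \<omega>))"
    and "(\<And>n. simple_process M F (B n)) \<Longrightarrow> (\<And>n. B n \<in> H2_processes M F) \<Longrightarrow>
      converges_in_probability M (\<lambda>n \<omega>. \<integral>s\<in>{0..t}. (b s \<omega> - B n s \<omega>)\<^sup>2 \<partial>lborel) (\<lambda>\<omega>. 0) \<Longrightarrow>
      converges_in_probability M (\<lambda>n. J (B n) t) (J b t)"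
proof -
  note J' = J[unfolded stochastic_integral_mapping_def, THEN conjunct2]
  show "AE \<omega> in M. J b t \<omega> = (\<Sum>i=1..n. b (\<tau> i) \<omega> * (W (\<tau> i) \<omega> - W (\<tau> (i - 1)) \<omega>))"
    if "simple_process M F b" "step_representation M b n \<tau>" "\<tau> n \<le> t"
    by (rule J'[THEN conjunct1, rule_format, of b t n \<tau>]) (use that t b in simp)
  show "converges_in_probability M (\<lambda>n. J (B n) t) (J b t)"
    if "\<And>n. simple_process M F (B n)" "\<And>n. B n \<in> H2_processes M F"
      "converges_in_probability M (\<lambda>n \<omega>. \<integral>s\<in>{0..t}. (b s \<omega> - B n s \<omega>)\<^sup>2 \<partial>lborel) (\<lambda>\<omega>. 0)"
    by (rule J'[THEN conjunct2, rule_format, of t b B]) (use that t b in simp)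
qed

text \<open>The first property fixes J almost surely on the approximating simple processes, the
  second carries this to b; \<open>X t\<close> is the limit in probability of the same elementary
  integrals.\<close>

lemma stochastic_integral_unique_at:
  assumes J: "stochastic_integral_mapping M F W J" and b: "b \<in> L2_processes M F"
    and X: "limit_of_elementary b X" and t: "0 < t"
  shows "AE \<omega> in M. J b t \<omega> = X t \<omega>"
proof -
  have t0: "0 \<le> t" using t by simp
  have Jm: "J c t \<in> borel_measurable M" if "c \<in> L2_processes M F" for c
  proof -
    have "J c \<in> continuous_adapted_processes M F"
      using J that unfolding stochastic_integral_mapping_def by blast
    then have "J c t \<in> borel_measurable (F t)" using t0 by (simp add: continuous_adapted_processes_def adapted_def)
    then show ?thesis by (rule measurable_F_M[OF t0])
  qed
  \<comment> \<open>The approximants depend on t, because the first property speaks about time t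
    only if the grid ends by t.\<close>
  define approx where "approx n c \<longleftrightarrow> simple_process M F c \<and> c \<in> H2_processes M F \<and>
    (\<exists>m \<sigma>. step_representation M c m \<sigma> \<and> \<sigma> m \<le> t) \<and>
    prob {\<omega>\<in>space M. ennreal ((1/2) ^ n) < quad (\<lambda>s \<omega>. b s \<omega> - c s \<omega>) t \<omega>} < (1/2) ^ n" for n c
  have "\<exists>c. approx n c" for n
  proof -
    have "(0::real) < (1/2) ^ n" by simp
    then obtain c m \<sigma> where "step_representation M c m \<sigma>" "\<sigma> m \<le> t" "simple_process M F c" "c \<in> H2_processes M F"
      "prob {\<omega>\<in>space M. ennreal ((1/2) ^ n) < quad (\<lambda>s \<omega>. b s \<omega> - c s \<omega>) t \<omega>} < (1/2) ^ n"
      by (rule approximation[OF b t])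
    then show ?thesis unfolding approx_def by (intro exI conjI)
  qed
  then obtain C where "\<And>n. approx n (C n)" by metis
  then have C: "\<And>n. \<exists>m \<sigma>. step_representation M (C n) m \<sigma> \<and> \<sigma> m \<le> t"
    "\<And>n. simple_process M F (C n)" "\<And>n. C n \<in> H2_processes M F"
    and p: "\<And>n. prob {\<omega>\<in>space M. ennreal ((1/2) ^ n) < quad (\<lambda>s \<omega>. b s \<omega> - C n s \<omega>) t \<omega>} < (1/2) ^ n"
    unfolding approx_def by simp_all
  have CL2: "C n \<in> L2_processes M F" for n using C(3) H2_subset_L2 by blast
  have conv: "quad_tendsto M b C t"
    unfolding quad_tendsto_def
  proof (intro allI impI)
    fix \<epsilon> :: real assume \<epsilon>: "0 < \<epsilon>"
    have p0: "(\<lambda>n. (1/2 :: real) ^ n) \<longlonglongrightarrow> 0" by (rule LIMSEQ_power_zero) simp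
    have qm[measurable]: "(\<lambda>\<omega>. quad (\<lambda>s \<omega>. b s \<omega> - C n s \<omega>) t \<omega>) \<in> borel_measurable M" for n
      by (rule quad_measurable jointly_measurable_diff L2_D(1)[OF b] L2_D(1)[OF CL2])+
    have "\<forall>\<^sub>F n in sequentially. (1/2) ^ n < \<epsilon>" by (rule order_tendstoD(2)[OF p0 \<epsilon>])
    then have ev: "\<forall>\<^sub>F n in sequentially.
      prob {\<omega>\<in>space M. ennreal \<epsilon> < quad (\<lambda>s \<omega>. b s \<omega> - C n s \<omega>) t \<omega>} \<le> (1/2) ^ n"
    proof eventually_elim
      case (elim n)
      have le: "ennreal ((1/2) ^ n) \<le> ennreal \<epsilon>" using elim by (intro ennreal_leI) simp
      have "prob {\<omega>\<in>space M. ennreal \<epsilon> < quad (\<lambda>s \<omega>. b s \<omega> - C n s \<omega>) t \<omega>} \<le>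
        prob {\<omega>\<in>space M. ennreal ((1/2) ^ n) < quad (\<lambda>s \<omega>. b s \<omega> - C n s \<omega>) t \<omega>}"
      proof (rule finite_measure_mono; safe?)
        show "ennreal ((1/2) ^ n) < quad (\<lambda>s \<omega>. b s \<omega> - C n s \<omega>) t \<omega>"
          if "ennreal \<epsilon> < quad (\<lambda>s \<omega>. b s \<omega> - C n s \<omega>) t \<omega>" for \<omega>
          by (rule order.strict_trans1[OF le that])
      qed measurable
      then show ?case using p[of n] by simp
    qed
    show "(\<lambda>n. prob {\<omega>\<in>space M. ennreal \<epsilon> < quad (\<lambda>s \<omega>. b s \<omega> - C n s \<omega>) t \<omega>}) \<longlonglongrightarrow> 0"
      by (rule tendsto_sandwich[OF _ ev tendsto_const p0]) simp
  qed
  have "converges_in_probability M (\<lambda>n \<omega>. \<integral>s\<in>{0..t}. (b s \<omega> - C n s \<omega>)\<^sup>2 \<partial>lborel) (\<lambda>\<omega>. 0)"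
    using quad_tendsto_iff[OF b CL2 t0] conv by (rule iffD2)
  then have "converges_in_probability M (\<lambda>n. J (C n) t) (J b t)"
    by (rule stochastic_integral_mappingD(2)[OF J t0 b C(2,3)])
  moreover have "AE \<omega> in M. J (C n) t \<omega> = elementary_integral W (C n) t \<omega>" for n
  proof -
    obtain m \<sigma> where m: "step_representation M (C n) m \<sigma>" "\<sigma> m \<le> t" using C(1) by blast
    have "AE \<omega> in M. J (C n) t \<omega> = (\<Sum>i=1..m. C n (\<sigma> i) \<omega> * (W (\<sigma> i) \<omega> - W (\<sigma> (i - 1)) \<omega>))"
      by (rule stochastic_integral_mappingD(1)[OF J t0 CL2 C(2) m])
    then show ?thesis
      using AE_space by eventually_elim (simp add: elementary_integral_eq_sum[OF m])
  qed
  ultimately have "converges_in_probability M (\<lambda>n. elementary_integral W (C n) t) (J b t)"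
    by (intro converges_in_probability_cong_AE[OF Jm[OF CL2] elementary_integral_M[OF C(2) t0] Jm[OF b]])
  moreover have "converges_in_probability M (\<lambda>n. elementary_integral W (C n) t) (X t)"
    by (rule limit_of_elementaryD[OF X t0 C(2) L2_D(1)[OF CL2] conv])
  ultimately show ?thesis
    by (intro converges_in_probability_unique[OF elementary_integral_M[OF C(2) t0] Jm[OF b] limit_of_elementary_M[OF X t0]])
qed

text \<open>Equality at each fixed time holds almost surely at all positive rational times together,
  and continuity of paths extends it to all times.\<close>

lemma stochastic_integral_unique:
  assumes J: "stochastic_integral_mapping M F W J" and b: "b \<in> L2_processes M F"
    and X: "limit_of_elementary b X"
  shows "indistinguishable M (J b) X"
proof -
  define D where "D = (\<rat> \<inter> {0<..} :: real set)"
  have cD: "countable D" unfolding D_def using countable_rat by blast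
  \<comment> \<open>Time 0, not covered by the previous lemma, is recovered as a limit of positive
    rationals.\<close>
  have clD: "closure D = {0..}"
    using closure_open_Int_superset[of "{0::real<..}" "\<rat>"] by (simp add: D_def closure_Rats Int_commute)
  have "AE \<omega> in M. \<forall>t\<in>D. J b t \<omega> = X t \<omega>"
    using stochastic_integral_unique_at[OF J b X] by (subst AE_ball_countable[OF cD]) (auto simp: D_def)
  then show ?thesis
    unfolding indistinguishable_def using AE_space
  proof eventually_elim
    case (elim \<omega>)
    have "continuous_on {0..} (\<lambda>t. J b t \<omega>)" "continuous_on {0..} (\<lambda>t. X t \<omega>)"
      using J b X elim(2)
      unfolding stochastic_integral_mapping_def limit_of_elementary_def continuous_adapted_processes_def continuous_process_def
      by blast+
    then have "continuous_on (closure D) (\<lambda>t. J b t \<omega> - X t \<omega>)" unfolding clD by (rule continuous_on_diff)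
    moreover have "\<forall>t\<in>D. norm (J b t \<omega> - X t \<omega>) \<le> 0" using elim(1) by simp
    ultimately have "norm (J b t \<omega> - X t \<omega>) \<le> 0" if "0 \<le> t" for t
      using continuous_on_closure_norm_le[of D "\<lambda>t. J b t \<omega> - X t \<omega>" 0 t] that unfolding clD by simp
    then show ?case by simp
  qed
qed

end

theorem theorem1:
  fixes M :: "'a measure" and F :: "real \<Rightarrow> 'a measure" and W :: "'a process"
  assumes "prob_space M" and "complete_measure M"
    and "augmented_filtration M F"
    and "standard_Wiener_process M F W"
  shows "\<exists>I. stochastic_integral_mapping M F W I \<and>
    (\<forall>J. stochastic_integral_mapping M F W J \<longrightarrow>
      (\<forall>b\<in>L2_processes M F. indistinguishable M (J b) (I b)))"
proof -
  interpret wiener M F W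
    using assms by (intro wiener.intro wiener_axioms.intro)
  \<comment> \<open>One limit process is selected for each integrand; outside
    \<open>L2_processes M F\<close> its value is arbitrary.\<close>
  define I where "I b = (SOME X. limit_of_elementary b X)" for b
  have I: "limit_of_elementary b (I b)" if "b \<in> L2_processes M F" for b
    unfolding I_def by (rule someI_ex[OF limit_of_elementary_exists[OF that]])
  show ?thesis
    using stochastic_integral_mapping_of_limits[OF I] stochastic_integral_unique[OF _ _ I] by blast
qed

end
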